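(* There are two inner functions $B$ and $\Theta$ on the upper half-plane $\mathbb{C}_+$ and an unbounded analytic function $\Psi$ on $\mathbb{C}_+$ such that $\Psi \mathscr{K}_B = \mathscr{K}_\Theta$.
   Context: $\mathbb{C}_+$ is the open upper half-plane and $\mathscr{H}^2$ is the Hardy space of $\mathbb{C}_+$. For an inner function $U$ on $\mathbb{C}_+$, the model space is $\mathscr{K}_U := \mathscr{H}^2 \cap (U\mathscr{H}^2)^{\perp}$. $\Psi\mathscr{K}_B=\{\Psi f: f\in\mathscr{K}_B\}$. *)

theory Defs
  imports "HOL-Complex_Analysis.Complex_Analysis"
begin

definition upper_half_plane :: "complex set" where
  "upper_half_plane = {z. 0 < Im z}"

text \<open>
  A function on the upper half-plane is represented by a total function. Members of the Hardy
  space are required to vanish off the half-plane, so that two of them are equal as HOL functions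
  iff they agree on the half-plane, and equality of sets of such functions has its usual meaning.
\<close>

definition hardy2 :: "(complex \<Rightarrow> complex) set" where
  "hardy2 = {f. f holomorphic_on upper_half_plane \<and>
                (\<forall>z. z \<notin> upper_half_plane \<longrightarrow> f z = 0) \<and>
                (SUP y\<in>{0<..}. \<integral>\<^sup>+x. ennreal ((cmod (f (Complex x y)))\<^sup>2) \<partial>lborel) < \<infinity>}"

text \<open>
  Vertical limits on the real line, the half-plane analogue of radial limits. Where the limit does
  not exist (a null set, for Hardy space functions and for bounded analytic functions) the value
  is the arbitrary one given by \<^const>\<open>Lim\<close>.
\<close>

definition boundary_value :: "(complex \<Rightarrow> complex) \<Rightarrow> real \<Rightarrow> complex" where
  "boundary_value f x = Lim (at_right 0) (\<lambda>y. f (Complex x y))"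

definition hardy2_inner :: "(complex \<Rightarrow> complex) \<Rightarrow> (complex \<Rightarrow> complex) \<Rightarrow> complex" where
  "hardy2_inner f g = (LINT x|lborel. boundary_value f x * cnj (boundary_value g x))"

definition hardy2_orthogonal :: "(complex \<Rightarrow> complex) set \<Rightarrow> (complex \<Rightarrow> complex) set" where
  "hardy2_orthogonal S = {f \<in> hardy2. \<forall>g\<in>S. hardy2_inner f g = 0}"

definition inner_function :: "(complex \<Rightarrow> complex) \<Rightarrow> bool" where
  "inner_function U \<longleftrightarrow>
     U holomorphic_on upper_half_plane \<and>
     bounded (U ` upper_half_plane) \<and>
     (AE x in lborel. \<exists>l. ((\<lambda>y. U (Complex x y)) \<longlongrightarrow> l) (at_right 0) \<and> cmod l = 1)"

definition mult_image ::
  "(complex \<Rightarrow> complex) \<Rightarrow> (complex \<Rightarrow> complex) set \<Rightarrow> (complex \<Rightarrow> complex) set" where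
  "mult_image h S = (\<lambda>f z. h z * f z) ` S"

definition model_space :: "(complex \<Rightarrow> complex) \<Rightarrow> (complex \<Rightarrow> complex) set" where
  "model_space U = hardy2 \<inter> hardy2_orthogonal (mult_image U hardy2)"

end

theory Submission
  imports Defs
begin

text \<open>
  The example comes from Clark measures. Take distinct nonzero real points \<open>t n\<close> tending to \<open>0\<close>, with
  masses \<open>m n > 0\<close> whose square roots are summable. Their Cauchy transform
  \<open>u z = (\<Sum>n. m n / (t n - z))\<close> has positive imaginary part on the half-plane and is real almost everywhere on the line, so its Cayley transform
  \<open>U = (u - \<i>) / (u + \<i>)\<close> is inner. At the point \<open>t n\<close> the function \<open>u\<close> has a pole and \<open>U\<close>
  takes the value \<open>1\<close>, and the functions
  \<open>E n z = 1 / ((u z + \<i>) * (t n - z))\<close> are multiples of the reproducing kernels of \<open>\<K>\<^sub>U\<close> at these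
  points. The algebraic identity
  \<open>(1 - U w * cnj (U x)) / (x - w) = 2 * \<i> * (\<Sum>n. m n * E n w * cnj (E n x))\<close> turns the
  reproducing formula of \<open>\<K>\<^sub>U\<close> into an expansion in the \<open>E n\<close>, which are orthogonal with
  \<open>\<parallel>E n\<parallel>\<^sup>2 = pi / m n\<close>. Hence \<open>\<K>\<^sub>U\<close> consists precisely of the sums of \<open>c n * m n * E n\<close> with
  \<open>\<Sum>n. m n * \<bar>c n\<bar>\<^sup>2 < \<infinity>\<close> (\<open>model_space_characterization\<close>).

  If the masses are replaced by comparable ones at the same points, the admissible coefficient
  sequences and the factors \<open>1 / (t n - z)\<close> stay the same, and only the outer factor \<open>1 / (u + \<i>)\<close>
  changes. So multiplication by the quotient \<open>\<Psi>\<close> of the two factors maps one model space onto the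
  other (\<open>mult_image_model_space\<close>). It remains to make \<open>\<Psi>\<close> unbounded: with atoms of mass \<open>2\<^sup>-\<^sup>k\<close> at the
  points \<open>\<plusminus>2\<^sup>-\<^sup>k\<close> the real parts of the terms of \<open>u\<close> cancel on the imaginary axis and \<open>u\<close> stays
  bounded there. Doubling the masses on the positive side destroys the cancellation, and \<open>Re u\<close> grows
  like \<open>ln (1 / y)\<close> as \<open>y\<close> tends to \<open>0\<close>.

  The inner product of the Hardy space is given by vertical boundary values of arbitrary members,
  so the argument rests on Fatou's theorem for the half-plane, which is proved first. For a
  function \<open>f\<close> of class \<open>H\<^sup>2\<close> the Poisson formula on a line inside the half-plane follows from
  Cauchy's formula on growing rectangles. The maximal inequality (\<open>vertical_max_bound\<close>) is
  obtained by the \<open>T T\<^sup>*\<close> argument: the linearised maximal operator \<open>T\<close> has a kernel for which \<open>T T\<^sup>*\<close> is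
  dominated by \<open>T + T\<^sup>*\<close>, so \<open>\<parallel>T\<parallel>\<^sup>2\<close> is at most a constant times \<open>\<parallel>T\<parallel>\<close>. Shifting contours shows
  that the translates \<open>f (z + \<i> * d)\<close> converge to \<open>f\<close> in norm, and with the maximal inequality this
  gives the limits almost everywhere (\<open>H2_vertical_limit\<close>).
\<close>

section \<open>The Poisson kernel and its maximal operator\<close>

definition poisson :: "real \<Rightarrow> real \<Rightarrow> real" where
  "poisson y t = y / (pi * (t\<^sup>2 + y\<^sup>2))"

lemma poisson_nonneg: "0 \<le> y \<Longrightarrow> 0 \<le> poisson y t"
  by (simp add: poisson_def)

lemma poisson_minus: "poisson y (s - t) = poisson y (t - s)"
  by (simp add: poisson_def power2_commute)

lemma borel_measurable_poisson [measurable]: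
  "f \<in> borel_measurable M \<Longrightarrow> g \<in> borel_measurable M \<Longrightarrow>
     (\<lambda>x. poisson (f x) (g x)) \<in> borel_measurable M"
  unfolding poisson_def by (intro borel_measurable_divide borel_measurable_times
    borel_measurable_add borel_measurable_power borel_measurable_const)

lemma nn_integral_poisson:
  assumes "y > 0"
  shows "(\<integral>\<^sup>+t. ennreal (poisson y (t - a)) \<partial>lborel) = 1"
proof -
  define p where "p = (\<lambda>x::real. 1 / (1 + x\<^sup>2))"
  have [measurable]: "p \<in> borel_measurable borel" unfolding p_def by measurable
  have half: "(\<integral>\<^sup>+x. ennreal (p x) * indicator {0..} x \<partial>lborel) = ennreal (pi / 2)"
    using nn_integral_FTC_atLeast[of p 0 arctan "pi / 2"]
    using DERIV_arctan by (auto simp: p_def tendsto_arctan_at_top inverse_eq_divide)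
  have "(\<integral>\<^sup>+x. ennreal (p x) * indicator {..<0} x \<partial>lborel) =
        (\<integral>\<^sup>+x. ennreal (p x) * indicator {0..} x \<partial>lborel)"
  proof -
    have "(\<integral>\<^sup>+x. ennreal (p x) * indicator {0..} x \<partial>lborel) =
          (\<integral>\<^sup>+x. ennreal (p (0 + -1 * x)) * indicator {0..} (0 + -1 * x) \<partial>lborel)"
      using nn_integral_real_affine[of "\<lambda>x. ennreal (p x) * indicator {0..} x" "-1" 0] by simp
    also have "\<dots> = (\<integral>\<^sup>+x. ennreal (p x) * indicator {..<0} x \<partial>lborel)"

    proof (intro nn_integral_cong_AE, use AE_lborel_singleton[of "0::real"] in eventually_elim)
      fix x :: real assume "x \<noteq> 0"
      then show "ennreal (p (0 + -1 * x)) * indicator {0..} (0 + -1 * x) =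
          ennreal (p x) * indicator {..<0} x"
        by (auto simp: p_def split: split_indicator)
    qed
    finally show ?thesis by simp
  qed
  moreover have "(\<integral>\<^sup>+x. ennreal (p x) \<partial>lborel) =
      (\<integral>\<^sup>+x. ennreal (p x) * indicator {..<0} x \<partial>lborel) +
      (\<integral>\<^sup>+x. ennreal (p x) * indicator {0..} x \<partial>lborel)"
    by (subst nn_integral_add[symmetric]) (auto intro!: nn_integral_cong split: split_indicator)
  ultimately have full: "(\<integral>\<^sup>+x. ennreal (p x) \<partial>lborel) = ennreal pi"
    using half by (simp flip: ennreal_plus)
  have "(\<integral>\<^sup>+t. ennreal (poisson y (t - a)) \<partial>lborel) =
        ennreal y * (\<integral>\<^sup>+x. ennreal (poisson y (y * x)) \<partial>lborel)"
    using nn_integral_real_affine[of "\<lambda>t. ennreal (poisson y (t - a))" y a] assms by simp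
  also have "(\<lambda>x. poisson y (y * x)) = (\<lambda>x. (1 / (pi * y)) * p x)"
  proof
    fix x
    have "(y * x)\<^sup>2 + y\<^sup>2 = y * (y * (1 + x\<^sup>2))" by (simp add: power2_eq_square algebra_simps)
    then show "poisson y (y * x) = (1 / (pi * y)) * p x"
      using assms by (simp add: poisson_def p_def divide_simps)
  qed
  also have "(\<integral>\<^sup>+x. ennreal ((1 / (pi * y)) * p x) \<partial>lborel) = ennreal (1 / (pi * y)) * ennreal pi"
    using assms by (subst full[symmetric], subst nn_integral_cmult[symmetric])
       (auto simp: ennreal_mult p_def simp flip: ennreal_mult intro!: nn_integral_cong)
  finally show ?thesis using assms by (simp flip: ennreal_mult)
qed

lemma poisson_half_le: "y > 0 \<Longrightarrow> poisson y (t / 2) \<le> 4 * poisson y t"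
proof -
  assume y: "y > 0"
  have pos: "t\<^sup>2 + y\<^sup>2 > 0" using y by (simp add: add_nonneg_pos)
  have "poisson y (t / 2) = 4 * (y / (pi * (t\<^sup>2 + 4 * y\<^sup>2)))"
    using y by (simp add: poisson_def power_divide divide_simps add_eq_0_iff)
  also have "\<dots> \<le> 4 * poisson y t"
    unfolding poisson_def using y pos
    by (intro mult_left_mono divide_left_mono mult_pos_pos add_nonneg_pos) auto
  finally show ?thesis .
qed

lemma poisson_antimono:
  assumes "y > 0" "\<bar>s\<bar> \<le> \<bar>t\<bar>" shows "poisson y t \<le> poisson y s"
proof -
  have "s\<^sup>2 \<le> t\<^sup>2" using assms(2) by (simp add: abs_le_square_iff)
  moreover have "0 < s\<^sup>2 + y\<^sup>2" using assms(1) by (simp add: add_nonneg_pos)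
  ultimately show ?thesis unfolding poisson_def using assms
    by (intro divide_left_mono mult_pos_pos mult_left_mono) auto
qed

text \<open>
  Exactly, the convolution is the Poisson kernel at height \<open>a + b\<close>. The weaker bound is all that the
  \<open>T T\<^sup>*\<close> argument uses, and it is elementary: every \<open>s\<close> is at distance at least
  \<open>\<bar>x - x'\<bar> / 2\<close> from \<open>x\<close> or from \<open>x'\<close>, the kernel centred there is at most four times its value at
  distance \<open>\<bar>x - x'\<bar>\<close>, and the other kernel has integral one.
\<close>
lemma poisson_convolution_le:
  assumes "a > 0" "b > 0"
  shows "(\<integral>\<^sup>+s. ennreal (poisson a (x - s)) * ennreal (poisson b (x' - s)) \<partial>lborel)
    \<le> 4 * (ennreal (poisson a (x - x')) + ennreal (poisson b (x - x')))"
proof -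
  have "ennreal (poisson a (x - s)) * ennreal (poisson b (x' - s)) \<le>
      ennreal (4 * poisson a (x - x')) * ennreal (poisson b (s - x')) +
      ennreal (4 * poisson b (x - x')) * ennreal (poisson a (s - x))" (is "?l s \<le> ?r s") for s
  proof -
    have "\<bar>(x - x') / 2\<bar> \<le> \<bar>x - s\<bar> \<or> \<bar>(x - x') / 2\<bar> \<le> \<bar>x' - s\<bar>"
    proof -
      have "\<bar>x - x'\<bar> \<le> \<bar>x - s\<bar> + \<bar>x' - s\<bar>" by linarith
      moreover have "\<bar>(x - x') / 2\<bar> = \<bar>x - x'\<bar> / 2" by simp
      moreover have "c / 2 \<le> p \<or> c / 2 \<le> q" if "c \<le> p + q" for c p q :: real
        using that by (intro disjCI) linarith
      ultimately show ?thesis by metis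
    qed
    then consider "\<bar>(x - x') / 2\<bar> \<le> \<bar>x - s\<bar>" | "\<bar>(x - x') / 2\<bar> \<le> \<bar>x' - s\<bar>" by blast
    then have "poisson a (x - s) * poisson b (x' - s) \<le>
      4 * poisson a (x - x') * poisson b (s - x') + 4 * poisson b (x - x') * poisson a (s - x)"
    proof cases
      case 1
      have "poisson a (x - s) \<le> 4 * poisson a (x - x')"
        using poisson_antimono[OF assms(1) 1] poisson_half_le[OF assms(1), of "x - x'"] by simp
      then have "poisson a (x - s) * poisson b (x' - s) \<le> 4 * poisson a (x - x') * poisson b (s - x')"
        using assms by (subst poisson_minus[of b]) (intro mult_right_mono poisson_nonneg, auto)
      then show ?thesis using assms by (simp add: add_increasing2 poisson_nonneg)
    next
      case 2
      have "poisson b (x' - s) \<le> 4 * poisson b (x - x')"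
        using poisson_antimono[OF assms(2) 2] poisson_half_le[OF assms(2), of "x - x'"] by simp
      then have "poisson b (x' - s) * poisson a (x - s) \<le> 4 * poisson b (x - x') * poisson a (s - x)"
        using assms by (subst poisson_minus[of a]) (intro mult_right_mono poisson_nonneg, auto)
      then show ?thesis using assms by (simp add: add_increasing poisson_nonneg mult.commute)
    qed
    then have "ennreal (poisson a (x - s) * poisson b (x' - s)) \<le> ennreal
      (4 * poisson a (x - x') * poisson b (s - x') + 4 * poisson b (x - x') * poisson a (s - x))"
      by (rule ennreal_leI)
    then show ?thesis using assms
      by (simp add: ennreal_mult' ennreal_plus poisson_nonneg)
  qed
  then have "(\<integral>\<^sup>+s. ?l s \<partial>lborel) \<le> (\<integral>\<^sup>+s. ?r s \<partial>lborel)"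
    by (intro nn_integral_mono)
  also have "\<dots> = ennreal (4 * poisson a (x - x')) + ennreal (4 * poisson b (x - x'))"
    using assms by (subst nn_integral_add) (simp_all add: nn_integral_cmult nn_integral_poisson)
  finally show ?thesis using assms by (simp add: ennreal_mult' distrib_left)
qed

text \<open>
  Write \<open>T\<close> for the operator with kernel \<open>K\<close> and put \<open>\<phi> = T f\<close>. Then \<open>\<parallel>\<phi>\<parallel>\<^sup>2 = \<langle>T\<^sup>* \<phi>, f\<rangle>\<close>, and the
  hypothesis on \<open>K\<close> says that \<open>T T\<^sup>*\<close> is dominated by \<open>C * (T + T\<^sup>*)\<close>, so
  \<open>\<parallel>T\<^sup>* \<phi>\<parallel>\<^sup>2 \<le> 2 * C * \<langle>\<phi>, T \<phi>\<rangle> \<le> 2 * C * sqrt L * \<parallel>\<phi>\<parallel>\<^sup>2\<close>. A finite bound \<open>L\<close> for the squared norm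
  of \<open>T\<close> is thereby replaced by \<open>2 * C * sqrt L\<close>.
\<close>
lemma kernel_operator_bound_improve:
  fixes K :: "real \<Rightarrow> real \<Rightarrow> ennreal" and C L :: real
  assumes K [measurable]: "case_prod K \<in> borel_measurable (borel \<Otimes>\<^sub>M borel)"
    and C: "0 \<le> C"
    and KK: "\<And>x x'. (\<integral>\<^sup>+s. K x s * K x' s \<partial>lborel) \<le> ennreal C * (K x x' + K x' x)"
    and L: "0 \<le> L" "\<And>f. f \<in> borel_measurable borel \<Longrightarrow>
      (\<integral>\<^sup>+x. (\<integral>\<^sup>+s. K x s * f s \<partial>lborel)\<^sup>2 \<partial>lborel) \<le> ennreal L * (\<integral>\<^sup>+s. (f s)\<^sup>2 \<partial>lborel)"
    and f [measurable]: "f \<in> borel_measurable borel"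
  shows "(\<integral>\<^sup>+x. (\<integral>\<^sup>+s. K x s * f s \<partial>lborel)\<^sup>2 \<partial>lborel)
           \<le> ennreal (2 * C * sqrt L) * (\<integral>\<^sup>+s. (f s)\<^sup>2 \<partial>lborel)"
proof -
  define \<phi> where "\<phi> = (\<lambda>x. \<integral>\<^sup>+s. K x s * f s \<partial>lborel)"
  have [measurable]: "\<phi> \<in> borel_measurable borel"
    unfolding \<phi>_def by measurable
  define F where "F = (\<integral>\<^sup>+s. (f s)\<^sup>2 \<partial>lborel)"
  define A where "A = (\<integral>\<^sup>+x. (\<phi> x)\<^sup>2 \<partial>lborel)"
  define \<psi> where "\<psi> = (\<lambda>s. \<integral>\<^sup>+x. \<phi> x * K x s \<partial>lborel)"
  have [measurable]: "\<psi> \<in> borel_measurable borel"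
    unfolding \<psi>_def by measurable
  define Q where "Q = (\<integral>\<^sup>+s. (\<psi> s)\<^sup>2 \<partial>lborel)"
  define T where "T = (\<integral>\<^sup>+x. (\<integral>\<^sup>+s. K x s * \<phi> s \<partial>lborel)\<^sup>2 \<partial>lborel)"
  have AL: "A \<le> ennreal L * F" using L(2)[OF f] by (simp add: A_def F_def \<phi>_def)
  have TL: "T \<le> ennreal L * A" using L(2)[of \<phi>] by (simp add: A_def T_def)
  have A_eq: "A = (\<integral>\<^sup>+s. \<psi> s * f s \<partial>lborel)"
  proof -
    have "A = (\<integral>\<^sup>+x. (\<integral>\<^sup>+s. \<phi> x * (K x s * f s) \<partial>lborel) \<partial>lborel)"
      unfolding A_def power2_eq_square by (subst (2) \<phi>_def) (simp add: nn_integral_cmult)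
    also have "\<dots> = (\<integral>\<^sup>+s. (\<integral>\<^sup>+x. \<phi> x * (K x s * f s) \<partial>lborel) \<partial>lborel)"
      by (rule lborel_pair.Fubini'[symmetric]) measurable
    also have "\<dots> = (\<integral>\<^sup>+s. \<psi> s * f s \<partial>lborel)"
      unfolding \<psi>_def by (simp add: nn_integral_multc mult.assoc[symmetric])
    finally show ?thesis .
  qed
  have A2: "A\<^sup>2 \<le> Q * F"
    unfolding A_eq Q_def F_def by (rule Cauchy_Schwarz_nn_integral) auto
  define J where "J = (\<integral>\<^sup>+x. \<phi> x * (\<integral>\<^sup>+x'. K x x' * \<phi> x' \<partial>lborel) \<partial>lborel)"
  have Q_le: "Q \<le> ennreal (2 * C) * J"
  proof -
    have "Q = (\<integral>\<^sup>+s. (\<integral>\<^sup>+x. (\<integral>\<^sup>+x'. \<phi> x * \<phi> x' * (K x s * K x' s) \<partial>lborel) \<partial>lborel) \<partial>lborel)"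
      unfolding Q_def power2_eq_square
    proof (rule nn_integral_cong)
      fix s
      have "\<psi> s * \<psi> s = (\<integral>\<^sup>+x. \<phi> x * K x s * \<psi> s \<partial>lborel)"
        by (subst \<psi>_def) (simp add: nn_integral_multc)
      also have "\<dots> = (\<integral>\<^sup>+x. (\<integral>\<^sup>+x'. \<phi> x * K x s * (\<phi> x' * K x' s) \<partial>lborel) \<partial>lborel)"
        by (subst \<psi>_def) (simp add: nn_integral_cmult)
      finally show "\<psi> s * \<psi> s =
        (\<integral>\<^sup>+x. (\<integral>\<^sup>+x'. \<phi> x * \<phi> x' * (K x s * K x' s) \<partial>lborel) \<partial>lborel)"
        by (simp add: mult_ac)
    qed
    also have "\<dots> = (\<integral>\<^sup>+x. (\<integral>\<^sup>+s. (\<integral>\<^sup>+x'. \<phi> x * \<phi> x' * (K x s * K x' s) \<partial>lborel) \<partial>lborel) \<partial>lborel)"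
      by (rule lborel_pair.Fubini') measurable
    also have "\<dots> = (\<integral>\<^sup>+x. (\<integral>\<^sup>+x'. (\<integral>\<^sup>+s. \<phi> x * \<phi> x' * (K x s * K x' s) \<partial>lborel) \<partial>lborel) \<partial>lborel)"
      by (intro nn_integral_cong lborel_pair.Fubini') measurable
    also have "\<dots> \<le> (\<integral>\<^sup>+x. (\<integral>\<^sup>+x'. \<phi> x * \<phi> x' * (ennreal C * (K x x' + K x' x)) \<partial>lborel) \<partial>lborel)"
      by (intro nn_integral_mono) (subst nn_integral_cmult, simp, intro mult_left_mono KK, simp)
    also have "\<dots> = (\<integral>\<^sup>+x. (\<integral>\<^sup>+x'. ennreal C * (\<phi> x * (K x x' * \<phi> x')) \<partial>lborel) \<partial>lborel) +
                    (\<integral>\<^sup>+x. (\<integral>\<^sup>+x'. ennreal C * (\<phi> x' * (K x' x * \<phi> x)) \<partial>lborel) \<partial>lborel)"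
      by (simp add: distrib_left mult_ac nn_integral_add)
    also have "(\<integral>\<^sup>+x. (\<integral>\<^sup>+x'. ennreal C * (\<phi> x' * (K x' x * \<phi> x)) \<partial>lborel) \<partial>lborel) =
               (\<integral>\<^sup>+x'. (\<integral>\<^sup>+x. ennreal C * (\<phi> x' * (K x' x * \<phi> x)) \<partial>lborel) \<partial>lborel)"
      by (rule lborel_pair.Fubini') measurable
    finally have "Q \<le> (\<integral>\<^sup>+x. (\<integral>\<^sup>+x'. ennreal C * (\<phi> x * (K x x' * \<phi> x')) \<partial>lborel) \<partial>lborel) +
       (\<integral>\<^sup>+x. (\<integral>\<^sup>+x'. ennreal C * (\<phi> x * (K x x' * \<phi> x')) \<partial>lborel) \<partial>lborel)" .
    also have "(\<integral>\<^sup>+x. (\<integral>\<^sup>+x'. ennreal C * (\<phi> x * (K x x' * \<phi> x')) \<partial>lborel) \<partial>lborel) = ennreal C * J"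
      unfolding J_def by (simp add: nn_integral_cmult)
    finally show ?thesis using C by (simp add: ennreal_mult mult_2 distrib_right mult.assoc flip: mult_2)
  qed
  have J2: "J\<^sup>2 \<le> A * T"
    unfolding J_def A_def T_def by (rule Cauchy_Schwarz_nn_integral) auto
  show ?thesis
  proof (cases "F = \<infinity> \<or> A = 0")
    case True
    then show ?thesis
    proof
      assume F: "F = \<infinity>"
      show ?thesis
      proof (cases "2 * C * sqrt L = 0")
        case True
        then consider "C = 0" | "L = 0" by auto
        then have "A = 0"
        proof cases
          assume "L = 0" then show ?thesis using AL by simp
        next
          assume "C = 0"
          then have "Q = 0" using Q_le by simp
          then have "AE s in lborel. \<psi> s = 0" unfolding Q_def
            by (subst (asm) nn_integral_0_iff_AE) auto
          then have "AE s in lborel. \<psi> s * f s = 0" by eventually_elim simp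
          then show ?thesis unfolding A_eq by (subst nn_integral_0_iff_AE) auto
        qed
        then show ?thesis by (simp add: A_def \<phi>_def)
      next
        case False
        then have "2 * C * sqrt L > 0" using C L by (simp add: zero_less_mult_iff)
        then have "ennreal (2 * C * sqrt L) \<noteq> 0" by (simp only: ennreal_eq_0_iff not_le)
        then have "ennreal (2 * C * sqrt L) * F = top"
          using F by (simp only: ennreal_mult_top infinity_ennreal_def if_False)
        then show ?thesis unfolding F_def by (simp only: top_greatest)
      qed
    next
      assume "A = 0" then show ?thesis by (simp add: A_def \<phi>_def)
    qed
  next
    case False
    then obtain F' where F': "F = ennreal F'" "0 \<le> F'" by (cases F) auto
    have "A \<le> ennreal (L * F')" using AL F' L by (simp add: ennreal_mult)
    then obtain A' where A': "A = ennreal A'" "0 \<le> A'" by (cases A) (auto simp: top_unique)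
    have "T \<le> ennreal (L * A')" using TL A' L by (simp add: ennreal_mult)
    then obtain T' where T': "T = ennreal T'" "0 \<le> T'" by (cases T) (auto simp: top_unique)
    have Tle: "T' \<le> L * A'" using \<open>T \<le> ennreal (L * A')\<close> T' A' L by simp
    have "J\<^sup>2 \<le> ennreal (A' * T')" using J2 A' T' by (simp add: ennreal_mult)
    then obtain J' where J': "J = ennreal J'" "0 \<le> J'"
    proof (cases J)
      case top
      then have "J\<^sup>2 = top" by (simp add: power2_eq_square)
      then show ?thesis using \<open>J\<^sup>2 \<le> ennreal (A' * T')\<close> by (simp add: top_unique)
    qed auto
    have "J'\<^sup>2 \<le> A' * T'" using \<open>J\<^sup>2 \<le> ennreal (A' * T')\<close> A' T' J'
      by (simp add: ennreal_power)
    also have "\<dots> \<le> A' * (L * A')" using Tle A' by (intro mult_left_mono) auto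
    also have "\<dots> = (sqrt L * A')\<^sup>2" using L by (simp add: power2_eq_square)
    finally have J_le: "J' \<le> sqrt L * A'" by (rule power2_le_imp_le) (use A' L in simp)
    have "Q \<le> ennreal (2 * C * J')" using Q_le J' C by (simp add: ennreal_mult)
    then obtain Q' where Q': "Q = ennreal Q'" "0 \<le> Q'" by (cases Q) (auto simp: top_unique)
    have "Q' \<le> 2 * C * J'" using \<open>Q \<le> ennreal (2 * C * J')\<close> Q' C J' by simp
    also have "\<dots> \<le> 2 * C * (sqrt L * A')" using J_le C by (intro mult_left_mono) auto
    finally have Q'_le: "Q' \<le> 2 * C * (sqrt L * A')" .
    have "A'\<^sup>2 \<le> Q' * F'" using A2 A' Q' F' by (simp add: ennreal_power flip: ennreal_mult)
    also have "\<dots> \<le> 2 * C * (sqrt L * A') * F'" using Q'_le F' by (intro mult_right_mono) auto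
    finally have "A' * A' \<le> (2 * C * sqrt L * F') * A'" by (simp add: power2_eq_square mult_ac)
    moreover have "A' > 0" using False A' by (auto simp: less_le)
    ultimately have "A' \<le> 2 * C * sqrt L * F'" by simp
    then have "A \<le> ennreal (2 * C * sqrt L) * F"
      using A' F' C L by (simp flip: ennreal_mult)
    then show ?thesis by (simp add: A_def F_def \<phi>_def)
  qed
qed

text \<open>
  The positive fixed point of the improvement \<open>L \<mapsto> 2 * C * sqrt L\<close> is \<open>4 * C\<^sup>2\<close>, and a valid bound of
  at least \<open>4 * C\<^sup>2 + 1\<close> can always be lowered by a fixed factor \<open>q < 1\<close>. The a priori bound \<open>L\<close> starts
  this iteration and does not enter the conclusion.
\<close>
lemma kernel_operator_bound:
  fixes K :: "real \<Rightarrow> real \<Rightarrow> ennreal" and C L :: real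
  assumes K: "case_prod K \<in> borel_measurable (borel \<Otimes>\<^sub>M borel)"
    and C: "0 \<le> C"
    and KK: "\<And>x x'. (\<integral>\<^sup>+s. K x s * K x' s \<partial>lborel) \<le> ennreal C * (K x x' + K x' x)"
    and L: "0 \<le> L" "\<And>f. f \<in> borel_measurable borel \<Longrightarrow>
      (\<integral>\<^sup>+x. (\<integral>\<^sup>+s. K x s * f s \<partial>lborel)\<^sup>2 \<partial>lborel) \<le> ennreal L * (\<integral>\<^sup>+s. (f s)\<^sup>2 \<partial>lborel)"
    and f: "f \<in> borel_measurable borel"
  shows "(\<integral>\<^sup>+x. (\<integral>\<^sup>+s. K x s * f s \<partial>lborel)\<^sup>2 \<partial>lborel)
           \<le> ennreal (4 * C\<^sup>2 + 1) * (\<integral>\<^sup>+s. (f s)\<^sup>2 \<partial>lborel)"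
proof -
  define S where "S = {M::real. 0 \<le> M \<and> (\<forall>f\<in>borel_measurable borel.
      (\<integral>\<^sup>+x. (\<integral>\<^sup>+s. K x s * f s \<partial>lborel)\<^sup>2 \<partial>lborel) \<le> ennreal M * (\<integral>\<^sup>+s. (f s)\<^sup>2 \<partial>lborel))}"
  have "\<exists>M\<in>S. M < 4 * C\<^sup>2 + 1"
  proof (rule ccontr)
    assume "\<not> (\<exists>M\<in>S. M < 4 * C\<^sup>2 + 1)"
    then have big: "4 * C\<^sup>2 + 1 \<le> M" if "M \<in> S" for M using that by force
    define q where "q = 2 * C / sqrt (4 * C\<^sup>2 + 1)"
    have "2 * C = sqrt (4 * C\<^sup>2)" using C by (simp add: real_sqrt_mult)
    also have "\<dots> < sqrt (4 * C\<^sup>2 + 1)" by (rule real_sqrt_less_mono) simp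
    finally have q: "0 \<le> q" "q < 1" using C by (simp_all add: q_def add_nonneg_pos)
    have Sq: "q * M \<in> S" if M: "M \<in> S" for M
    proof -
      have "2 * C * sqrt M \<le> q * M"
      proof -
        have M0: "M > 0" "4 * C\<^sup>2 + 1 > 0" using big[OF M] by (auto simp: add_nonneg_pos intro: less_le_trans[rotated])
        have "sqrt M * sqrt (4 * C\<^sup>2 + 1) \<le> sqrt M * sqrt M"
          using big[OF M] M0 by (intro mult_left_mono) auto
        then have "sqrt M \<le> M / sqrt (4 * C\<^sup>2 + 1)" using M0 by (simp add: field_simps)
        then have "2 * C * sqrt M \<le> 2 * C * (M / sqrt (4 * C\<^sup>2 + 1))" using C by (intro mult_left_mono) auto
        then show ?thesis by (simp add: q_def)
      qed
      then have le: "ennreal (2 * C * sqrt M) \<le> ennreal (q * M)" by (rule ennreal_leI)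
      have "(\<integral>\<^sup>+x. (\<integral>\<^sup>+s. K x s * f s \<partial>lborel)\<^sup>2 \<partial>lborel) \<le> ennreal (q * M) * (\<integral>\<^sup>+s. (f s)\<^sup>2 \<partial>lborel)"
        if "f \<in> borel_measurable borel" for f
        using kernel_operator_bound_improve[OF K C KK _ _ that, of M] M mult_right_mono[OF le]
        unfolding S_def by (auto intro: order_trans)
      then show ?thesis using M q by (auto simp: S_def)
    qed
    have pw: "q ^ n * L \<in> S" for n
    proof (induction n)
      case 0 then show ?case using L by (auto simp: S_def)
    next
      case (Suc n) then show ?case using Sq[OF Suc] by (simp add: mult.assoc)
    qed
    have "(\<lambda>n. q ^ n * L) \<longlonglongrightarrow> 0 * L"
      by (intro tendsto_mult LIMSEQ_power_zero tendsto_const) (use q in auto)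
    then have "eventually (\<lambda>n. q ^ n * L < 1) sequentially"
      by (intro order_tendstoD) auto
    then obtain n where "q ^ n * L < 1" by (auto simp: eventually_sequentially)
    moreover have "4 * C\<^sup>2 \<ge> 0" by simp
    ultimately show False using big[OF pw[of n]] by linarith
  qed
  then obtain M where M: "M \<in> S" "M < 4 * C\<^sup>2 + 1" by auto
  have "(\<integral>\<^sup>+x. (\<integral>\<^sup>+s. K x s * f s \<partial>lborel)\<^sup>2 \<partial>lborel) \<le> ennreal M * (\<integral>\<^sup>+s. (f s)\<^sup>2 \<partial>lborel)"
    using M f by (auto simp: S_def)
  also have "\<dots> \<le> ennreal (4 * C\<^sup>2 + 1) * (\<integral>\<^sup>+s. (f s)\<^sup>2 \<partial>lborel)"
    using M by (intro mult_right_mono ennreal_leI) auto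
  finally show ?thesis .
qed

text \<open>
  Jensen's inequality for the probability density \<open>poisson y\<close>, obtained from Cauchy-Schwarz by
  splitting the kernel into two square roots, followed by Tonelli.
\<close>
lemma nn_integral_poisson_convolution_square:
  assumes y: "y > 0" and [measurable]: "f \<in> borel_measurable borel"
  shows "(\<integral>\<^sup>+x. (\<integral>\<^sup>+s. ennreal (poisson y (x - s)) * f s \<partial>lborel)\<^sup>2 \<partial>lborel) \<le> (\<integral>\<^sup>+s. (f s)\<^sup>2 \<partial>lborel)"
proof -
  have sq: "ennreal (sqrt (poisson y t)) * ennreal (sqrt (poisson y t)) = ennreal (poisson y t)" for t
    using y by (simp add: poisson_nonneg flip: ennreal_mult)
  have "(\<integral>\<^sup>+s. ennreal (poisson y (x - s)) * f s \<partial>lborel)\<^sup>2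
      \<le> (\<integral>\<^sup>+s. ennreal (poisson y (x - s)) * (f s)\<^sup>2 \<partial>lborel)" for x
  proof -
    have "(\<integral>\<^sup>+s. ennreal (poisson y (x - s)) * f s \<partial>lborel)\<^sup>2 =
       (\<integral>\<^sup>+s. ennreal (sqrt (poisson y (x - s))) * (ennreal (sqrt (poisson y (x - s))) * f s) \<partial>lborel)\<^sup>2"
      by (simp add: sq flip: mult.assoc)
    also have "\<dots> \<le> (\<integral>\<^sup>+s. (ennreal (sqrt (poisson y (x - s))))\<^sup>2 \<partial>lborel) *
        (\<integral>\<^sup>+s. (ennreal (sqrt (poisson y (x - s))) * f s)\<^sup>2 \<partial>lborel)"
      by (rule Cauchy_Schwarz_nn_integral) measurable
    also have "\<dots> = 1 * (\<integral>\<^sup>+s. ennreal (poisson y (x - s)) * (f s)\<^sup>2 \<partial>lborel)"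
      using nn_integral_poisson[OF y, of x]
      unfolding power_mult_distrib poisson_minus[of y x] by (simp add: power2_eq_square[of "ennreal _"] sq)
    finally show ?thesis by simp
  qed
  then have "(\<integral>\<^sup>+x. (\<integral>\<^sup>+s. ennreal (poisson y (x - s)) * f s \<partial>lborel)\<^sup>2 \<partial>lborel)
      \<le> (\<integral>\<^sup>+x. (\<integral>\<^sup>+s. ennreal (poisson y (x - s)) * (f s)\<^sup>2 \<partial>lborel) \<partial>lborel)"
    by (intro nn_integral_mono)
  also have "\<dots> = (\<integral>\<^sup>+s. (\<integral>\<^sup>+x. ennreal (poisson y (x - s)) * (f s)\<^sup>2 \<partial>lborel) \<partial>lborel)"
    by (rule lborel_pair.Fubini'[symmetric]) measurable
  also have "\<dots> = (\<integral>\<^sup>+s. (f s)\<^sup>2 \<partial>lborel)"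
    by (simp add: nn_integral_multc nn_integral_poisson[OF y])
  finally show ?thesis .
qed

text \<open>
  A maximal operator is linearised by letting the height \<open>\<tau> x\<close> depend on the point. The bounds \<open>a\<close> and \<open>b\<close> give
  the finite a priori bound \<open>(b / a)\<^sup>2\<close>, but the resulting constant does not depend on them; it is
  \<open>4 * C\<^sup>2 + 1\<close> with the constant \<open>C = 4\<close> of \<open>poisson_convolution_le\<close>.
\<close>
lemma poisson_maximal_bound:
  assumes \<tau> [measurable]: "\<tau> \<in> borel_measurable borel" and ab: "0 < a" "\<And>x. a \<le> \<tau> x" "\<And>x. \<tau> x \<le> b"
    and f: "f \<in> borel_measurable borel"
  shows "(\<integral>\<^sup>+x. (\<integral>\<^sup>+s. ennreal (poisson (\<tau> x) (x - s)) * f s \<partial>lborel)\<^sup>2 \<partial>lborel)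
           \<le> ennreal 65 * (\<integral>\<^sup>+s. (f s)\<^sup>2 \<partial>lborel)"
proof -
  have tpos: "\<tau> x > 0" for x using ab(1) ab(2)[of x] by linarith
  have bpos: "b > 0" using tpos[of 0] ab(3)[of 0] by linarith
  let ?K = "\<lambda>x s. ennreal (poisson (\<tau> x) (x - s))"
  have "(\<integral>\<^sup>+x. (\<integral>\<^sup>+s. ?K x s * f s \<partial>lborel)\<^sup>2 \<partial>lborel) \<le> ennreal (4 * 4\<^sup>2 + 1) * (\<integral>\<^sup>+s. (f s)\<^sup>2 \<partial>lborel)"
  proof (rule kernel_operator_bound[where L = "(b / a)\<^sup>2"])
    show "case_prod ?K \<in> borel_measurable (borel \<Otimes>\<^sub>M borel)" by measurable
    show "(\<integral>\<^sup>+s. ?K x s * ?K x' s \<partial>lborel) \<le> ennreal 4 * (?K x x' + ?K x' x)" for x x'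
      using poisson_convolution_le[OF tpos tpos, of x x x' x'] by (simp add: poisson_minus[of _ x' x])
  next
    fix f :: "real \<Rightarrow> ennreal" assume [measurable]: "f \<in> borel_measurable borel"
    have "(\<integral>\<^sup>+s. ?K x s * f s \<partial>lborel) \<le> ennreal (b / a) * (\<integral>\<^sup>+s. ennreal (poisson a (x - s)) * f s \<partial>lborel)" for x
    proof -
      have "poisson (\<tau> x) t \<le> b / a * poisson a t" for t
      proof -
        have "\<tau> x / (pi * (t\<^sup>2 + (\<tau> x)\<^sup>2)) \<le> b / (pi * (t\<^sup>2 + a\<^sup>2))"
          using ab tpos[of x] bpos
          by (intro frac_le mult_left_mono add_left_mono power_mono) (auto intro!: mult_pos_pos add_nonneg_pos)
        then show ?thesis using ab by (simp add: poisson_def)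
      qed
      then have "?K x s \<le> ennreal (b / a) * ennreal (poisson a (x - s))" for s
        using ab bpos by (subst ennreal_mult[symmetric]) (auto intro: ennreal_leI simp: poisson_nonneg)
      then have "(\<integral>\<^sup>+s. ?K x s * f s \<partial>lborel) \<le> (\<integral>\<^sup>+s. ennreal (b / a) * ennreal (poisson a (x - s)) * f s \<partial>lborel)"
        by (intro nn_integral_mono mult_right_mono) auto
      then show ?thesis by (simp add: nn_integral_cmult mult.assoc)
    qed
    then have "(\<integral>\<^sup>+x. (\<integral>\<^sup>+s. ?K x s * f s \<partial>lborel)\<^sup>2 \<partial>lborel) \<le>
       (\<integral>\<^sup>+x. (ennreal (b / a) * (\<integral>\<^sup>+s. ennreal (poisson a (x - s)) * f s \<partial>lborel))\<^sup>2 \<partial>lborel)"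
      by (intro nn_integral_mono power_mono) auto
    also have "\<dots> = ennreal ((b / a)\<^sup>2) * (\<integral>\<^sup>+x. (\<integral>\<^sup>+s. ennreal (poisson a (x - s)) * f s \<partial>lborel)\<^sup>2 \<partial>lborel)"
      using ab bpos by (simp add: power_mult_distrib nn_integral_cmult ennreal_power del: ennreal_power[symmetric])
    also have "\<dots> \<le> ennreal ((b / a)\<^sup>2) * (\<integral>\<^sup>+s. (f s)\<^sup>2 \<partial>lborel)"
      by (intro mult_left_mono nn_integral_poisson_convolution_square) (use ab in auto)
    finally show "(\<integral>\<^sup>+x. (\<integral>\<^sup>+s. ?K x s * f s \<partial>lborel)\<^sup>2 \<partial>lborel)
      \<le> ennreal ((b / a)\<^sup>2) * (\<integral>\<^sup>+s. (f s)\<^sup>2 \<partial>lborel)" .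
  qed (use f in auto)
  then show ?thesis by simp
qed

section \<open>Shifting horizontal contours\<close>

lemma ennreal_le_of_power2_le:
  assumes "a\<^sup>2 \<le> (ennreal b)\<^sup>2" "0 \<le> b" shows "a \<le> ennreal b"
proof (cases a)
  case (real r)
  then have "ennreal (r\<^sup>2) \<le> ennreal (b\<^sup>2)" using assms by (simp add: ennreal_power)
  then have "r\<^sup>2 \<le> b\<^sup>2" by (simp add: ennreal_le_iff)
  then have "r \<le> b" using assms(2) by (rule power2_le_imp_le)
  then show ?thesis using real by (simp add: ennreal_leI)
next
  case top
  then have "a\<^sup>2 = top" by (simp add: power2_eq_square)
  then show ?thesis using assms by (simp add: ennreal_power top_unique)
qed

lemma L2_product:
  fixes f g :: "real \<Rightarrow> complex"
  assumes [measurable]: "f \<in> borel_measurable borel" "g \<in> borel_measurable borel"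
    and f: "(\<integral>\<^sup>+x. ennreal ((cmod (f x))\<^sup>2) \<partial>lborel) \<le> ennreal A"
    and g: "(\<integral>\<^sup>+x. ennreal ((cmod (g x))\<^sup>2) \<partial>lborel) \<le> ennreal B"
    and AB: "0 \<le> A" "0 \<le> B"
  shows "(\<integral>\<^sup>+x. ennreal (cmod (f x * g x)) \<partial>lborel) \<le> ennreal (sqrt (A * B))"
    and "integrable lborel (\<lambda>x. f x * g x)"
    and "cmod (LINT x|lborel. f x * g x) \<le> sqrt (A * B)"
proof -
  let ?I = "\<integral>\<^sup>+x. ennreal (cmod (f x * g x)) \<partial>lborel"
  have "?I\<^sup>2 = (\<integral>\<^sup>+x. ennreal (cmod (f x)) * ennreal (cmod (g x)) \<partial>lborel)\<^sup>2"
    by (simp add: norm_mult ennreal_mult)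
  also have "\<dots> \<le> (\<integral>\<^sup>+x. (ennreal (cmod (f x)))\<^sup>2 \<partial>lborel) * (\<integral>\<^sup>+x. (ennreal (cmod (g x)))\<^sup>2 \<partial>lborel)"
    by (rule Cauchy_Schwarz_nn_integral) measurable
  also have "\<dots> \<le> ennreal A * ennreal B"
    using f g by (intro mult_mono) (auto simp: ennreal_power)
  also have "\<dots> = (ennreal (sqrt (A * B)))\<^sup>2"
    using AB by (simp add: ennreal_power flip: ennreal_mult)
  finally show I: "?I \<le> ennreal (sqrt (A * B))"
    by (rule ennreal_le_of_power2_le) (use AB in simp)
  show int: "integrable lborel (\<lambda>x. f x * g x)"
    by (rule integrableI_bounded) (use I in \<open>auto intro: le_less_trans\<close>)
  have "ennreal (cmod (LINT x|lborel. f x * g x)) \<le> ?I"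
    by (rule integral_norm_bound_ennreal[OF int])
  then have "ennreal (cmod (LINT x|lborel. f x * g x)) \<le> ennreal (sqrt (A * B))"
    using I by simp
  then show "cmod (LINT x|lborel. f x * g x) \<le> sqrt (A * B)"
    using AB by (simp add: ennreal_le_iff)
qed

lemma contour_integral_linepath_horizontal:
  assumes "a < b"
  shows "contour_integral (linepath (Complex a c) (Complex b c)) f = integral {a..b} (\<lambda>x. f (Complex x c))"
proof -
  have "contour_integral (linepath (Complex a c) (Complex b c)) f =
        of_real (b - a) * integral {0..1} (\<lambda>x. f (Complex (a + (b - a) * x) c))"
  proof -
    have "linepath (Complex a c) (Complex b c) x = Complex (a + (b - a) * x) c" for x
      by (simp add: linepath_def complex_eq_iff algebra_simps)
    moreover have "Complex b c - Complex a c = of_real (b - a)" by (simp add: complex_eq_iff)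
    ultimately show ?thesis by (simp add: contour_integral_integral)
  qed
  also have "integral {0..1} (\<lambda>x. f (Complex (a + (b - a) * x) c)) =
      integral ((\<lambda>x. x / (b - a)) ` {0..b - a}) (\<lambda>x. f (Complex (a + (b - a) * x) c))"
    using assms by simp
  also have "\<dots> = integral {a-a..b-a} (\<lambda>x. f (Complex (x + a) c)) / of_real (b - a)"
    using assms by (subst integral_stretch_real) (auto simp: scaleR_conv_of_real add_ac)
  also have "\<dots> = integral {a..b} (\<lambda>x. f (Complex x c)) / of_real (b - a)"
    by (subst integral_shift_real_ivl) (rule refl)
  finally show ?thesis using assms by simp
qed

lemma integral_interval_tendsto_LINT:
  fixes f :: "real \<Rightarrow> complex"
  assumes f: "integrable lborel f"
  shows "((\<lambda>X. integral {-X..X} f) \<longlongrightarrow> (LINT x|lborel. f x)) at_top"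
proof -
  have "((\<lambda>X. LINT x|lborel. indicator {-X..X} x *\<^sub>R f x) \<longlongrightarrow> (LINT x|lborel. f x)) at_top"
  proof (rule integral_dominated_convergence_at_top[where w = "\<lambda>x. cmod (f x)"])
    show "AE x in lborel. ((\<lambda>X. indicator {-X..X} x *\<^sub>R f x) \<longlongrightarrow> f x) at_top"
    proof (rule AE_I2)
      fix x :: real
      have "eventually (\<lambda>X. indicator {-X..X} x *\<^sub>R f x = f x) at_top"
        using eventually_ge_at_top[of "\<bar>x\<bar>"] by eventually_elim (auto simp: indicator_def)
      then show "((\<lambda>X. indicator {-X..X} x *\<^sub>R f x) \<longlongrightarrow> f x) at_top"
        by (rule tendsto_eventually)
    qed
  qed (use f in \<open>auto simp: indicator_def\<close>)
  moreover have "(LINT x|lborel. indicator {-X..X} x *\<^sub>R f x) = integral {-X..X} f" for X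
  proof -
    have "set_integrable lborel {-X..X} f"
      using f unfolding set_integrable_def by (intro integrable_mult_indicator) auto
    from set_borel_integral_eq_integral(2)[OF this] show ?thesis
      by (simp add: set_lebesgue_integral_def)
  qed
  ultimately show ?thesis by simp
qed

text \<open>
  The integral over the rectangle with vertical sides at \<open>\<plusminus>X\<close> is the same number \<open>c\<close> for all large \<open>X\<close>. The
  two sides cannot both stay bounded away from zero in total, because by Tonelli their lengthwise
  integrals are integrable in \<open>X\<close>. So bounds for the \<open>L\<^sup>1\<close> norms of \<open>h\<close> on horizontal lines replace
  pointwise decay. The point \<open>w\<close> is where \<open>h\<close> may have a pole.
\<close>
lemma horizontal_integral_shift_residue:
  fixes h :: "complex \<Rightarrow> complex"
  assumes y: "y1 < y2"
    and w: "y1 < Im w" "Im w < y2" "\<bar>Re w\<bar> < X0"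
    and cont: "continuous_on ({z. y1 \<le> Im z \<and> Im z \<le> y2} - {w}) h"
    and rect: "\<And>X. X0 \<le> X \<Longrightarrow> (h has_contour_integral c) (rectpath (Complex (-X) y1) (Complex X y2))"
    and int: "integrable lborel (\<lambda>x. h (Complex x y1))" "integrable lborel (\<lambda>x. h (Complex x y2))"
    and bound: "\<And>y. y1 \<le> y \<Longrightarrow> y \<le> y2 \<Longrightarrow>
      (\<integral>\<^sup>+x. indicator {x. X0 \<le> \<bar>x\<bar>} x * ennreal (cmod (h (Complex x y))) \<partial>lborel) \<le> ennreal C"
  shows "(LINT x|lborel. h (Complex x y1)) - (LINT x|lborel. h (Complex x y2)) = c"
proof (rule ccontr)
  assume ne: "\<not> ?thesis"
  define d where "d = cmod ((LINT x|lborel. h (Complex x y1)) - (LINT x|lborel. h (Complex x y2)) - c)"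
  have d: "d > 0" using ne by (simp add: d_def)
  have X0: "X0 > 0" using w by linarith
  define J where "J = (\<lambda>X. integral {-X..X} (\<lambda>x. h (Complex x y1)) - integral {-X..X} (\<lambda>x. h (Complex x y2)))"
  have "((\<lambda>X. cmod (J X - c)) \<longlongrightarrow> d) at_top"
    unfolding J_def d_def by (intro tendsto_intros integral_interval_tendsto_LINT int)
  then have "eventually (\<lambda>X. d / 2 < cmod (J X - c)) at_top"
    by (rule order_tendstoD) (use d in simp)
  then obtain X1 where X1: "\<And>X. X \<ge> X1 \<Longrightarrow> d / 2 < cmod (J X - c)"
    by (auto simp: eventually_at_top_linorder)
  define X2 where "X2 = max X0 X1"
  define k where "k = (\<lambda>x y. indicator ({x. X0 \<le> \<bar>x\<bar>} \<times> {y1..y2}) (x, y) * ennreal (cmod (h (Complex x y))))"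
  have k_meas: "case_prod k \<in> borel_measurable (borel \<Otimes>\<^sub>M borel)"
  proof -
    define A where "A = {x::real. X0 \<le> \<bar>x\<bar>} \<times> {y1..y2}"
    have clA: "closed A" unfolding A_def by (intro closed_Times closed_Collect_le continuous_intros)
    have "continuous_on A (\<lambda>p. cmod (h (Complex (fst p) (snd p))))"
    proof (rule continuous_on_norm, rule continuous_on_compose2[OF cont])
      show "continuous_on A (\<lambda>p. Complex (fst p) (snd p))"
        unfolding Complex_eq by (intro continuous_intros)
      show "(\<lambda>p. Complex (fst p) (snd p)) ` A \<subseteq> {z. y1 \<le> Im z \<and> Im z \<le> y2} - {w}"
        using w by (auto simp: A_def)
    qed
    from borel_measurable_continuous_on_indicator[OF borel_closed[OF clA] this]
    have "(\<lambda>p. indicator A p *\<^sub>R cmod (h (Complex (fst p) (snd p)))) \<in> borel_measurable borel" .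
    then have "(\<lambda>p. ennreal (indicator A p *\<^sub>R cmod (h (Complex (fst p) (snd p))))) \<in> borel_measurable (borel \<Otimes>\<^sub>M borel)"
      by (simp add: borel_prod)
    moreover have "case_prod k = (\<lambda>p. ennreal (indicator A p *\<^sub>R cmod (h (Complex (fst p) (snd p)))))"
      by (auto simp: k_def A_def fun_eq_iff split: split_indicator)
    ultimately show ?thesis by simp
  qed
  note [measurable] = k_meas
  define S where "S = (\<lambda>X. \<integral>\<^sup>+y. k X y + k (-X) y \<partial>lborel)"
  have [measurable]: "S \<in> borel_measurable borel" unfolding S_def by measurable
  have S_ge: "ennreal (d / 2) \<le> S X" if X: "X \<ge> X2" for X
  proof -
    have XX: "X \<ge> X0" "X \<ge> X1" "X > 0" using X X0 by (auto simp: X2_def)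
    define a1 a2 a3 a4 where "a1 = Complex (-X) y1" and "a2 = Complex X y1" and "a3 = Complex X y2" and "a4 = Complex (-X) y2"
    have sub: "closed_segment a1 a2 \<subseteq> {z. y1 \<le> Im z \<and> Im z \<le> y2} - {w}"
        "closed_segment a2 a3 \<subseteq> {z. y1 \<le> Im z \<and> Im z \<le> y2} - {w}"
        "closed_segment a4 a3 \<subseteq> {z. y1 \<le> Im z \<and> Im z \<le> y2} - {w}"
        "closed_segment a1 a4 \<subseteq> {z. y1 \<le> Im z \<and> Im z \<le> y2} - {w}"
      using XX w y unfolding a1_def a2_def a3_def a4_def
      by (auto simp: closed_segment_same_Im closed_segment_same_Re closed_segment_eq_real_ivl)
    note cs = sub[THEN continuous_on_subset[OF cont]]
    note ci = cs[THEN contour_integrable_continuous_linepath]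
    have cs': "continuous_on (closed_segment a3 a4) h" "continuous_on (closed_segment a4 a1) h"
      using cs(3,4) by (simp_all add: closed_segment_commute)
    note ci' = cs'[THEN contour_integrable_continuous_linepath]
    have "c = contour_integral (rectpath a1 a3) h"
      using rect[OF XX(1)] unfolding a1_def a3_def by (rule contour_integral_unique[symmetric])
    also have "\<dots> = contour_integral (linepath a1 a2) h + (contour_integral (linepath a2 a3) h +
        (contour_integral (linepath a3 a4) h + contour_integral (linepath a4 a1) h))"
      unfolding rectpath_def Let_def using ci ci'
      by (simp add: a1_def a2_def a3_def a4_def)
    also have "contour_integral (linepath a3 a4) h = - contour_integral (linepath a4 a3) h"
      by (rule contour_integral_reverse_linepath[OF cs'(1)])
    also have "contour_integral (linepath a4 a1) h = - contour_integral (linepath a1 a4) h"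
      by (rule contour_integral_reverse_linepath[OF cs'(2)])
    also have "contour_integral (linepath a1 a2) h = integral {-X..X} (\<lambda>x. h (Complex x y1))"
      unfolding a1_def a2_def using XX by (intro contour_integral_linepath_horizontal) auto
    also have "contour_integral (linepath a4 a3) h = integral {-X..X} (\<lambda>x. h (Complex x y2))"
      unfolding a4_def a3_def using XX by (intro contour_integral_linepath_horizontal) auto
    finally have "J X - c = contour_integral (linepath a1 a4) h - contour_integral (linepath a2 a3) h"
      by (simp add: J_def algebra_simps)
    also have "cmod \<dots> \<le> cmod (contour_integral (linepath a1 a4) h) + cmod (contour_integral (linepath a2 a3) h)"
      by (rule norm_triangle_ineq4)
    finally have le: "cmod (J X - c) \<le> cmod (contour_integral (linepath a1 a4) h) + cmod (contour_integral (linepath a2 a3) h)" .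
    have side: "ennreal (cmod (contour_integral (linepath (Complex s y1) (Complex s y2)) h)) \<le> (\<integral>\<^sup>+y. k s y \<partial>lborel)"
      if s: "X0 \<le> \<bar>s\<bar>" for s
    proof -
      have "continuous_on {y1..y2} (\<lambda>y. h (Complex s y))"
      proof (rule continuous_on_compose2[OF cont])
        show "continuous_on {y1..y2} (Complex s)" unfolding Complex_eq by (intro continuous_intros)
        show "Complex s ` {y1..y2} \<subseteq> {z. y1 \<le> Im z \<and> Im z \<le> y2} - {w}" using s w by auto
      qed
      then have si: "set_integrable lborel {y1..y2} (\<lambda>y. h (Complex s y))"
        by (rule borel_integrable_atLeastAtMost')
      have "cmod (contour_integral (linepath (Complex s y1) (Complex s y2)) h) = cmod (integral {y1..y2} (\<lambda>y. h (Complex s y)))"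
        using y by (subst contour_integral_linepath_same_Re[where c = s and a = y1 and b = y2]) (auto simp: norm_mult)
      also have "\<dots> = cmod (LINT y|lborel. indicator {y1..y2} y *\<^sub>R h (Complex s y))"
        using set_borel_integral_eq_integral(2)[OF si] by (simp add: set_lebesgue_integral_def)
      also have "ennreal \<dots> \<le> (\<integral>\<^sup>+y. ennreal (cmod (indicator {y1..y2} y *\<^sub>R h (Complex s y))) \<partial>lborel)"
        using si unfolding set_integrable_def by (rule integral_norm_bound_ennreal)
      also have "\<dots> = (\<integral>\<^sup>+y. k s y \<partial>lborel)"
        using s by (intro nn_integral_cong) (auto simp: k_def split: split_indicator)
      finally show ?thesis .
    qed
    have "ennreal (d / 2) \<le> ennreal (cmod (contour_integral (linepath a1 a4) h) + cmod (contour_integral (linepath a2 a3) h))"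
      using X1[OF XX(2)] le by (intro ennreal_leI) linarith
    also have "\<dots> \<le> (\<integral>\<^sup>+y. k (-X) y \<partial>lborel) + (\<integral>\<^sup>+y. k X y \<partial>lborel)"
      using side[of "-X"] side[of X] XX unfolding a1_def a2_def a3_def a4_def
      by (simp add: add_mono)
    also have "\<dots> = S X"
      unfolding S_def by (subst nn_integral_add) (auto simp: add.commute)
    finally show ?thesis .
  qed
  have fin: "(\<integral>\<^sup>+x. (\<integral>\<^sup>+y. k x y \<partial>lborel) \<partial>lborel) \<le> ennreal C * ennreal (y2 - y1)"
  proof -
    have "(\<integral>\<^sup>+x. (\<integral>\<^sup>+y. k x y \<partial>lborel) \<partial>lborel) = (\<integral>\<^sup>+y. (\<integral>\<^sup>+x. k x y \<partial>lborel) \<partial>lborel)"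
      by (rule lborel_pair.Fubini'[symmetric]) measurable
    also have "\<dots> \<le> (\<integral>\<^sup>+y. ennreal C * indicator {y1..y2} y \<partial>lborel)"
    proof (rule nn_integral_mono)
      fix y
      show "(\<integral>\<^sup>+x. k x y \<partial>lborel) \<le> ennreal C * indicator {y1..y2} y"
      proof (cases "y \<in> {y1..y2}")
        case True
        then have "k x y = indicator {x. X0 \<le> \<bar>x\<bar>} x * ennreal (cmod (h (Complex x y)))" for x
          by (auto simp: k_def split: split_indicator)
        then show ?thesis using bound[of y] True by simp
      qed (simp add: k_def)
    qed
    also have "\<dots> = ennreal C * ennreal (y2 - y1)" using y by (simp add: nn_integral_cmult)
    finally show ?thesis .
  qed
  have "(\<integral>\<^sup>+X. S X \<partial>lborel) = (\<integral>\<^sup>+X. (\<integral>\<^sup>+y. k X y \<partial>lborel) \<partial>lborel) + (\<integral>\<^sup>+X. (\<integral>\<^sup>+y. k (-X) y \<partial>lborel) \<partial>lborel)"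
    unfolding S_def by (subst nn_integral_add, simp, simp, subst nn_integral_add) auto
  also have "(\<integral>\<^sup>+X. (\<integral>\<^sup>+y. k (-X) y \<partial>lborel) \<partial>lborel) = (\<integral>\<^sup>+X. (\<integral>\<^sup>+y. k X y \<partial>lborel) \<partial>lborel)"
    using nn_integral_real_affine[of "\<lambda>X. \<integral>\<^sup>+y. k X y \<partial>lborel" "-1" 0] by simp
  also have "(\<integral>\<^sup>+X. (\<integral>\<^sup>+y. k X y \<partial>lborel) \<partial>lborel) + (\<integral>\<^sup>+X. (\<integral>\<^sup>+y. k X y \<partial>lborel) \<partial>lborel)
      \<le> ennreal C * ennreal (y2 - y1) + ennreal C * ennreal (y2 - y1)"
    by (intro add_mono fin)
  also have "\<dots> < \<infinity>" by (simp add: ennreal_mult_less_top)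
  finally have "(\<integral>\<^sup>+X. S X \<partial>lborel) < \<infinity>" .
  moreover have "(\<integral>\<^sup>+X. ennreal (d / 2) * indicator {X2..} X \<partial>lborel) \<le> (\<integral>\<^sup>+X. S X \<partial>lborel)"
    using S_ge by (intro nn_integral_mono) (auto split: split_indicator)
  moreover have "(\<integral>\<^sup>+X. ennreal (d / 2) * indicator {X2..} X \<partial>lborel) = \<infinity>"
  proof -
    have "top = (SUP n. of_nat n :: ennreal)" by (simp add: ennreal_SUP_of_nat_eq_top)
    also have "\<dots> \<le> emeasure lborel {X2..}"
    proof (rule SUP_least)
      fix n :: nat
      have "of_nat n = emeasure lborel {X2..X2 + real n}" by (simp add: ennreal_of_nat_eq_real_of_nat)
      also have "\<dots> \<le> emeasure lborel {X2..}" by (intro emeasure_mono) auto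
      finally show "of_nat n \<le> emeasure lborel {X2..}" .
    qed
    finally have "emeasure lborel {X2..} = top" by (simp add: top_unique)
    then show ?thesis using d by (simp add: nn_integral_cmult ennreal_mult_top)
  qed
  ultimately show False by (simp add: top_unique)
qed

lemma horizontal_integral_shift:
  fixes h :: "complex \<Rightarrow> complex"
  assumes y: "a < y1" "y1 < y2" "y2 < b"
    and hol: "h holomorphic_on {z. a < Im z \<and> Im z < b}"
    and bound: "\<And>y. y1 \<le> y \<Longrightarrow> y \<le> y2 \<Longrightarrow> (\<integral>\<^sup>+x. ennreal (cmod (h (Complex x y))) \<partial>lborel) \<le> ennreal C"
  shows "(LINT x|lborel. h (Complex x y1)) = (LINT x|lborel. h (Complex x y2))"
proof -
  have conv: "convex {z. a < Im z \<and> Im z < b}"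
    using convex_Int[OF convex_halfspace_Im_gt[of a] convex_halfspace_Im_lt[of b]] by (simp add: Int_def)
  have cont: "continuous_on {z. a < Im z \<and> Im z < b} h" by (rule holomorphic_on_imp_continuous_on[OF hol])
  have int: "integrable lborel (\<lambda>x. h (Complex x y))" if "y1 \<le> y" "y \<le> y2" for y
  proof (rule integrableI_bounded)
    have "continuous_on UNIV (\<lambda>x. h (Complex x y))"
      by (rule continuous_on_compose2[OF cont])
         (use that y in \<open>auto simp: Complex_eq intro!: continuous_intros\<close>)
    then show "(\<lambda>x. h (Complex x y)) \<in> borel_measurable lborel"
      using borel_measurable_continuous_onI by simp
  qed (use bound[OF that] in \<open>auto intro: le_less_trans\<close>)
  have "(LINT x|lborel. h (Complex x y1)) - (LINT x|lborel. h (Complex x y2)) = 0"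
  proof (rule horizontal_integral_shift_residue[where w = "Complex 0 ((y1 + y2) / 2)" and ?X0.0 = 1 and C = C])
    show "continuous_on ({z. y1 \<le> Im z \<and> Im z \<le> y2} - {Complex 0 ((y1 + y2) / 2)}) h"
      by (rule continuous_on_subset[OF cont]) (use y in auto)
    show "(h has_contour_integral 0) (rectpath (Complex (- X) y1) (Complex X y2))" if "1 \<le> X" for X
    proof (rule Cauchy_theorem_convex_simple[OF hol conv])
      show "path_image (rectpath (Complex (- X) y1) (Complex X y2)) \<subseteq> {z. a < Im z \<and> Im z < b}"
        using path_image_rectpath_subset_cbox[of "Complex (- X) y1" "Complex X y2"] y that
        by (auto simp: in_cbox_complex_iff subset_iff)
    qed auto
    show "(\<integral>\<^sup>+x. indicator {x. 1 \<le> \<bar>x\<bar>} x * ennreal (cmod (h (Complex x y))) \<partial>lborel) \<le> ennreal C"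
      if "y1 \<le> y" "y \<le> y2" for y
      by (rule order_trans[OF nn_integral_mono bound[OF that]]) (auto split: split_indicator)
  qed (use y int in auto)
  then show ?thesis by simp
qed

section \<open>Poisson formula and maximal inequality for Hardy space functions\<close>

definition line_sqnorm :: "(complex \<Rightarrow> complex) \<Rightarrow> real \<Rightarrow> ennreal" where
  "line_sqnorm f y = (\<integral>\<^sup>+x. ennreal ((cmod (f (Complex x y)))\<^sup>2) \<partial>lborel)"

text \<open>
  Membership in the Hardy space as far as it concerns the half-plane itself: the values elsewhere
  are left free, which makes the class closed under translation \<open>z \<mapsto> z + \<i> * d\<close>.
\<close>
definition H2 :: "(complex \<Rightarrow> complex) \<Rightarrow> bool" where
  "H2 f \<longleftrightarrow> f holomorphic_on upper_half_plane \<and> (\<exists>C\<ge>0. \<forall>y>0. line_sqnorm f y \<le> ennreal C)"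

lemma Complex_in_upper_half_plane [simp]: "Complex x y \<in> upper_half_plane \<longleftrightarrow> 0 < y"
  by (simp add: upper_half_plane_def)

lemma open_upper_half_plane: "open upper_half_plane"
  unfolding upper_half_plane_def by (rule open_halfspace_Im_gt)

lemma H2_holomorphic: "H2 f \<Longrightarrow> f holomorphic_on upper_half_plane"
  by (simp add: H2_def)

lemma H2_continuous: "H2 f \<Longrightarrow> continuous_on upper_half_plane f"
  by (rule holomorphic_on_imp_continuous_on) (rule H2_holomorphic)

lemma hardy2_iff: "f \<in> hardy2 \<longleftrightarrow> H2 f \<and> (\<forall>z. z \<notin> upper_half_plane \<longrightarrow> f z = 0)"
proof -
  have "(SUP y\<in>{0<..}. line_sqnorm f y) < \<infinity> \<longleftrightarrow> (\<exists>C\<ge>0. \<forall>y>0. line_sqnorm f y \<le> ennreal C)"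
  proof
    assume "(SUP y\<in>{0<..}. line_sqnorm f y) < \<infinity>"
    then obtain C where C: "0 \<le> C" "(SUP y\<in>{0<..}. line_sqnorm f y) = ennreal C"
      by (cases "SUP y\<in>{0<..}. line_sqnorm f y") auto
    then have "line_sqnorm f y \<le> ennreal C" if "y > 0" for y
      using SUP_upper[of y "{0<..}" "line_sqnorm f"] that by auto
    then show "\<exists>C\<ge>0. \<forall>y>0. line_sqnorm f y \<le> ennreal C" using C by blast
  next
    assume "\<exists>C\<ge>0. \<forall>y>0. line_sqnorm f y \<le> ennreal C"
    then obtain C where "\<forall>y>0. line_sqnorm f y \<le> ennreal C" by blast
    then have "(SUP y\<in>{0<..}. line_sqnorm f y) \<le> ennreal C" by (intro SUP_least) auto
    then show "(SUP y\<in>{0<..}. line_sqnorm f y) < \<infinity>" by (auto intro: le_less_trans)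
  qed
  then show ?thesis unfolding hardy2_def H2_def line_sqnorm_def by auto
qed

lemma horizontal_measurable:
  fixes f :: "complex \<Rightarrow> complex"
  assumes "continuous_on upper_half_plane f" "0 < y"
  shows "(\<lambda>x. f (Complex x y)) \<in> borel_measurable borel"
proof -
  have "continuous_on UNIV (\<lambda>x. f (Complex x y))"
    by (rule continuous_on_compose2[OF assms(1)])
       (use assms in \<open>auto simp: Complex_eq upper_half_plane_def intro!: continuous_intros\<close>)
  then show ?thesis by (rule borel_measurable_continuous_onI)
qed

lemma poisson_le: "0 < s \<Longrightarrow> poisson s t \<le> 1 / (pi * s)"
proof -
  assume s: "0 < s"
  have "s / (pi * (t\<^sup>2 + s\<^sup>2)) \<le> s / (pi * s\<^sup>2)"
    using s by (intro divide_left_mono mult_left_mono mult_pos_pos add_nonneg_pos) auto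
  then show ?thesis using s by (simp add: poisson_def power2_eq_square)
qed

lemma nn_integral_poisson_square_le:
  assumes s: "0 < s"
  shows "(\<integral>\<^sup>+x. ennreal ((poisson s (x - a))\<^sup>2) \<partial>lborel) \<le> ennreal (1 / (pi * s))"
proof -
  have "(\<integral>\<^sup>+x. ennreal ((poisson s (x - a))\<^sup>2) \<partial>lborel) \<le>
        (\<integral>\<^sup>+x. ennreal (1 / (pi * s)) * ennreal (poisson s (x - a)) \<partial>lborel)"
  proof (rule nn_integral_mono)
    fix x
    have "(poisson s (x - a))\<^sup>2 \<le> 1 / (pi * s) * poisson s (x - a)"
      unfolding power2_eq_square using s by (intro mult_right_mono poisson_le poisson_nonneg) auto
    then show "ennreal ((poisson s (x - a))\<^sup>2) \<le> ennreal (1 / (pi * s)) * ennreal (poisson s (x - a))"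
      using s by (simp add: ennreal_leI poisson_nonneg flip: ennreal_mult)
  qed
  also have "\<dots> = ennreal (1 / (pi * s))"
    by (simp add: nn_integral_cmult nn_integral_poisson[OF s])
  finally show ?thesis .
qed

lemma poisson_product:
  assumes [measurable]: "f \<in> borel_measurable borel" and s: "0 < s"
    and f: "(\<integral>\<^sup>+x. ennreal ((cmod (f x))\<^sup>2) \<partial>lborel) \<le> ennreal C" "0 \<le> C"
  shows "(\<integral>\<^sup>+x. ennreal (cmod (f x) * poisson s (x - a)) \<partial>lborel) \<le> ennreal (sqrt (C / (pi * s)))"
    and "integrable lborel (\<lambda>x. f x * of_real (poisson s (x - a)))"
proof -
  have "(\<integral>\<^sup>+x. ennreal ((cmod (of_real (poisson s (x - a)) :: complex))\<^sup>2) \<partial>lborel) \<le> ennreal (1 / (pi * s))"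
    using nn_integral_poisson_square_le[OF s] by simp
  note L = L2_product[OF assms(1) _ f(1) this f(2)]
  show "integrable lborel (\<lambda>x. f x * of_real (poisson s (x - a)))"
    by (rule L(2)) (use s in auto)
  have "(\<integral>\<^sup>+x. ennreal (cmod (f x * of_real (poisson s (x - a)))) \<partial>lborel) \<le> ennreal (sqrt (C * (1 / (pi * s))))"
    by (rule L(1)) (use s in auto)
  then show "(\<integral>\<^sup>+x. ennreal (cmod (f x) * poisson s (x - a)) \<partial>lborel) \<le> ennreal (sqrt (C / (pi * s)))"
    using s by (simp add: norm_mult poisson_nonneg)
qed

text \<open>
  With \<open>w = a + \<i> * (\<eta> + b)\<close> and its mirror image \<open>w'\<close> in the line at height \<open>\<eta>\<close>, the function
  \<open>f z * (w - w') / ((z - w') * (z - w))\<close> restricts to \<open>2 * pi * \<i> * f\<close> times the Poisson kernel on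
  that line and has residue \<open>f w\<close> at \<open>w\<close>. Cauchy's formula on the strip up to height \<open>Y\<close> gives the claim in the limit,
  since the integral over the upper line tends to zero as \<open>Y\<close> grows.
\<close>
theorem H2_poisson:
  assumes f: "H2 f" and \<eta>: "0 < \<eta>" and b: "0 < b"
  shows "f (Complex a (\<eta> + b)) = (LINT x|lborel. f (Complex x \<eta>) * of_real (poisson b (x - a)))"
proof -
  obtain C where C: "0 \<le> C" "\<And>y. y > 0 \<Longrightarrow> line_sqnorm f y \<le> ennreal C"
    using f by (auto simp: H2_def)
  note hm = horizontal_measurable[OF H2_continuous[OF f]]
  note pp = poisson_product[OF hm _ C(2)[unfolded line_sqnorm_def] C(1)]
  define w where "w = Complex a (\<eta> + b)"
  define w' where "w' = Complex a (\<eta> - b)"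
  define F where "F = (\<lambda>z. f z * (2 * \<i> * of_real b) / (z - w'))"
  define h where "h = (\<lambda>z. F z / (z - w))"
  define S where "S = {z. max 0 (\<eta> - b) < Im z}"
  have S: "convex S" "open S" "S \<subseteq> upper_half_plane"
    using convex_halfspace_Im_gt[of "max 0 (\<eta> - b)"] open_halfspace_Im_gt[of "max 0 (\<eta> - b)"]
    unfolding S_def upper_half_plane_def by auto
  have wS: "w \<in> S" using \<eta> b by (auto simp: S_def w_def)
  have w'S: "z \<noteq> w'" if "z \<in> S" for z using that by (auto simp: S_def w'_def)
  have holF: "F holomorphic_on S"
    unfolding F_def using w'S by (intro holomorphic_intros holomorphic_on_subset[OF H2_holomorphic[OF f] S(3)]) auto
  have hnorm: "cmod (h z) = cmod (f z) * (2 * b / (cmod (z - w') * cmod (z - w)))" for z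
    using b by (simp add: h_def F_def norm_divide norm_mult)
  have bottom: "h (Complex x \<eta>) = 2 * of_real pi * \<i> * (f (Complex x \<eta>) * of_real (poisson b (x - a)))" for x
  proof -
    have "(Complex x \<eta> - w') * (Complex x \<eta> - w) = of_real ((x - a)\<^sup>2 + b\<^sup>2)"
      by (simp add: w_def w'_def complex_eq_iff power2_eq_square)
    then have "h (Complex x \<eta>) = f (Complex x \<eta>) * (2 * \<i> * of_real b) / of_real ((x - a)\<^sup>2 + b\<^sup>2)"
      by (simp add: h_def F_def)
    then show ?thesis by (simp add: poisson_def)
  qed
  have top_bound: "cmod (h (Complex x Y)) \<le> 2 * b * pi / s * (cmod (f (Complex x Y)) * poisson s (x - a))"
    if s: "s > 0" "Y = \<eta> + b + s" for x Y s
  proof -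
    define q where "q = (cmod (Complex x Y - w))\<^sup>2"
    have q: "q > 0" "q = (x - a)\<^sup>2 + s\<^sup>2" using s by (auto simp: q_def cmod_power2 w_def intro: add_nonneg_pos)
    have "cmod (Complex x Y - w) \<le> cmod (Complex x Y - w')"
      unfolding cmod_def w_def w'_def using s b by (intro real_sqrt_le_mono) (auto intro!: power_mono)
    then have "cmod (Complex x Y - w) * cmod (Complex x Y - w) \<le> cmod (Complex x Y - w') * cmod (Complex x Y - w)"
      by (intro mult_right_mono) auto
    then have "2 * b / (cmod (Complex x Y - w') * cmod (Complex x Y - w)) \<le> 2 * b / q"
      using b q unfolding q_def power2_eq_square by (intro divide_left_mono) (auto intro: less_le_trans mult_pos_pos)
    also have "2 * b / q = 2 * b * pi / s * poisson s (x - a)"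
      using s q by (simp add: poisson_def)
    finally have "cmod (f (Complex x Y)) * (2 * b / (cmod (Complex x Y - w') * cmod (Complex x Y - w)))
        \<le> cmod (f (Complex x Y)) * (2 * b * pi / s * poisson s (x - a))"
      by (intro mult_left_mono) auto
    then show ?thesis by (simp add: hnorm mult_ac)
  qed
  have top_nn: "(\<integral>\<^sup>+x. ennreal (cmod (h (Complex x Y))) \<partial>lborel) \<le> ennreal (2 * b * pi / s * sqrt (C / (pi * s)))"
    if s: "s > 0" "Y = \<eta> + b + s" for Y s
  proof -
    have Y: "Y > 0" using s \<eta> b by simp
    note [measurable] = hm[OF Y]
    have "(\<integral>\<^sup>+x. ennreal (cmod (h (Complex x Y))) \<partial>lborel) \<le>
        (\<integral>\<^sup>+x. ennreal (2 * b * pi / s) * ennreal (cmod (f (Complex x Y)) * poisson s (x - a)) \<partial>lborel)"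
    proof (rule nn_integral_mono)
      fix x
      show "ennreal (cmod (h (Complex x Y))) \<le>
          ennreal (2 * b * pi / s) * ennreal (cmod (f (Complex x Y)) * poisson s (x - a))"
        using ennreal_leI[OF top_bound[OF s, of x]] s b by (simp add: poisson_nonneg flip: ennreal_mult)
    qed
    also have "\<dots> = ennreal (2 * b * pi / s) * (\<integral>\<^sup>+x. ennreal (cmod (f (Complex x Y)) * poisson s (x - a)) \<partial>lborel)"
      by (rule nn_integral_cmult) measurable
    also have "\<dots> \<le> ennreal (2 * b * pi / s) * ennreal (sqrt (C / (pi * s)))"
      by (intro mult_left_mono pp(1)[OF Y s(1) Y]) auto
    finally show ?thesis using s b C by (simp flip: ennreal_mult)
  qed
  have h_meas: "(\<lambda>x. h (Complex x Y)) \<in> borel_measurable borel" if "Y > 0" for Y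
    unfolding h_def F_def using hm[OF that] by (simp add: Complex_eq)
  have shift: "(LINT x|lborel. h (Complex x \<eta>)) - (LINT x|lborel. h (Complex x Y)) = 2 * pi * \<i> * F w"
    if s: "s > 0" "Y = \<eta> + b + s" for Y s
  proof (rule horizontal_integral_shift_residue[where w = w and ?X0.0 = "\<bar>a\<bar> + 1" and C = "4 * b * pi * sqrt (C / pi)"])
    show "\<eta> < Y" "\<eta> < Im w" "Im w < Y" "\<bar>Re w\<bar> < \<bar>a\<bar> + 1" using s b by (auto simp: w_def)
    have sub: "{z. \<eta> \<le> Im z \<and> Im z \<le> Y} \<subseteq> S" using \<eta> b by (auto simp: S_def)
    show "continuous_on ({z. \<eta> \<le> Im z \<and> Im z \<le> Y} - {w}) h"
      unfolding h_def using sub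
      by (intro continuous_intros continuous_on_subset[OF holomorphic_on_imp_continuous_on[OF holF]]) auto
    show "(h has_contour_integral 2 * pi * \<i> * F w) (rectpath (Complex (- X) \<eta>) (Complex X Y))"
      if X: "\<bar>a\<bar> + 1 \<le> X" for X
    proof -
      have wbox: "w \<in> box (Complex (- X) \<eta>) (Complex X Y)"
        using X s b by (auto simp: in_box_complex_iff w_def)
      have "(h has_contour_integral (2 * pi * \<i> * winding_number (rectpath (Complex (- X) \<eta>) (Complex X Y)) w * F w))
          (rectpath (Complex (- X) \<eta>) (Complex X Y))"
        unfolding h_def
      proof (rule Cauchy_integral_formula_convex_simple[OF S(1) holF])
        show "w \<in> interior S" using wS S(2) by (simp add: interior_open)
        have "path_image (rectpath (Complex (- X) \<eta>) (Complex X Y)) = cbox (Complex (- X) \<eta>) (Complex X Y) - box (Complex (- X) \<eta>) (Complex X Y)"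
          using X s b by (intro path_image_rectpath_cbox_minus_box) auto
        then show "path_image (rectpath (Complex (- X) \<eta>) (Complex X Y)) \<subseteq> S - {w}"
          using wbox sub by (auto simp: in_cbox_complex_iff)
      qed auto
      then show ?thesis by (simp add: winding_number_rectpath[OF wbox])
    qed
    show "integrable lborel (\<lambda>x. h (Complex x \<eta>))"
      unfolding bottom by (intro integrable_mult_right pp(2) \<eta> b)
    show "integrable lborel (\<lambda>x. h (Complex x Y))"
      by (rule integrableI_bounded) (use h_meas[of Y] top_nn[OF s] s \<eta> b in \<open>auto intro: le_less_trans\<close>)
    fix y assume y: "\<eta> \<le> y" "y \<le> Y"
    then have y0: "y > 0" using \<eta> by simp
    note [measurable] = hm[OF y0]
    have "(\<integral>\<^sup>+x. indicator {x. \<bar>a\<bar> + 1 \<le> \<bar>x\<bar>} x * ennreal (cmod (h (Complex x y))) \<partial>lborel) \<le>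
        (\<integral>\<^sup>+x. ennreal (4 * b * pi) * ennreal (cmod (f (Complex x y)) * poisson 1 (x - a)) \<partial>lborel)"
    proof (rule nn_integral_mono)
      fix x
      show "indicator {x. \<bar>a\<bar> + 1 \<le> \<bar>x\<bar>} x * ennreal (cmod (h (Complex x y))) \<le>
        ennreal (4 * b * pi) * ennreal (cmod (f (Complex x y)) * poisson 1 (x - a))"
      proof (cases "\<bar>a\<bar> + 1 \<le> \<bar>x\<bar>")
        case True
        then have t: "\<bar>x - a\<bar> \<ge> 1" by linarith
        then have t2: "(x - a)\<^sup>2 \<ge> 1" using abs_le_square_iff[of 1 "x - a"] by simp
        have "\<bar>x - a\<bar> \<le> cmod (Complex x y - w')" "\<bar>x - a\<bar> \<le> cmod (Complex x y - w)"
          using abs_Re_le_cmod[of "Complex x y - w'"] abs_Re_le_cmod[of "Complex x y - w"] by (auto simp: w_def w'_def)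
        then have "\<bar>x - a\<bar> * \<bar>x - a\<bar> \<le> cmod (Complex x y - w') * cmod (Complex x y - w)"
          by (intro mult_mono) auto
        then have le: "(x - a)\<^sup>2 \<le> cmod (Complex x y - w') * cmod (Complex x y - w)"
          by (simp add: power2_eq_square flip: abs_mult)
        have "2 * b / (cmod (Complex x y - w') * cmod (Complex x y - w)) \<le> 2 * b / (x - a)\<^sup>2"
          using b le t2 by (intro divide_left_mono mult_pos_pos) (auto intro: less_le_trans)
        also have "\<dots> \<le> 4 * b / ((x - a)\<^sup>2 + 1)"
        proof -
          have "2 * b * ((x - a)\<^sup>2 + 1) \<le> 2 * b * (2 * (x - a)\<^sup>2)"
            using b t2 by (intro mult_left_mono) auto
          then have "2 * b * ((x - a)\<^sup>2 + 1) \<le> 4 * b * (x - a)\<^sup>2" by simp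
          moreover have "(x - a)\<^sup>2 > 0" "(x - a)\<^sup>2 + 1 > 0" using t2 by linarith+
          ultimately show ?thesis by (simp only: frac_le_eq pos_divide_le_eq pos_le_divide_eq times_divide_eq_left)
        qed
        also have "\<dots> = 4 * b * pi * poisson 1 (x - a)" by (simp add: poisson_def)
        finally have "cmod (h (Complex x y)) \<le> cmod (f (Complex x y)) * (4 * b * pi * poisson 1 (x - a))"
          unfolding hnorm by (intro mult_left_mono) auto
        then show ?thesis using True b by (simp add: poisson_nonneg mult_ac ennreal_leI flip: ennreal_mult)
      qed auto
    qed
    also have "\<dots> = ennreal (4 * b * pi) * (\<integral>\<^sup>+x. ennreal (cmod (f (Complex x y)) * poisson 1 (x - a)) \<partial>lborel)"
      by (rule nn_integral_cmult) measurable
    also have "\<dots> \<le> ennreal (4 * b * pi) * ennreal (sqrt (C / (pi * 1)))"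
      by (intro mult_left_mono pp(1) y0) auto
    finally show "(\<integral>\<^sup>+x. indicator {x. \<bar>a\<bar> + 1 \<le> \<bar>x\<bar>} x * ennreal (cmod (h (Complex x y))) \<partial>lborel)
        \<le> ennreal (4 * b * pi * sqrt (C / pi))"
      using b C by (simp flip: ennreal_mult)
  qed
  have "((\<lambda>s. (2 * b * pi) * inverse s * sqrt (C / pi * inverse s)) \<longlongrightarrow> (2 * b * pi) * 0 * sqrt (C / pi * 0)) at_top"
    by (intro tendsto_intros tendsto_inverse_0_at_top filterlim_ident)
  then have "((\<lambda>s. 2 * b * pi / s * sqrt (C / (pi * s))) \<longlongrightarrow> 0) at_top"
    by (simp add: field_simps)
  moreover have "cmod ((LINT x|lborel. h (Complex x \<eta>)) - 2 * pi * \<i> * F w) \<le> 2 * b * pi / s * sqrt (C / (pi * s))"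
    if s: "s > 0" for s
  proof -
    define Y where "Y = \<eta> + b + s"
    have "ennreal (cmod (LINT x|lborel. h (Complex x Y))) \<le> (\<integral>\<^sup>+x. ennreal (cmod (h (Complex x Y))) \<partial>lborel)"
      by (rule integral_norm_bound_ennreal, rule integrableI_bounded)
         (use h_meas[of Y] top_nn[OF s Y_def] s \<eta> b in \<open>auto simp: Y_def intro: le_less_trans\<close>)
    also note top_nn[OF s Y_def]
    finally have "cmod (LINT x|lborel. h (Complex x Y)) \<le> 2 * b * pi / s * sqrt (C / (pi * s))"
      using s b C by (subst (asm) ennreal_le_iff) auto
    then show ?thesis using shift[OF s Y_def] by (simp add: algebra_simps)
  qed
  then have "eventually (\<lambda>s. cmod ((LINT x|lborel. h (Complex x \<eta>)) - 2 * pi * \<i> * F w) \<le> 2 * b * pi / s * sqrt (C / (pi * s))) at_top"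
    by (intro eventually_mono[OF eventually_gt_at_top[of 0]])
  ultimately have "cmod ((LINT x|lborel. h (Complex x \<eta>)) - 2 * pi * \<i> * F w) \<le> 0"
    by (intro tendsto_lowerbound) auto
  then have "2 * pi * \<i> * F w = (LINT x|lborel. h (Complex x \<eta>))" by simp
  also have "\<dots> = 2 * of_real pi * \<i> * (LINT x|lborel. f (Complex x \<eta>) * of_real (poisson b (x - a)))"
    unfolding bottom by simp
  finally have "F w = (LINT x|lborel. f (Complex x \<eta>) * of_real (poisson b (x - a)))" by simp
  moreover have "w - w' = 2 * \<i> * of_real b" by (simp add: w_def w'_def complex_eq_iff)
  ultimately show ?thesis using b unfolding F_def w_def by auto
qed

lemma H2_norm_le_poisson:
  assumes f: "H2 f" and \<eta>: "0 < \<eta>" and b: "0 < b"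
  shows "ennreal (cmod (f (Complex a (\<eta> + b)))) \<le>
    (\<integral>\<^sup>+x. ennreal (poisson b (a - x)) * ennreal (cmod (f (Complex x \<eta>))) \<partial>lborel)"
proof -
  obtain C where C: "0 \<le> C" "\<And>y. y > 0 \<Longrightarrow> line_sqnorm f y \<le> ennreal C"
    using f by (auto simp: H2_def)
  have "integrable lborel (\<lambda>x. f (Complex x \<eta>) * of_real (poisson b (x - a)))"
    by (rule poisson_product(2)[OF horizontal_measurable[OF H2_continuous[OF f] \<eta>] b C(2)[unfolded line_sqnorm_def, OF \<eta>] C(1)])
  from integral_norm_bound_ennreal[OF this] show ?thesis
    using b by (simp add: H2_poisson[OF f \<eta> b] norm_mult poisson_nonneg ennreal_mult mult.commute poisson_minus[of b a])
qed

lemma line_sqnorm_antimono: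
  assumes f: "H2 f" and "0 < y1" "y1 \<le> y2"
  shows "line_sqnorm f y2 \<le> line_sqnorm f y1"
proof (cases "y1 = y2")
  case False
  define b where "b = y2 - y1"
  have b: "b > 0" "y2 = y1 + b" using False assms by (auto simp: b_def)
  have [measurable]: "(\<lambda>x. f (Complex x y1)) \<in> borel_measurable borel"
    by (rule horizontal_measurable[OF H2_continuous[OF f] assms(2)])
  have "line_sqnorm f y2 \<le> (\<integral>\<^sup>+a. (\<integral>\<^sup>+x. ennreal (poisson b (a - x)) * ennreal (cmod (f (Complex x y1))) \<partial>lborel)\<^sup>2 \<partial>lborel)"
    unfolding line_sqnorm_def b(2) using H2_norm_le_poisson[OF f assms(2) b(1)]
    by (intro nn_integral_mono) (simp add: power_mono flip: ennreal_power)
  also have "\<dots> \<le> (\<integral>\<^sup>+x. (ennreal (cmod (f (Complex x y1))))\<^sup>2 \<partial>lborel)"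
    by (rule nn_integral_poisson_convolution_square[OF b(1)]) measurable
  also have "\<dots> = line_sqnorm f y1" by (simp add: line_sqnorm_def ennreal_power)
  finally show ?thesis .
qed simp

text \<open>
  A sequence running through the positive rationals, so that suprema over all heights become countable.
\<close>
definition heights :: "nat \<Rightarrow> real" where
  "heights n = (if 0 < real_of_rat (from_nat n) then real_of_rat (from_nat n) else 1)"

lemma heights_pos: "heights n > 0"
  by (simp add: heights_def)

lemma heights_dense:
  assumes "0 \<le> a" "a < b" obtains n where "a < heights n" "heights n < b"
proof -
  obtain r where r: "r \<in> \<rat>" "a < r" "r < b" using Rats_dense_in_real[OF assms(2)] by blast
  then obtain q where q: "r = real_of_rat q" by (auto simp: Rats_def)
  have "0 < real_of_rat q" using r assms q by linarith
  then have "heights (to_nat q) = r" unfolding heights_def from_nat_to_nat q by (simp only: if_True)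
  then show ?thesis using that[of "to_nat q"] r by simp
qed

definition vertical_max :: "(complex \<Rightarrow> complex) \<Rightarrow> real \<Rightarrow> ennreal" where
  "vertical_max f x = (SUP n. ennreal ((cmod (f (Complex x (heights n))))\<^sup>2))"

lemma vertical_max_measurable:
  assumes "continuous_on upper_half_plane f"
  shows "vertical_max f \<in> borel_measurable borel"
proof -
  note [measurable] = horizontal_measurable[OF assms heights_pos]
  show ?thesis unfolding vertical_max_def by measurable
qed

lemma vertical_max_upper:
  assumes f: "continuous_on upper_half_plane f" and y: "y > 0"
  shows "ennreal ((cmod (f (Complex x y)))\<^sup>2) \<le> vertical_max f x"
proof (rule ccontr)
  assume "\<not> ?thesis"
  then have less: "vertical_max f x < ennreal ((cmod (f (Complex x y)))\<^sup>2)" by simp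
  then obtain c where c: "vertical_max f x = ennreal c" "0 \<le> c" by (cases "vertical_max f x") auto
  have lt: "c < (cmod (f (Complex x y)))\<^sup>2" using less c by (simp add: ennreal_less_iff)
  have "continuous_on {0<..} (\<lambda>y. (cmod (f (Complex x y)))\<^sup>2)"
    by (intro continuous_intros continuous_on_compose2[OF f])
       (auto simp: Complex_eq upper_half_plane_def intro!: continuous_intros)
  then have "isCont (\<lambda>y. (cmod (f (Complex x y)))\<^sup>2) y"
    using y by (simp add: continuous_on_eq_continuous_at)
  then have "eventually (\<lambda>y'. c < (cmod (f (Complex x y')))\<^sup>2) (at y)"
    using lt unfolding isCont_def by (rule order_tendstoD)
  then obtain d where d: "d > 0" "\<And>y'. y' \<noteq> y \<Longrightarrow> \<bar>y' - y\<bar> < d \<Longrightarrow> c < (cmod (f (Complex x y')))\<^sup>2"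
    by (auto simp: eventually_at dist_real_def)
  obtain n where n: "max 0 (y - d) < heights n" "heights n < y"
    by (rule heights_dense[of "max 0 (y - d)" y]) (use y d in auto)
  have "ennreal ((cmod (f (Complex x (heights n))))\<^sup>2) \<le> ennreal c"
    unfolding c(1)[symmetric] vertical_max_def by (rule SUP_upper) simp
  moreover have "c < (cmod (f (Complex x (heights n))))\<^sup>2" by (rule d(2)) (use n in auto)
  ultimately show False using c by (simp add: ennreal_le_iff)
qed

text \<open>
  For finitely many heights let \<open>\<tau> x\<close> be the one at which \<open>\<bar>f\<bar>\<close> is largest above \<open>x\<close>. Writing \<open>f\<close> as
  a Poisson integral from a lower line at height \<open>\<eta>\<close> reduces the bound to \<open>poisson_maximal_bound\<close>;
  monotone convergence then admits all heights.
\<close>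
theorem vertical_max_bound:
  assumes f: "H2 f" and c: "\<And>\<eta>. 0 < \<eta> \<Longrightarrow> \<eta> < \<eta>0 \<Longrightarrow> line_sqnorm f \<eta> \<le> c" and \<eta>0: "0 < \<eta>0"
  shows "(\<integral>\<^sup>+x. vertical_max f x \<partial>lborel) \<le> 65 * c"
proof -
  note hm[measurable] = horizontal_measurable[OF H2_continuous[OF f] heights_pos]
  define m where "m = (\<lambda>N x. SUP n\<in>{..N}. ennreal ((cmod (f (Complex x (heights n))))\<^sup>2))"
  have [measurable]: "m N \<in> borel_measurable borel" for N
    unfolding m_def by measurable
  have m_bound: "(\<integral>\<^sup>+x. m N x \<partial>lborel) \<le> 65 * c" for N
  proof -
    define P where "P = (\<lambda>x j. j \<le> N \<and> (\<forall>k\<le>N. cmod (f (Complex x (heights k))) \<le> cmod (f (Complex x (heights j)))))"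
    define j where "j = (\<lambda>x. LEAST j. P x j)"
    have Pm: "Measurable.pred borel (\<lambda>x. P x i)" for i
      unfolding P_def by measurable
    have [measurable]: "j \<in> borel \<rightarrow>\<^sub>M count_space UNIV"
      unfolding j_def using Pm by (rule measurable_Least)
    have "P x (j x)" for x
    proof -
      have "\<exists>i\<in>{..N}. \<forall>k\<in>{..N}. cmod (f (Complex x (heights k))) \<le> cmod (f (Complex x (heights i)))"
      proof -
        have "Max ((\<lambda>k. cmod (f (Complex x (heights k)))) ` {..N}) \<in> (\<lambda>k. cmod (f (Complex x (heights k)))) ` {..N}"
          by (rule Max_in) auto
        then have "\<exists>i\<le>N. Max ((\<lambda>k. cmod (f (Complex x (heights k)))) ` {..N}) = cmod (f (Complex x (heights i)))"
          unfolding image_iff by blast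
        then obtain i where i: "i \<le> N" "Max ((\<lambda>k. cmod (f (Complex x (heights k)))) ` {..N}) = cmod (f (Complex x (heights i)))"
          by blast
        have "cmod (f (Complex x (heights k))) \<le> cmod (f (Complex x (heights i)))" if "k \<le> N" for k
          unfolding i(2)[symmetric] by (rule Max_ge) (use that in auto)
        then show ?thesis using i by auto
      qed
      then have "\<exists>i. P x i" unfolding P_def Bex_def Ball_def atMost_iff by blast
      then show ?thesis unfolding j_def by (rule LeastI_ex)
    qed
    then have Pj: "P x (j x)" for x .
    have j: "j x \<le> N" "k \<le> N \<Longrightarrow> cmod (f (Complex x (heights k))) \<le> cmod (f (Complex x (heights (j x))))" for x k
      using Pj[of x] unfolding P_def by blast+
    \<comment> \<open>The base line has to lie below all of the heights, and below \<open>\<eta>0\<close>.\<close>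
    define \<mu> where "\<mu> = Min (heights ` {..N})"
    have \<mu>: "\<mu> > 0" "k \<le> N \<Longrightarrow> \<mu> \<le> heights k" for k
      unfolding \<mu>_def using heights_pos by (auto simp: Min_gr_iff)
    define \<eta> where "\<eta> = min \<mu> \<eta>0 / 2"
    have \<eta>: "0 < \<eta>" "\<eta> < \<eta>0" "\<eta> < \<mu>" using \<mu>(1) \<eta>0 by (auto simp: \<eta>_def)
    note [measurable] = horizontal_measurable[OF H2_continuous[OF f] \<eta>(1)]
    define \<tau> where "\<tau> = (\<lambda>x. heights (j x) - \<eta>)"
    have [measurable]: "\<tau> \<in> borel_measurable borel" unfolding \<tau>_def by measurable
    have \<tau>: "\<mu> - \<eta> \<le> \<tau> x" "\<tau> x \<le> Max (heights ` {..N})" for x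
    proof -
      show "\<mu> - \<eta> \<le> \<tau> x" using \<mu>(2)[OF j(1)[of x]] by (simp add: \<tau>_def)
      have "heights (j x) \<le> Max (heights ` {..N})" using j(1)[of x] by (intro Max_ge) auto
      then show "\<tau> x \<le> Max (heights ` {..N})" using \<eta> by (simp add: \<tau>_def)
    qed
    have "m N x \<le> (\<integral>\<^sup>+s. ennreal (poisson (\<tau> x) (x - s)) * ennreal (cmod (f (Complex s \<eta>))) \<partial>lborel)\<^sup>2" for x
      unfolding m_def
    proof (rule SUP_least)
      fix k assume k: "k \<in> {..N}"
      have "\<tau> x > 0" using \<tau>(1)[of x] \<eta> by simp
      from H2_norm_le_poisson[OF f \<eta>(1) this, of x]
      have "ennreal (cmod (f (Complex x (heights (j x))))) \<le>
          (\<integral>\<^sup>+s. ennreal (poisson (\<tau> x) (x - s)) * ennreal (cmod (f (Complex s \<eta>))) \<partial>lborel)"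
        by (simp add: \<tau>_def)
      moreover have "ennreal (cmod (f (Complex x (heights k)))) \<le> ennreal (cmod (f (Complex x (heights (j x)))))"
        using j(2)[of k x] k by (intro ennreal_leI) auto
      ultimately show "ennreal ((cmod (f (Complex x (heights k))))\<^sup>2) \<le>
          (\<integral>\<^sup>+s. ennreal (poisson (\<tau> x) (x - s)) * ennreal (cmod (f (Complex s \<eta>))) \<partial>lborel)\<^sup>2"
        unfolding ennreal_power[OF norm_ge_zero, symmetric]
        by (intro power_mono order_trans[OF \<open>ennreal (cmod (f (Complex x (heights k)))) \<le> _\<close>]) auto
    qed
    then have "(\<integral>\<^sup>+x. m N x \<partial>lborel) \<le> (\<integral>\<^sup>+x. (\<integral>\<^sup>+s. ennreal (poisson (\<tau> x) (x - s)) * ennreal (cmod (f (Complex s \<eta>))) \<partial>lborel)\<^sup>2 \<partial>lborel)"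
      by (intro nn_integral_mono)
    also have "\<dots> \<le> ennreal 65 * (\<integral>\<^sup>+s. (ennreal (cmod (f (Complex s \<eta>))))\<^sup>2 \<partial>lborel)"
      by (rule poisson_maximal_bound[where a = "\<mu> - \<eta>", OF _ _ \<tau>]) (use \<eta> in auto)
    also have "\<dots> = 65 * line_sqnorm f \<eta>" by (simp add: line_sqnorm_def ennreal_power)
    also have "\<dots> \<le> 65 * c" by (intro mult_left_mono c \<eta>) auto
    finally show ?thesis .
  qed
  have "vertical_max f x = (SUP N. m N x)" for x
  proof (rule antisym)
    show "vertical_max f x \<le> (SUP N. m N x)"
      unfolding vertical_max_def m_def by (intro SUP_mono) (auto intro!: SUP_upper)
    show "(SUP N. m N x) \<le> vertical_max f x"
      unfolding vertical_max_def m_def by (intro SUP_least) (auto intro!: SUP_upper)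
  qed
  then have "(\<integral>\<^sup>+x. vertical_max f x \<partial>lborel) = (\<integral>\<^sup>+x. (SUP N. m N x) \<partial>lborel)" by simp
  also have "\<dots> = (SUP N. \<integral>\<^sup>+x. m N x \<partial>lborel)"
    by (rule nn_integral_monotone_convergence_SUP)
       (auto simp: m_def incseq_def le_fun_def intro!: SUP_subset_mono)
  also have "\<dots> \<le> 65 * c" by (rule SUP_least) (rule m_bound)
  finally show ?thesis .
qed

section \<open>Fatou's theorem\<close>

lemma line_sqnorm_eq_LINT:
  assumes f: "H2 f" and y: "0 < y"
  shows "integrable lborel (\<lambda>x. (cmod (f (Complex x y)))\<^sup>2)"
    and "line_sqnorm f y = ennreal (LINT x|lborel. (cmod (f (Complex x y)))\<^sup>2)"
proof -
  note [measurable] = horizontal_measurable[OF H2_continuous[OF f] y]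
  obtain C where C: "0 \<le> C" "line_sqnorm f y \<le> ennreal C"
    using f y by (auto simp: H2_def)
  show int: "integrable lborel (\<lambda>x. (cmod (f (Complex x y)))\<^sup>2)"
    by (rule integrableI_bounded) (use C in \<open>auto simp: line_sqnorm_def intro: le_less_trans\<close>)
  show "line_sqnorm f y = ennreal (LINT x|lborel. (cmod (f (Complex x y)))\<^sup>2)"
    unfolding line_sqnorm_def by (rule nn_integral_eq_integral[OF int]) auto
qed

lemma H2_shift:
  assumes f: "H2 f" and d: "0 \<le> d"
  shows "H2 (\<lambda>z. f (z + \<i> * of_real d))"
proof -
  have eq: "Complex x y + \<i> * of_real d = Complex x (y + d)" for x y by (simp add: complex_eq_iff)
  have "(f \<circ> (\<lambda>z. z + \<i> * of_real d)) holomorphic_on upper_half_plane"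
    by (intro holomorphic_on_compose_gen[OF _ H2_holomorphic[OF f]] holomorphic_intros)
       (use d in \<open>auto simp: upper_half_plane_def\<close>)
  moreover have "line_sqnorm (\<lambda>z. f (z + \<i> * of_real d)) y = line_sqnorm f (y + d)" for y
    by (simp add: line_sqnorm_def eq)
  ultimately show ?thesis using f d unfolding H2_def o_def
    by (auto simp: add_pos_nonneg)
qed

lemma H2_add:
  assumes f: "H2 f" and g: "H2 g"
  shows "H2 (\<lambda>z. f z + g z)"
proof -
  obtain A B where A: "0 \<le> A" "\<And>y. y > 0 \<Longrightarrow> line_sqnorm f y \<le> ennreal A"
    and B: "0 \<le> B" "\<And>y. y > 0 \<Longrightarrow> line_sqnorm g y \<le> ennreal B"
    using f g by (auto simp: H2_def)
  have "line_sqnorm (\<lambda>z. f z + g z) y \<le> ennreal (2 * A + 2 * B)" if y: "y > 0" for y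
  proof -
    note [measurable] = horizontal_measurable[OF H2_continuous[OF f] y] horizontal_measurable[OF H2_continuous[OF g] y]
    have "(cmod (a + b))\<^sup>2 \<le> 2 * (cmod a)\<^sup>2 + 2 * (cmod b)\<^sup>2" for a b
    proof -
      have "(cmod (a + b))\<^sup>2 \<le> (cmod a + cmod b)\<^sup>2" by (intro power_mono norm_triangle_ineq) auto
      also have "\<dots> \<le> 2 * (cmod a)\<^sup>2 + 2 * (cmod b)\<^sup>2"
        using sum_squares_bound[of "cmod a" "cmod b"] by (simp add: power2_sum)
      finally show ?thesis .
    qed
    then have "line_sqnorm (\<lambda>z. f z + g z) y \<le> (\<integral>\<^sup>+x. 2 * ennreal ((cmod (f (Complex x y)))\<^sup>2) + 2 * ennreal ((cmod (g (Complex x y)))\<^sup>2) \<partial>lborel)"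
    proof -
      assume le: "\<And>a b. (cmod (a + b))\<^sup>2 \<le> 2 * (cmod a)\<^sup>2 + 2 * (cmod b)\<^sup>2"
      have "ennreal ((cmod (a + b))\<^sup>2) \<le> 2 * ennreal ((cmod a)\<^sup>2) + 2 * ennreal ((cmod b)\<^sup>2)" for a b
        using ennreal_leI[OF le[of a b]] by (simp add: ennreal_plus ennreal_mult)
      then show ?thesis unfolding line_sqnorm_def by (intro nn_integral_mono)
    qed
    also have "\<dots> = 2 * line_sqnorm f y + 2 * line_sqnorm g y"
      unfolding line_sqnorm_def by (subst nn_integral_add) (auto simp: nn_integral_cmult)
    also have "\<dots> \<le> 2 * ennreal A + 2 * ennreal B"
      using A(2)[OF y] B(2)[OF y] by (intro add_mono mult_left_mono) auto
    also have "\<dots> = ennreal (2 * A + 2 * B)" using A B by (simp add: ennreal_mult)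
    finally show ?thesis .
  qed
  then show ?thesis using A(1) B(1) H2_holomorphic[OF f] H2_holomorphic[OF g] unfolding H2_def
    by (auto intro!: holomorphic_intros exI[of _ "2 * A + 2 * B"])
qed

lemma H2_bounded_mult:
  assumes f: "H2 f" and v: "v holomorphic_on upper_half_plane" "\<And>z. z \<in> upper_half_plane \<Longrightarrow> cmod (v z) \<le> K"
  shows "H2 (\<lambda>z. v z * f z)"
proof -
  obtain A where A: "0 \<le> A" "\<And>y. y > 0 \<Longrightarrow> line_sqnorm f y \<le> ennreal A"
    using f by (auto simp: H2_def)
  have "line_sqnorm (\<lambda>z. v z * f z) y \<le> ennreal (K\<^sup>2 * A)" if y: "y > 0" for y
  proof -
    note [measurable] = horizontal_measurable[OF H2_continuous[OF f] y]
    have "line_sqnorm (\<lambda>z. v z * f z) y \<le> (\<integral>\<^sup>+x. ennreal (K\<^sup>2) * ennreal ((cmod (f (Complex x y)))\<^sup>2) \<partial>lborel)"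
      unfolding line_sqnorm_def
    proof (rule nn_integral_mono)
      fix x
      have "(cmod (v (Complex x y) * f (Complex x y)))\<^sup>2 \<le> K\<^sup>2 * (cmod (f (Complex x y)))\<^sup>2"
        unfolding norm_mult power_mult_distrib
        using v(2)[of "Complex x y"] y by (intro mult_right_mono power_mono) auto
      then show "ennreal ((cmod (v (Complex x y) * f (Complex x y)))\<^sup>2) \<le> ennreal (K\<^sup>2) * ennreal ((cmod (f (Complex x y)))\<^sup>2)"
        by (simp add: ennreal_leI flip: ennreal_mult)
    qed
    also have "\<dots> = ennreal (K\<^sup>2) * line_sqnorm f y"
      unfolding line_sqnorm_def by (simp add: nn_integral_cmult)
    also have "\<dots> \<le> ennreal (K\<^sup>2) * ennreal A"
      using A(2)[OF y] by (intro mult_left_mono) auto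
    finally show ?thesis using A by (simp add: ennreal_mult)
  qed
  then show ?thesis using A(1) H2_holomorphic[OF f] v(1) unfolding H2_def
    by (auto intro!: holomorphic_intros exI[of _ "K\<^sup>2 * A"])
qed

lemma H2_cmult: "H2 f \<Longrightarrow> H2 (\<lambda>z. c * f z)"
  by (rule H2_bounded_mult[where K = "cmod c"]) auto

lemma H2_diff: "H2 f \<Longrightarrow> H2 g \<Longrightarrow> H2 (\<lambda>z. f z - g z)"
  using H2_add[of f "\<lambda>z. (-1) * g z"] H2_cmult[of g "-1"] by simp

lemma H2_zero: "H2 (\<lambda>z. 0)"
  by (auto simp: H2_def line_sqnorm_def intro: exI[of _ 0])

lemma H2_sum: "finite A \<Longrightarrow> (\<And>i. i \<in> A \<Longrightarrow> H2 (f i)) \<Longrightarrow> H2 (\<lambda>z. \<Sum>i\<in>A. f i z)"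
  by (induction A rule: finite_induct) (auto intro: H2_add H2_zero)

lemma H2_cong:
  assumes "H2 f" "\<And>z. z \<in> upper_half_plane \<Longrightarrow> f z = g z"
  shows "H2 g"
proof -
  have "line_sqnorm g y = line_sqnorm f y" if "y > 0" for y
    unfolding line_sqnorm_def using assms(2) that by simp
  moreover have "g holomorphic_on upper_half_plane"
    using H2_holomorphic[OF assms(1)] assms(2) by (simp cong: holomorphic_cong)
  ultimately show ?thesis using assms(1) by (auto simp: H2_def)
qed

text \<open>
  The function \<open>f z * cnj (f (cnj z + \<i> * (y1 + y2)))\<close> is holomorphic in a strip, so its integral
  does not depend on the height and may be evaluated half-way, where the two factors are conjugate.
\<close>
lemma H2_line_inner:
  assumes f: "H2 f" and y: "0 < y1" "y1 < y2"
  shows "(LINT x|lborel. f (Complex x y1) * cnj (f (Complex x y2))) =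
    of_real (LINT x|lborel. (cmod (f (Complex x ((y1 + y2) / 2))))\<^sup>2)"
proof -
  obtain C where C: "0 \<le> C" "\<And>y. y > 0 \<Longrightarrow> line_sqnorm f y \<le> ennreal C"
    using f by (auto simp: H2_def)
  define c where "c = y1 + y2"
  define h where "h = (\<lambda>z. f z * cnj (f (cnj z + \<i> * of_real c)))"
  have hC: "h (Complex x y) = f (Complex x y) * cnj (f (Complex x (c - y)))" for x y
    by (simp add: h_def complex_eq_iff[of "cnj _ + _"] Complex_eq algebra_simps)
  have "h holomorphic_on {z. 0 < Im z \<and> Im z < c}"
  proof -
    define A where "A = {z. 0 < Im z \<and> Im z < c}"
    have "open A" unfolding A_def
      using open_Int[OF open_halfspace_Im_gt[of 0] open_halfspace_Im_lt[of c]] by (simp add: Int_def)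
    have "(f \<circ> (\<lambda>z. z + \<i> * of_real c)) holomorphic_on (cnj ` A)"
      by (intro holomorphic_on_compose_gen[OF _ H2_holomorphic[OF f]] holomorphic_intros)
         (auto simp: upper_half_plane_def A_def)
    from holomorphic_on_compose_cnj_cnj[OF this \<open>open A\<close>]
    have "(\<lambda>z. cnj (f (cnj z + \<i> * of_real c))) holomorphic_on A" by (simp add: o_def)
    then show ?thesis unfolding h_def A_def
      by (intro holomorphic_intros holomorphic_on_subset[OF H2_holomorphic[OF f]])
         (auto simp: upper_half_plane_def)
  qed
  moreover have "(\<integral>\<^sup>+x. ennreal (cmod (h (Complex x y))) \<partial>lborel) \<le> ennreal (sqrt (C * C))" if "0 < y" "y < c" for y
  proof -
    note hm = horizontal_measurable[OF H2_continuous[OF f]]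
    have [measurable]: "(\<lambda>x. f (Complex x (c - y))) \<in> borel_measurable borel" using hm[of "c - y"] that by simp
    have "(\<lambda>x. cnj (f (Complex x (c - y)))) \<in> borel_measurable borel"
      by (rule borel_measurable_continuous_on[of cnj]) (auto intro: continuous_intros)
    then show ?thesis
      unfolding hC using that C(1) C(2)[of "c - y", unfolded line_sqnorm_def]
      by (intro L2_product(1)[OF hm _ C(2)[unfolded line_sqnorm_def]]) auto
  qed
  ultimately have "(LINT x|lborel. h (Complex x y1)) = (LINT x|lborel. h (Complex x (c / 2)))"
    using y by (intro horizontal_integral_shift[where a = 0 and b = c and C = "sqrt (C * C)"]) (auto simp: c_def)
  moreover have "h (Complex x (c / 2)) = of_real ((cmod (f (Complex x ((y1 + y2) / 2))))\<^sup>2)" for x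
  proof -
    have "c - c / 2 = (y1 + y2) / 2" "c / 2 = (y1 + y2) / 2" unfolding c_def by (simp_all add: field_simps)
    then show ?thesis by (simp only: hC complex_norm_square)
  qed
  ultimately have "(LINT x|lborel. h (Complex x y1)) = of_real (LINT x|lborel. (cmod (f (Complex x ((y1 + y2) / 2))))\<^sup>2)"
    by (simp only: integral_complex_of_real)
  moreover have "h (Complex x y1) = f (Complex x y1) * cnj (f (Complex x y2))" for x
    by (simp add: hC c_def)
  ultimately show ?thesis by simp
qed

text \<open>
  Expanding the square gives \<open>M y + M (y + d) - 2 * M (y + d / 2)\<close>, where \<open>M\<close> is the squared norm on a line, by
  \<open>H2_line_inner\<close>; as \<open>M\<close> is decreasing, this is at most \<open>M y - M (y + d)\<close>. Since \<open>M\<close> is bounded, the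
  differences become small near the real line: translates converge in norm.
\<close>
lemma H2_line_sqnorm_shift_diff:
  assumes f: "H2 f" and y: "0 < y" and d: "0 < d"
  shows "line_sqnorm (\<lambda>z. f z - f (z + \<i> * of_real d)) y \<le>
    ennreal ((LINT x|lborel. (cmod (f (Complex x y)))\<^sup>2) - (LINT x|lborel. (cmod (f (Complex x (y + d))))\<^sup>2))"
proof -
  define M where "M = (\<lambda>y. LINT x|lborel. (cmod (f (Complex x y)))\<^sup>2)"
  have M: "line_sqnorm f y = ennreal (M y)" "M y \<ge> 0" if "y > 0" for y
    using line_sqnorm_eq_LINT[OF f that] by (auto simp: M_def)
  have mono: "M y' \<le> M y" if "0 < y" "y \<le> y'" for y y'
    using line_sqnorm_antimono[OF f that] M[of y] M[of y'] that by simp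
  have eq: "Complex x y + \<i> * of_real d = Complex x (y + d)" for x by (simp add: complex_eq_iff)
  note int = line_sqnorm_eq_LINT(1)[OF f]
  note g = H2_diff[OF f H2_shift[OF f, of d]]
  have intp: "integrable lborel (\<lambda>x. f (Complex x y) * cnj (f (Complex x (y + d))))"
  proof -
    have [measurable]: "(\<lambda>x. f (Complex x (y + d))) \<in> borel_measurable borel"
      using horizontal_measurable[OF H2_continuous[OF f], of "y + d"] y d by simp
    have "(\<lambda>x. cnj (f (Complex x (y + d)))) \<in> borel_measurable borel"
      by (rule borel_measurable_continuous_on[of cnj]) (auto intro: continuous_intros)
    then show ?thesis
      using M[of y] M[of "y + d"] y d
      by (intro L2_product(2)[of _ _ "M y" "M (y + d)"] horizontal_measurable[OF H2_continuous[OF f]])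
         (auto simp: line_sqnorm_def)
  qed
  have "line_sqnorm (\<lambda>z. f z - f (z + \<i> * of_real d)) y = ennreal (LINT x|lborel. (cmod (f (Complex x y) - f (Complex x (y + d))))\<^sup>2)"
    using line_sqnorm_eq_LINT(2)[OF g y] d by (simp add: eq)
  also have "(LINT x|lborel. (cmod (f (Complex x y) - f (Complex x (y + d))))\<^sup>2) =
     (LINT x|lborel. (cmod (f (Complex x y)))\<^sup>2 + (cmod (f (Complex x (y + d))))\<^sup>2 - 2 * Re (f (Complex x y) * cnj (f (Complex x (y + d)))))"
    unfolding cmod_power2
    by (intro Bochner_Integration.integral_cong refl) (simp add: power2_eq_square algebra_simps)
  also have "\<dots> = M y + M (y + d) - 2 * Re (LINT x|lborel. f (Complex x y) * cnj (f (Complex x (y + d))))"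
  proof -
    define p where "p = (\<lambda>x. f (Complex x y) * cnj (f (Complex x (y + d))))"
    have "integrable lborel p" using intp by (simp add: p_def)
    then have "(LINT x|lborel. (cmod (f (Complex x y)))\<^sup>2 + (cmod (f (Complex x (y + d))))\<^sup>2 - 2 * Re (p x)) =
        M y + M (y + d) - 2 * Re (LINT x|lborel. p x)"
      using int[OF y] int[of "y + d"] y d by (simp add: M_def)
    then show ?thesis by (simp only: p_def)
  qed
  also have "Re (LINT x|lborel. f (Complex x y) * cnj (f (Complex x (y + d)))) = M (y + d / 2)"
    using y d by (subst H2_line_inner[OF f]) (auto simp: M_def add_divide_distrib)
  also have "M y + M (y + d) - 2 * M (y + d / 2) \<le> M y - M (y + d)"
    using mono[of "y + d / 2" "y + d"] y d by simp
  finally show ?thesis by (simp add: M_def ennreal_leI)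
qed

lemma vertical_limit_iff_Cauchy:
  fixes \<phi> :: "real \<Rightarrow> complex"
  shows "(\<exists>l. (\<phi> \<longlongrightarrow> l) (at_right 0)) \<longleftrightarrow>
    (\<forall>e>0. \<exists>d>0. \<forall>y y'. 0 < y \<longrightarrow> y < d \<longrightarrow> 0 < y' \<longrightarrow> y' < d \<longrightarrow> dist (\<phi> y) (\<phi> y') < e)" (is "?L \<longleftrightarrow> ?R")
proof
  assume ?L
  then obtain l where l: "(\<phi> \<longlongrightarrow> l) (at_right 0)" by auto
  show ?R
  proof (intro allI impI)
    fix e :: real assume "e > 0"
    then have "eventually (\<lambda>y. dist (\<phi> y) l < e / 2) (at_right 0)" by (intro tendstoD[OF l]) auto
    then obtain d where d: "d > 0" "\<And>y. 0 < y \<Longrightarrow> y < d \<Longrightarrow> dist (\<phi> y) l < e / 2"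
      unfolding eventually_at_right_field by auto
    have "dist (\<phi> y) (\<phi> y') < e" if "0 < y" "y < d" "0 < y'" "y' < d" for y y'
      using dist_triangle_half_l[OF d(2)[OF that(1,2)] d(2)[OF that(3,4)]] .
    then show "\<exists>d>0. \<forall>y y'. 0 < y \<longrightarrow> y < d \<longrightarrow> 0 < y' \<longrightarrow> y' < d \<longrightarrow> dist (\<phi> y) (\<phi> y') < e"
      using d(1) by blast
  qed
next
  assume R: ?R
  have "cauchy_filter (filtermap \<phi> (at_right 0))"
    unfolding cauchy_filter_metric_filtermap
  proof (intro allI impI)
    fix e :: real assume "e > 0"
    then obtain d where d: "d > 0" "\<And>y y'. 0 < y \<Longrightarrow> y < d \<Longrightarrow> 0 < y' \<Longrightarrow> y' < d \<Longrightarrow> dist (\<phi> y) (\<phi> y') < e"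
      using R by blast
    have "eventually (\<lambda>y. 0 < y \<and> y < d) (at_right 0)"
      unfolding eventually_at_right_field using d(1) by blast
    then show "\<exists>P. eventually P (at_right 0) \<and> (\<forall>x y. P x \<and> P y \<longrightarrow> dist (\<phi> x) (\<phi> y) < e)"
      using d(2) by (intro exI[of _ "\<lambda>y. 0 < y \<and> y < d"]) auto
  qed
  from cauchy_filter_complete_converges[OF this complete_UNIV]
  show ?L by (auto simp: filterlim_def filtermap_bot_iff)
qed

lemma dense_heights_le:
  fixes \<psi> :: "real \<Rightarrow> real"
  assumes c: "continuous_on {0<..} \<psi>" and le: "\<And>i. heights i < d \<Longrightarrow> \<psi> (heights i) \<le> e" and y: "0 < y" "y < d"
  shows "\<psi> y \<le> e"
proof (rule ccontr)
  assume "\<not> ?thesis"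
  have "isCont \<psi> y" using c y by (simp add: continuous_on_eq_continuous_at)
  then have "eventually (\<lambda>y'. e < \<psi> y') (at y)"
    unfolding isCont_def by (rule order_tendstoD) (use \<open>\<not> _\<close> in simp)
  then obtain r where r: "r > 0" "\<And>y'. y' \<noteq> y \<Longrightarrow> \<bar>y' - y\<bar> < r \<Longrightarrow> e < \<psi> y'"
    by (auto simp: eventually_at dist_real_def)
  obtain n where n: "max 0 (y - r) < heights n" "heights n < y"
    by (rule heights_dense[of "max 0 (y - r)" y]) (use y r in auto)
  have "e < \<psi> (heights n)" by (rule r(2)) (use n in auto)
  moreover have "\<psi> (heights n) \<le> e" by (rule le) (use n y in auto)
  ultimately show False by simp
qed

lemma vertical_continuous:
  fixes f :: "complex \<Rightarrow> complex"
  assumes "continuous_on upper_half_plane f"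
  shows "continuous_on {0<..} (\<lambda>y. f (Complex x y))"
  by (rule continuous_on_compose2[OF assms])
     (auto simp: Complex_eq upper_half_plane_def intro!: continuous_intros)

text \<open>
  Existence of a vertical limit as a countable condition, which makes the exceptional set measurable.
\<close>
lemma vertical_limit_iff_heights:
  fixes f :: "complex \<Rightarrow> complex"
  assumes f: "continuous_on upper_half_plane f"
  shows "(\<exists>l. ((\<lambda>y. f (Complex x y)) \<longlongrightarrow> l) (at_right 0)) \<longleftrightarrow>
    (\<forall>n::nat. \<exists>m::nat. \<forall>i j. heights i < 1 / real (Suc m) \<longrightarrow> heights j < 1 / real (Suc m) \<longrightarrow>
       dist (f (Complex x (heights i))) (f (Complex x (heights j))) \<le> 1 / real (Suc n))" (is "?L \<longleftrightarrow> ?R")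
proof
  assume L: ?L
  show ?R
  proof
    fix n :: nat
    have "0 < 1 / real (Suc n)" by simp
    with L obtain d where d: "d > 0" "\<And>y y'. 0 < y \<Longrightarrow> y < d \<Longrightarrow> 0 < y' \<Longrightarrow> y' < d \<Longrightarrow> dist (f (Complex x y)) (f (Complex x y')) < 1 / real (Suc n)"
      unfolding vertical_limit_iff_Cauchy by meson
    obtain m where m: "1 / real (Suc m) < d" using reals_Archimedean[OF d(1)] by (auto simp: inverse_eq_divide)
    show "\<exists>m::nat. \<forall>i j. heights i < 1 / real (Suc m) \<longrightarrow> heights j < 1 / real (Suc m) \<longrightarrow>
       dist (f (Complex x (heights i))) (f (Complex x (heights j))) \<le> 1 / real (Suc n)"
      using d(2) heights_pos m by (intro exI[of _ m]) (auto intro!: less_imp_le simp del: of_nat_Suc dest: less_trans)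
  qed
next
  assume R: ?R
  show ?L
    unfolding vertical_limit_iff_Cauchy
  proof (intro allI impI)
    fix e :: real assume "e > 0"
    then obtain n where n: "1 / real (Suc n) < e" using reals_Archimedean by (auto simp: inverse_eq_divide)
    obtain m where m: "\<And>i j. heights i < 1 / real (Suc m) \<Longrightarrow> heights j < 1 / real (Suc m) \<Longrightarrow>
       dist (f (Complex x (heights i))) (f (Complex x (heights j))) \<le> 1 / real (Suc n)"
      using R by blast
    note vc = vertical_continuous[OF f, of x]
    have 1: "dist (f (Complex x y)) (f (Complex x (heights j))) \<le> 1 / real (Suc n)"
      if "heights j < 1 / real (Suc m)" "0 < y" "y < 1 / real (Suc m)" for y j
      by (rule dense_heights_le[where \<psi> = "\<lambda>y. dist (f (Complex x y)) (f (Complex x (heights j)))", OF _ m that(2,3)])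
         (use that in \<open>auto intro!: continuous_intros vc\<close>)
    have 2: "dist (f (Complex x y)) (f (Complex x y')) \<le> 1 / real (Suc n)"
      if "0 < y" "y < 1 / real (Suc m)" "0 < y'" "y' < 1 / real (Suc m)" for y y'
      by (rule dense_heights_le[where \<psi> = "\<lambda>y'. dist (f (Complex x y)) (f (Complex x y'))", OF _ 1 that(3,4)])
         (use that in \<open>auto intro!: continuous_intros vc\<close>)
    show "\<exists>d>0. \<forall>y y'. 0 < y \<longrightarrow> y < d \<longrightarrow> 0 < y' \<longrightarrow> y' < d \<longrightarrow> dist (f (Complex x y)) (f (Complex x y')) < e"
      using 2 n by (intro exI[of _ "1 / real (Suc m)"]) (auto intro: le_less_trans simp del: of_nat_Suc)
  qed
qed

lemma boundary_value_eqI: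
  assumes "((\<lambda>y. f (Complex x y)) \<longlongrightarrow> l) (at_right 0)"
  shows "boundary_value f x = l"
  unfolding boundary_value_def by (rule tendsto_Lim[OF _ assms]) simp

lemma boundary_value_tendsto:
  assumes "\<exists>l. ((\<lambda>y. f (Complex x y)) \<longlongrightarrow> l) (at_right 0)"
  shows "((\<lambda>y. f (Complex x y)) \<longlongrightarrow> boundary_value f x) (at_right 0)"
  using assms boundary_value_eqI by blast

lemma inverse_Suc_at_right: "filterlim (\<lambda>n. 1 / real (Suc n)) (at_right 0) sequentially"
  unfolding filterlim_at using LIMSEQ_Suc[OF lim_1_over_n[where 'a = real]] by auto

text \<open>
  At points without a vertical limit, \<^const>\<open>boundary_value\<close> is one fixed number, so the function is Borel
  measurable as it stands and not only up to null sets.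
\<close>
lemma boundary_value_measurable:
  fixes f :: "complex \<Rightarrow> complex"
  assumes f: "continuous_on upper_half_plane f"
  shows "boundary_value f \<in> borel_measurable borel"
proof -
  define Q where "Q = (\<lambda>x. \<forall>n::nat. \<exists>m::nat. \<forall>i j. heights i < 1 / real (Suc m) \<longrightarrow> heights j < 1 / real (Suc m) \<longrightarrow>
       dist (f (Complex x (heights i))) (f (Complex x (heights j))) \<le> 1 / real (Suc n))"
  have Q: "Q x \<longleftrightarrow> (\<exists>l. ((\<lambda>y. f (Complex x y)) \<longlongrightarrow> l) (at_right 0))" for x
    unfolding Q_def vertical_limit_iff_heights[OF f] ..
  note [measurable] = horizontal_measurable[OF f heights_pos]
  have [measurable]: "Measurable.pred borel Q"
    unfolding Q_def by measurable
  have [measurable]: "(\<lambda>x. f (Complex x (1 / real (Suc n)))) \<in> borel_measurable borel" for n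
    by (rule horizontal_measurable[OF f]) simp
  have "boundary_value f x = (if Q x then lim (\<lambda>n. f (Complex x (1 / real (Suc n)))) else (THE l. False))" for x
  proof (cases "Q x")
    case True
    then have "((\<lambda>y. f (Complex x y)) \<longlongrightarrow> boundary_value f x) (at_right 0)"
      using Q boundary_value_tendsto by blast
    from filterlim_compose[OF this inverse_Suc_at_right]
    show ?thesis using True by (simp add: limI)
  next
    case False
    then have "(\<lambda>l. ((\<lambda>y. f (Complex x y)) \<longlongrightarrow> l) (at_right 0)) = (\<lambda>l. False)"
      unfolding Q by auto
    then show ?thesis using False by (simp add: boundary_value_def Topological_Spaces.Lim_def)
  qed
  then have "boundary_value f = (\<lambda>x. if Q x then lim (\<lambda>n. f (Complex x (1 / real (Suc n)))) else (THE l. False))"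
    by auto
  also have "\<dots> \<in> borel_measurable borel" by measurable
  finally show ?thesis .
qed

text \<open>
  The translate \<open>f (z + \<i> * d)\<close> is continuous up to the line, so the oscillation of \<open>f\<close> along a
  vertical is at most twice the vertical maximum of \<open>f z - f (z + \<i> * d)\<close>. By the maximal inequality
  this maximum is small in \<open>L\<^sup>2\<close> for small \<open>d\<close>; hence its infimum over a sequence of values \<open>d\<close> is zero almost everywhere.
\<close>
theorem H2_vertical_limit:
  assumes f: "H2 f"
  shows "AE x in lborel. \<exists>l. ((\<lambda>y. f (Complex x y)) \<longlongrightarrow> l) (at_right 0)"
proof -
  define M where "M = (\<lambda>y. LINT x|lborel. (cmod (f (Complex x y)))\<^sup>2)"
  obtain C where C: "0 \<le> C" "\<And>y. y > 0 \<Longrightarrow> line_sqnorm f y \<le> ennreal C"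
    using f by (auto simp: H2_def)
  have M: "line_sqnorm f y = ennreal (M y)" "M y \<ge> 0" if "y > 0" for y
    using line_sqnorm_eq_LINT[OF f that] by (auto simp: M_def)
  have mono: "M y' \<le> M y" if "0 < y" "y \<le> y'" for y y'
    using line_sqnorm_antimono[OF f that] M[of y] M[of y'] that by simp
  have MC: "M y \<le> C" if "y > 0" for y using C(2)[OF that] M[OF that] C(1) by simp
  have bdd: "bdd_above (M ` {0<..})" using MC by (intro bdd_aboveI2[where M = C]) auto
  have ex: "\<exists>d>0. \<forall>y. 0 < y \<longrightarrow> y < d \<longrightarrow> M y - M (y + d) \<le> e" if e: "e > 0" for e
  proof -
    have "\<exists>d\<in>{0<..}. (SUP y\<in>{0<..}. M y) - e < M d"
      by (rule less_cSUP_iff[THEN iffD1, OF _ bdd]) (use e in auto)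
    then obtain d where d: "d > 0" "(SUP y\<in>{0<..}. M y) - e < M d" by auto
    have "M y - M (y + d / 2) \<le> e" if "0 < y" "y < d / 2" for y
      using cSUP_upper[OF _ bdd, of y] mono[of "y + d / 2" d] that d by simp
    then show ?thesis using d(1) by (intro exI[of _ "d / 2"]) auto
  qed
  define e where "e = (\<lambda>k::nat. inverse (real (Suc k)))"
  have "\<exists>d. \<forall>k. d k > 0 \<and> (\<forall>y. 0 < y \<longrightarrow> y < d k \<longrightarrow> M y - M (y + d k) \<le> e k)"
    by (rule choice) (use ex in \<open>auto simp: e_def\<close>)
  then obtain d where d: "\<And>k. d k > 0" "\<And>k y. 0 < y \<Longrightarrow> y < d k \<Longrightarrow> M y - M (y + d k) \<le> e k" by blast
  define D where "D = (\<lambda>k. vertical_max (\<lambda>z. f z - f (z + \<i> * of_real (d k))))"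
  have H2d: "H2 (\<lambda>z. f z - f (z + \<i> * of_real (d k)))" for k
    by (intro H2_diff H2_shift f less_imp_le d)
  have [measurable]: "D k \<in> borel_measurable borel" for k
    unfolding D_def by (intro vertical_max_measurable H2_continuous H2d)
  have intD: "(\<integral>\<^sup>+x. D k x \<partial>lborel) \<le> 65 * ennreal (e k)" for k
    unfolding D_def
  proof (rule vertical_max_bound[OF H2d _ d(1)])
    fix y assume y: "0 < y" "y < d k"
    have "line_sqnorm (\<lambda>z. f z - f (z + \<i> * of_real (d k))) y \<le> ennreal (M y - M (y + d k))"
      unfolding M_def by (rule H2_line_sqnorm_shift_diff[OF f y(1) d(1)])
    also have "\<dots> \<le> ennreal (e k)" by (intro ennreal_leI d(2) y)
    finally show "line_sqnorm (\<lambda>z. f z - f (z + \<i> * of_real (d k))) y \<le> ennreal (e k)" .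
  qed
  have "(\<integral>\<^sup>+x. (INF k. D k x) \<partial>lborel) \<le> 0"
  proof (rule LIMSEQ_le_const)
    \<comment> \<open>The infimum is below every single maximum, whose integral is at most \<open>65 * e k\<close>.\<close>
    have "(\<lambda>k. 65 * e k) \<longlonglongrightarrow> 65 * 0"
      unfolding e_def by (intro tendsto_intros LIMSEQ_inverse_real_of_nat)
    from tendsto_ennrealI[OF this]
    show "(\<lambda>k. ennreal (65 * e k)) \<longlonglongrightarrow> 0" by simp
    show "\<exists>N. \<forall>k\<ge>N. (\<integral>\<^sup>+x. (INF k. D k x) \<partial>lborel) \<le> ennreal (65 * e k)"
    proof (intro exI[of _ 0] allI impI)
      fix k
      have "(\<integral>\<^sup>+x. (INF k. D k x) \<partial>lborel) \<le> (\<integral>\<^sup>+x. D k x \<partial>lborel)"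
        by (intro nn_integral_mono INF_lower) auto
      also note intD[of k]
      finally show "(\<integral>\<^sup>+x. (INF k. D k x) \<partial>lborel) \<le> ennreal (65 * e k)"
        by (simp add: ennreal_mult e_def)
    qed
  qed
  then have "AE x in lborel. (INF k. D k x) = 0"
    by (subst nn_integral_0_iff_AE[symmetric]) auto
  then show ?thesis
  proof eventually_elim
    fix x assume x: "(INF k. D k x) = 0"
    show "\<exists>l. ((\<lambda>y. f (Complex x y)) \<longlongrightarrow> l) (at_right 0)"
      unfolding vertical_limit_iff_Cauchy
    proof (intro allI impI)
      fix r :: real assume r: "r > 0"
      have "(INF k. D k x) < ennreal ((r / 4)\<^sup>2)" using r by (simp add: x)
      then obtain k where k: "D k x < ennreal ((r / 4)\<^sup>2)" by (auto simp: INF_less_iff)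
      have near: "dist (f (Complex x y)) (f (Complex x (y + d k))) < r / 4" if "y > 0" for y
      proof -
        have eq: "Complex x y + \<i> * of_real (d k) = Complex x (y + d k)" by (simp add: complex_eq_iff)
        have "ennreal ((cmod (f (Complex x y) - f (Complex x (y + d k))))\<^sup>2) \<le> D k x"
          using vertical_max_upper[OF H2_continuous[OF H2d[of k]] that, of x] unfolding D_def eq .
        also note k
        finally have "(cmod (f (Complex x y) - f (Complex x (y + d k))))\<^sup>2 < (r / 4)\<^sup>2"
          using r by (simp add: ennreal_less_iff)
        then have "cmod (f (Complex x y) - f (Complex x (y + d k))) < r / 4"
          by (rule power_less_imp_less_base) (use r in simp)
        then show ?thesis by (simp add: dist_norm)
      qed
      have "isCont (\<lambda>y. f (Complex x y)) (d k)"
        using vertical_continuous[OF H2_continuous[OF f], of x] d(1)[of k] by (simp add: continuous_on_eq_continuous_at)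
      then obtain s where s: "s > 0" "\<And>y. dist y (d k) < s \<Longrightarrow> dist (f (Complex x y)) (f (Complex x (d k))) < r / 4"
        using r unfolding continuous_at_eps_delta by (meson divide_pos_pos zero_less_numeral)
      have half: "dist (f (Complex x y)) (f (Complex x (d k))) < r / 2" if "0 < y" "y < s" for y
        using dist_triangle_less_add[OF near[OF that(1)], of "f (Complex x (d k))" "r / 4"] s(2)[of "y + d k"] that
        by (simp add: dist_real_def dist_commute)
      show "\<exists>d>0. \<forall>y y'. 0 < y \<longrightarrow> y < d \<longrightarrow> 0 < y' \<longrightarrow> y' < d \<longrightarrow> dist (f (Complex x y)) (f (Complex x y')) < r"
        using s(1) dist_triangle_half_l[OF half half] by (intro exI[of _ s]) auto
    qed
  qed
qed

section \<open>Boundary integrals of Hardy space functions\<close>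

lemma H2_boundary_measurable: "H2 f \<Longrightarrow> boundary_value f \<in> borel_measurable borel"
  by (intro boundary_value_measurable H2_continuous)

lemma H2_boundary_tendsto:
  assumes f: "H2 f"
  shows "AE x in lborel. ((\<lambda>y. f (Complex x y)) \<longlongrightarrow> boundary_value f x) (at_right 0)"
  using H2_vertical_limit[OF f] by eventually_elim (rule boundary_value_tendsto)

lemma H2_boundary_LIMSEQ:
  assumes f: "H2 f"
  shows "AE x in lborel. (\<lambda>n. f (Complex x (1 / real (Suc n)))) \<longlonglongrightarrow> boundary_value f x"
  using H2_boundary_tendsto[OF f] by eventually_elim (rule filterlim_compose[OF _ inverse_Suc_at_right])

lemma nn_integral_norm_square_LIMSEQ_le:
  fixes f :: "nat \<Rightarrow> real \<Rightarrow> complex"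
  assumes [measurable]: "\<And>n. f n \<in> borel_measurable borel"
    and lim: "AE x in lborel. (\<lambda>n. f n x) \<longlonglongrightarrow> g x"
    and c: "\<And>n. (\<integral>\<^sup>+x. ennreal ((cmod (f n x))\<^sup>2) \<partial>lborel) \<le> c"
  shows "(\<integral>\<^sup>+x. ennreal ((cmod (g x))\<^sup>2) \<partial>lborel) \<le> c"
proof -
  have "(\<integral>\<^sup>+x. ennreal ((cmod (g x))\<^sup>2) \<partial>lborel) = (\<integral>\<^sup>+x. liminf (\<lambda>n. ennreal ((cmod (f n x))\<^sup>2)) \<partial>lborel)"
  proof (rule nn_integral_cong_AE, use lim in eventually_elim)
    fix x assume "(\<lambda>n. f n x) \<longlonglongrightarrow> g x"
    then have "(\<lambda>n. ennreal ((cmod (f n x))\<^sup>2)) \<longlonglongrightarrow> ennreal ((cmod (g x))\<^sup>2)"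
      by (intro tendsto_intros)
    from lim_imp_Liminf[OF _ this]
    show "ennreal ((cmod (g x))\<^sup>2) = liminf (\<lambda>n. ennreal ((cmod (f n x))\<^sup>2))" by simp
  qed
  also have "\<dots> \<le> liminf (\<lambda>n. \<integral>\<^sup>+x. ennreal ((cmod (f n x))\<^sup>2) \<partial>lborel)"
    by (rule nn_integral_liminf) measurable
  also have "\<dots> \<le> liminf (\<lambda>n. c)" by (rule Liminf_mono) (use c in auto)
  also have "\<dots> = c" by (simp add: Liminf_const)
  finally show ?thesis .
qed

lemma H2_boundary_norm_le:
  assumes f: "H2 f" and c: "\<And>y. y > 0 \<Longrightarrow> line_sqnorm f y \<le> c"
  shows "(\<integral>\<^sup>+x. ennreal ((cmod (boundary_value f x))\<^sup>2) \<partial>lborel) \<le> c"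
proof (rule nn_integral_norm_square_LIMSEQ_le[OF _ H2_boundary_LIMSEQ[OF f]])
  show "(\<integral>\<^sup>+x. ennreal ((cmod (f (Complex x (1 / real (Suc n)))))\<^sup>2) \<partial>lborel) \<le> c" for n
    using c[of "1 / real (Suc n)"] by (simp add: line_sqnorm_def)
qed (use horizontal_measurable[OF H2_continuous[OF f]] in simp)

definition boundary_sqnorm :: "(complex \<Rightarrow> complex) \<Rightarrow> real" where
  "boundary_sqnorm f = (LINT x|lborel. (cmod (boundary_value f x))\<^sup>2)"

lemma boundary_sqnorm_nonneg: "0 \<le> boundary_sqnorm f"
  unfolding boundary_sqnorm_def by (rule integral_nonneg_AE) simp

lemma H2_boundary_square_integrable:
  assumes f: "H2 f"
  shows "integrable lborel (\<lambda>x. (cmod (boundary_value f x))\<^sup>2)"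
    and "(\<integral>\<^sup>+x. ennreal ((cmod (boundary_value f x))\<^sup>2) \<partial>lborel) = ennreal (boundary_sqnorm f)"
proof -
  note [measurable] = H2_boundary_measurable[OF f]
  obtain C where C: "0 \<le> C" "\<And>y. y > 0 \<Longrightarrow> line_sqnorm f y \<le> ennreal C"
    using f by (auto simp: H2_def)
  show int: "integrable lborel (\<lambda>x. (cmod (boundary_value f x))\<^sup>2)"
    by (rule integrableI_bounded) (use H2_boundary_norm_le[OF f C(2)] in \<open>auto intro: le_less_trans\<close>)
  show "(\<integral>\<^sup>+x. ennreal ((cmod (boundary_value f x))\<^sup>2) \<partial>lborel) = ennreal (boundary_sqnorm f)"
    unfolding boundary_sqnorm_def by (rule nn_integral_eq_integral[OF int]) auto
qed

text \<open>
  Dominated convergence; the majorant of \<open>f\<close> is the square root of \<^const>\<open>vertical_max\<close>, which is in \<open>L\<^sup>2\<close>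
  by the maximal inequality, and products are dominated by sums of squares.
\<close>
lemma H2_boundary_limit:
  assumes f: "H2 f" and [measurable]: "\<And>n. V n \<in> borel_measurable borel" "Vl \<in> borel_measurable borel" "k \<in> borel_measurable borel"
    and lim: "AE x in lborel. (\<lambda>n. V n x) \<longlonglongrightarrow> Vl x"
    and dom: "\<And>n x. cmod (V n x) \<le> k x" and k: "(\<integral>\<^sup>+x. ennreal ((k x)\<^sup>2) \<partial>lborel) < \<infinity>"
  shows "(\<lambda>n. LINT x|lborel. f (Complex x (1 / real (Suc n))) * V n x) \<longlonglongrightarrow> (LINT x|lborel. boundary_value f x * Vl x)"
    and "integrable lborel (\<lambda>x. boundary_value f x * Vl x)"
proof -
  obtain C where C: "0 \<le> C" "\<And>y. y > 0 \<Longrightarrow> line_sqnorm f y \<le> ennreal C"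
    using f by (auto simp: H2_def)
  note [measurable] = H2_boundary_measurable[OF f] vertical_max_measurable[OF H2_continuous[OF f]]
  have [measurable]: "(\<lambda>x. f (Complex x (1 / real (Suc n)))) \<in> borel_measurable borel" for n
    by (rule horizontal_measurable[OF H2_continuous[OF f]]) simp
  have max_int: "(\<integral>\<^sup>+x. vertical_max f x \<partial>lborel) < \<infinity>"
  proof -
    have "(\<integral>\<^sup>+x. vertical_max f x \<partial>lborel) \<le> 65 * ennreal C"
      by (rule vertical_max_bound[OF f C(2), where ?\<eta>0.0 = 1]) auto
    also have "\<dots> < \<infinity>" by (simp add: ennreal_mult_less_top)
    finally show ?thesis .
  qed
  then have fin: "AE x in lborel. vertical_max f x \<noteq> \<infinity>"
    by (intro nn_integral_noteq_infinite) auto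
  define w where "w = (\<lambda>x. enn2real (vertical_max f x) + (k x)\<^sup>2)"
  have "integrable lborel (\<lambda>x. enn2real (vertical_max f x))"
  proof (rule integrableI_bounded)
    have "(\<integral>\<^sup>+x. ennreal (norm (enn2real (vertical_max f x))) \<partial>lborel) = (\<integral>\<^sup>+x. vertical_max f x \<partial>lborel)"
      using fin by (intro nn_integral_cong_AE) (auto elim!: eventually_mono simp: ennreal_enn2real_if)
    then show "(\<integral>\<^sup>+x. ennreal (norm (enn2real (vertical_max f x))) \<partial>lborel) < \<infinity>" using max_int by simp
  qed auto
  moreover have "integrable lborel (\<lambda>x. (k x)\<^sup>2)"
    by (rule integrableI_bounded) (use k in auto)
  ultimately have w: "integrable lborel w" unfolding w_def by (rule Bochner_Integration.integrable_add)
  have lim': "AE x in lborel. (\<lambda>n. f (Complex x (1 / real (Suc n))) * V n x) \<longlonglongrightarrow> boundary_value f x * Vl x"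
    using H2_boundary_LIMSEQ[OF f] lim by eventually_elim (rule tendsto_mult)
  have bound: "AE x in lborel. norm (f (Complex x (1 / real (Suc n))) * V n x) \<le> w x" for n
    using fin
  proof eventually_elim
    fix x assume fx: "vertical_max f x \<noteq> \<infinity>"
    define a where "a = cmod (f (Complex x (1 / real (Suc n))))"
    have "ennreal (a\<^sup>2) \<le> vertical_max f x"
      unfolding a_def by (rule vertical_max_upper[OF H2_continuous[OF f]]) simp
    also have "\<dots> = ennreal (enn2real (vertical_max f x))" using fx by (simp add: ennreal_enn2real_if)
    finally have a2: "a\<^sup>2 \<le> enn2real (vertical_max f x)" by (simp add: ennreal_le_iff)
    have "cmod (V n x) \<le> k x" by (rule dom)
    then have "a * cmod (V n x) \<le> a * k x" by (intro mult_left_mono) (auto simp: a_def)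
    also have "\<dots> \<le> a\<^sup>2 + (k x)\<^sup>2"
      using sum_squares_bound[of a "k x"] zero_le_power2[of a] zero_le_power2[of "k x"] by linarith
    finally show "norm (f (Complex x (1 / real (Suc n))) * V n x) \<le> w x"
      using a2 by (simp add: w_def norm_mult a_def)
  qed
  show "(\<lambda>n. LINT x|lborel. f (Complex x (1 / real (Suc n))) * V n x) \<longlonglongrightarrow> (LINT x|lborel. boundary_value f x * Vl x)"
    by (rule integral_dominated_convergence[OF _ _ w lim' bound]) measurable
  show "integrable lborel (\<lambda>x. boundary_value f x * Vl x)"
    by (rule integrable_dominated_convergence[OF _ _ w lim' bound]) measurable
qed

lemma H2_poisson_boundary:
  assumes f: "H2 f" and b: "0 < b"
  shows "f (Complex a b) = (LINT x|lborel. boundary_value f x * of_real (poisson b (x - a)))"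
    and "integrable lborel (\<lambda>x. boundary_value f x * of_real (poisson b (x - a)))"
proof -
  have k: "(\<integral>\<^sup>+x. ennreal ((poisson b (x - a))\<^sup>2) \<partial>lborel) < \<infinity>"
    using nn_integral_poisson_square_le[OF b, of a] by (auto intro: le_less_trans)
  note L = H2_boundary_limit[OF f, where V = "\<lambda>_ x. of_real (poisson b (x - a))" and Vl = "\<lambda>x. of_real (poisson b (x - a))" and k = "\<lambda>x. poisson b (x - a)",
      OF _ _ _ _ _ k]
  show "integrable lborel (\<lambda>x. boundary_value f x * of_real (poisson b (x - a)))"
    by (rule L(2)) (use b in \<open>auto simp: poisson_nonneg\<close>)
  have 1: "(\<lambda>n. LINT x|lborel. f (Complex x (1 / real (Suc n))) * of_real (poisson b (x - a))) \<longlonglongrightarrow>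
      (LINT x|lborel. boundary_value f x * of_real (poisson b (x - a)))"
    by (rule L(1)) (use b in \<open>auto simp: poisson_nonneg\<close>)
  have "(\<lambda>n. f (Complex a (1 / real (Suc n) + b))) \<longlonglongrightarrow> f (Complex a b)"
  proof -
    have "isCont (\<lambda>y. f (Complex a y)) b"
      using vertical_continuous[OF H2_continuous[OF f], of a] b by (simp add: continuous_on_eq_continuous_at)
    moreover have "(\<lambda>n. 1 / real (Suc n) + b) \<longlonglongrightarrow> 0 + b"
      by (intro tendsto_intros LIMSEQ_Suc[OF lim_1_over_n])
    ultimately show ?thesis by (intro isCont_tendsto_compose[where g = "\<lambda>y. f (Complex a y)"]) auto
  qed
  then have "(\<lambda>n. LINT x|lborel. f (Complex x (1 / real (Suc n))) * of_real (poisson b (x - a))) \<longlonglongrightarrow> f (Complex a b)"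
    using H2_poisson[OF f _ b, of "1 / real (Suc n)" for n] by simp
  from LIMSEQ_unique[OF this 1] show "f (Complex a b) = (LINT x|lborel. boundary_value f x * of_real (poisson b (x - a)))" .
qed

lemma H2_line_sqnorm_le_boundary:
  assumes f: "H2 f" and y: "0 < y"
  shows "line_sqnorm f y \<le> ennreal (boundary_sqnorm f)"
proof -
  note [measurable] = H2_boundary_measurable[OF f]
  have "ennreal (cmod (f (Complex a y))) \<le>
    (\<integral>\<^sup>+x. ennreal (poisson y (a - x)) * ennreal (cmod (boundary_value f x)) \<partial>lborel)" for a
    using integral_norm_bound_ennreal[OF H2_poisson_boundary(2)[OF f y, of a]] y
    by (simp add: H2_poisson_boundary(1)[OF f y] norm_mult poisson_nonneg ennreal_mult mult.commute poisson_minus[of y a])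
  then have "line_sqnorm f y \<le> (\<integral>\<^sup>+a. (\<integral>\<^sup>+x. ennreal (poisson y (a - x)) * ennreal (cmod (boundary_value f x)) \<partial>lborel)\<^sup>2 \<partial>lborel)"
    unfolding line_sqnorm_def by (intro nn_integral_mono) (simp add: power_mono flip: ennreal_power)
  also have "\<dots> \<le> (\<integral>\<^sup>+x. (ennreal (cmod (boundary_value f x)))\<^sup>2 \<partial>lborel)"
    by (rule nn_integral_poisson_convolution_square[OF y]) measurable
  also have "\<dots> = ennreal (boundary_sqnorm f)" by (simp add: H2_boundary_square_integrable[OF f] ennreal_power)
  finally show ?thesis .
qed

lemma cmod_Complex_plus_i: "cmod (Complex x y + \<i>) = sqrt (x\<^sup>2 + (y + 1)\<^sup>2)"
  by (simp add: cmod_def)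

lemma line_sqnorm_decay:
  assumes v: "\<And>z. z \<in> upper_half_plane \<Longrightarrow> cmod (v z) \<le> K / cmod (z + \<i>)" and y: "0 < y" and K: "0 \<le> K"
  shows "line_sqnorm v y \<le> ennreal (K\<^sup>2 * pi / (y + 1))"
proof -
  have "line_sqnorm v y \<le> (\<integral>\<^sup>+x. ennreal (K\<^sup>2 * pi / (y + 1)) * ennreal (poisson (y + 1) (x - 0)) \<partial>lborel)"
    unfolding line_sqnorm_def
  proof (rule nn_integral_mono)
    fix x
    have "(cmod (v (Complex x y)))\<^sup>2 \<le> (K / cmod (Complex x y + \<i>))\<^sup>2"
      using v[of "Complex x y"] y by (intro power_mono) auto
    also have "\<dots> = K\<^sup>2 * pi / (y + 1) * poisson (y + 1) (x - 0)"
      using y unfolding cmod_Complex_plus_i by (simp add: power_divide poisson_def)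
    finally show "ennreal ((cmod (v (Complex x y)))\<^sup>2) \<le> ennreal (K\<^sup>2 * pi / (y + 1)) * ennreal (poisson (y + 1) (x - 0))"
      using y by (simp add: ennreal_leI poisson_nonneg flip: ennreal_mult)
  qed
  also have "\<dots> = ennreal (K\<^sup>2 * pi / (y + 1))"
    using y nn_integral_poisson[of "y + 1" 0] by (simp add: nn_integral_cmult)
  finally show ?thesis .
qed

lemma H2_decay:
  assumes hol: "v holomorphic_on upper_half_plane"
    and v: "\<And>z. z \<in> upper_half_plane \<Longrightarrow> cmod (v z) \<le> K / cmod (z + \<i>)"
  shows "H2 v"
proof -
  have K: "0 \<le> K"
  proof -
    have "0 \<le> cmod (v \<i>)" by simp
    also have "\<dots> \<le> K / cmod (\<i> + \<i>)" by (rule v) (simp add: upper_half_plane_def)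
    finally show ?thesis by (simp add: zero_le_divide_iff)
  qed
  have "line_sqnorm v y \<le> ennreal (K\<^sup>2 * pi)" if y: "0 < y" for y
  proof -
    have "K\<^sup>2 * pi / (y + 1) \<le> K\<^sup>2 * pi / 1" using y by (intro divide_left_mono) auto
    then show ?thesis using line_sqnorm_decay[OF v y K] by (auto intro: order_trans ennreal_leI)
  qed
  then show ?thesis using hol unfolding H2_def by (auto intro!: exI[of _ "K\<^sup>2 * pi"])
qed

text \<open>
  The integral of \<open>f * v\<close> does not depend on the height. It tends to zero at large heights because the norm of
  \<open>v\<close> on lines does, and it tends to the boundary integral at small heights.
\<close>
theorem H2_boundary_product_zero:
  assumes f: "H2 f" and hol: "v holomorphic_on upper_half_plane"
    and v: "\<And>z. z \<in> upper_half_plane \<Longrightarrow> cmod (v z) \<le> K / cmod (z + \<i>)"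
  shows "(LINT x|lborel. boundary_value f x * boundary_value v x) = 0"
    and "integrable lborel (\<lambda>x. boundary_value f x * boundary_value v x)"
proof -
  have K: "0 \<le> K"
  proof -
    have "0 \<le> cmod (v \<i>)" by simp
    also have "\<dots> \<le> K / cmod (\<i> + \<i>)" by (rule v) (simp add: upper_half_plane_def)
    finally show ?thesis by (simp add: zero_le_divide_iff)
  qed
  have H2v: "H2 v" by (rule H2_decay[OF hol v])
  obtain C where C: "0 \<le> C" "\<And>y. y > 0 \<Longrightarrow> line_sqnorm f y \<le> ennreal C"
    using f by (auto simp: H2_def)
  note hmf = horizontal_measurable[OF H2_continuous[OF f]] and hmv = horizontal_measurable[OF H2_continuous[OF H2v]]
  define I where "I = (\<lambda>y. LINT x|lborel. f (Complex x y) * v (Complex x y))"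
  have dec: "line_sqnorm v y \<le> ennreal (K\<^sup>2 * pi / (y + 1))" if "0 < y" for y
    by (rule line_sqnorm_decay[OF v that K])
  have prod: "(\<integral>\<^sup>+x. ennreal (cmod (f (Complex x y) * v (Complex x y))) \<partial>lborel) \<le> ennreal (sqrt (C * (K\<^sup>2 * pi / (y + 1))))"
     "cmod (I y) \<le> sqrt (C * (K\<^sup>2 * pi / (y + 1)))" if y: "0 < y" for y
    unfolding I_def
    using L2_product(1,3)[OF hmf[OF y] hmv[OF y] C(2)[OF y, unfolded line_sqnorm_def] dec[OF y, unfolded line_sqnorm_def] C(1)] y
    by simp_all
  have const: "I y1 = I y2" if y: "0 < y1" "y1 < y2" for y1 y2
    unfolding I_def
  proof (rule horizontal_integral_shift[where a = 0 and b = "y2 + 1" and C = "sqrt (C * (K\<^sup>2 * pi))" and h = "\<lambda>z. f z * v z"])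
    show "(\<lambda>z. f z * v z) holomorphic_on {z. 0 < Im z \<and> Im z < y2 + 1}"
      by (intro holomorphic_intros holomorphic_on_subset[OF H2_holomorphic[OF f]] holomorphic_on_subset[OF hol])
         (auto simp: upper_half_plane_def)
    fix y assume "y1 \<le> y" "y \<le> y2"
    then have y0: "0 < y" using y by simp
    have "sqrt (C * (K\<^sup>2 * pi / (y + 1))) \<le> sqrt (C * (K\<^sup>2 * pi / 1))"
      using y0 C by (intro real_sqrt_le_mono mult_left_mono divide_left_mono) auto
    then show "(\<integral>\<^sup>+x. ennreal (cmod (f (Complex x y) * v (Complex x y))) \<partial>lborel) \<le> ennreal (sqrt (C * (K\<^sup>2 * pi)))"
      using prod(1)[OF y0] by (metis (no_types, lifting) div_by_1 ennreal_leI order_trans)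
  qed (use y in auto)
  have I0: "I y = 0" if y: "0 < y" for y
  proof -
    have "((\<lambda>t. sqrt (C * (K\<^sup>2 * pi * inverse (t + 1)))) \<longlongrightarrow> sqrt (C * (K\<^sup>2 * pi * 0))) at_top"
    proof (intro tendsto_intros tendsto_inverse_0_at_top)
      show "filterlim (\<lambda>t::real. t + 1) at_top at_top"
        using filterlim_tendsto_add_at_top[OF tendsto_const[of 1] filterlim_ident] by (simp add: add.commute)
    qed
    then have "((\<lambda>t. sqrt (C * (K\<^sup>2 * pi / (t + 1)))) \<longlongrightarrow> 0) at_top" by (simp add: divide_inverse)
    moreover have "eventually (\<lambda>t. cmod (I y) \<le> sqrt (C * (K\<^sup>2 * pi / (t + 1)))) at_top"
      using eventually_gt_at_top[of y]
    proof eventually_elim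
      fix t assume "y < t"
      then show "cmod (I y) \<le> sqrt (C * (K\<^sup>2 * pi / (t + 1)))"
        using const[of y t] prod(2)[of t] y by simp
    qed
    ultimately have "cmod (I y) \<le> 0" by (intro tendsto_lowerbound) auto
    then show ?thesis by simp
  qed
  define k where "k = (\<lambda>x::real. K / sqrt (x\<^sup>2 + 1))"
  have [measurable]: "k \<in> borel_measurable borel" unfolding k_def by measurable
  have kint: "(\<integral>\<^sup>+x. ennreal ((k x)\<^sup>2) \<partial>lborel) < \<infinity>"
  proof -
    have "(\<integral>\<^sup>+x. ennreal ((k x)\<^sup>2) \<partial>lborel) = (\<integral>\<^sup>+x. ennreal (K\<^sup>2 * pi) * ennreal (poisson 1 (x - 0)) \<partial>lborel)"
      by (intro nn_integral_cong) (simp add: k_def power_divide poisson_def poisson_nonneg add_nonneg_nonneg flip: ennreal_mult)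
    also have "\<dots> = ennreal (K\<^sup>2 * pi)" using nn_integral_poisson[of 1 0] by (simp add: nn_integral_cmult)
    finally show ?thesis by simp
  qed
  have vk: "cmod (v (Complex x (1 / real (Suc n)))) \<le> k x" for x n
  proof -
    define y where "y = 1 / real (Suc n)"
    have y: "0 < y" by (simp add: y_def)
    have "cmod (v (Complex x y)) \<le> K / cmod (Complex x y + \<i>)" by (rule v) (use y in simp)
    also have "\<dots> \<le> K / sqrt (x\<^sup>2 + 1)"
    proof -
      have "1\<^sup>2 \<le> (y + 1)\<^sup>2" using y by (intro power_mono) auto
      then have "sqrt (x\<^sup>2 + 1) \<le> sqrt (x\<^sup>2 + (y + 1)\<^sup>2)" by simp
      then show ?thesis unfolding cmod_Complex_plus_i using K
        using y by (intro divide_left_mono mult_pos_pos) (auto intro: add_nonneg_pos)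
    qed
    finally show ?thesis by (simp add: k_def y_def)
  qed
  note L = H2_boundary_limit[OF f, where V = "\<lambda>n x. v (Complex x (1 / real (Suc n)))" and Vl = "boundary_value v" and k = k,
      OF hmv H2_boundary_measurable[OF H2v] _ H2_boundary_LIMSEQ[OF H2v] vk kint]
  show "integrable lborel (\<lambda>x. boundary_value f x * boundary_value v x)"
    by (rule L(2)) auto
  have "(\<lambda>n. I (1 / real (Suc n))) \<longlonglongrightarrow> (LINT x|lborel. boundary_value f x * boundary_value v x)"
    unfolding I_def by (rule L(1)) auto
  then have "(\<lambda>n. 0) \<longlonglongrightarrow> (LINT x|lborel. boundary_value f x * boundary_value v x)"
    by (simp add: I0)
  then show "(LINT x|lborel. boundary_value f x * boundary_value v x) = 0"
    using LIMSEQ_unique[OF tendsto_const] by metis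
qed

lemma conj_kernel_decay:
  assumes w: "0 < Im w" and z: "z \<in> upper_half_plane"
  shows "cmod (1 / (z - cnj w)) \<le> (1 + cmod (cnj w + \<i>) / Im w) / cmod (z + \<i>)"
proof -
  have zz: "0 < Im z" using z by (simp add: upper_half_plane_def)
  have "Im w \<le> Im (z - cnj w)" using zz by simp
  also have "\<dots> \<le> cmod (z - cnj w)" using abs_Im_le_cmod[of "z - cnj w"] by linarith
  finally have ge: "Im w \<le> cmod (z - cnj w)" .
  have ne: "0 < cmod (z + \<i>)" using zz by (auto simp: complex_eq_iff)
  have "cmod (z + \<i>) = cmod ((z - cnj w) + (cnj w + \<i>))" by simp
  also have "\<dots> \<le> cmod (z - cnj w) + cmod (cnj w + \<i>)" by (rule norm_triangle_ineq)
  also have "cmod (cnj w + \<i>) \<le> cmod (z - cnj w) * (cmod (cnj w + \<i>) / Im w)"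
    using mult_right_mono[OF ge, of "cmod (cnj w + \<i>) / Im w"] w by simp
  finally have "cmod (z + \<i>) \<le> cmod (z - cnj w) * (1 + cmod (cnj w + \<i>) / Im w)" by (simp add: distrib_left)
  then have "1 * cmod (z + \<i>) \<le> (1 + cmod (cnj w + \<i>) / Im w) * cmod (z - cnj w)" by (simp add: mult.commute)
  moreover have "0 < cmod (z - cnj w)" using ge w by linarith
  ultimately show ?thesis using ne by (simp add: norm_divide frac_le_eq pos_divide_le_eq pos_le_divide_eq)
qed

lemma conj_kernel_boundary_value:
  assumes w: "0 < Im w"
  shows "boundary_value (\<lambda>z. 1 / (z - cnj w)) x = 1 / (of_real x - cnj w)"
proof (rule boundary_value_eqI)
  have "((\<lambda>y. 1 / (Complex x y - cnj w)) \<longlongrightarrow> 1 / (Complex x 0 - cnj w)) (at_right 0)"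
    unfolding Complex_eq using w by (intro tendsto_intros) (auto simp: complex_eq_iff)
  then show "((\<lambda>y. 1 / (Complex x y - cnj w)) \<longlongrightarrow> 1 / (of_real x - cnj w)) (at_right 0)"
    by (simp add: Complex_eq)
qed

lemma conj_kernel_holomorphic:
  "0 < Im w \<Longrightarrow> (\<lambda>z. 1 / (z - cnj w)) holomorphic_on upper_half_plane"
  by (intro holomorphic_intros) (auto simp: upper_half_plane_def complex_eq_iff)

text \<open>
  The Cauchy kernel at \<open>w\<close> is the one at \<open>cnj w\<close>, which contributes nothing by \<open>H2_boundary_product_zero\<close>,
  plus a multiple of the Poisson kernel.
\<close>
lemma H2_boundary_kernel_integrable:
  assumes f: "H2 f" and w: "0 < Im w"
  shows "integrable lborel (\<lambda>x. boundary_value f x * (1 / (of_real x - w)))"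
    and "2 * of_real pi * \<i> * f w = (LINT x|lborel. boundary_value f x * (1 / (of_real x - w)))"
proof -
  define a b where "a = Re w" and "b = Im w"
  have w_eq: "w = Complex a b" and b: "0 < b" using w by (simp_all add: a_def b_def)
  have Z: "(LINT x|lborel. boundary_value f x * (1 / (of_real x - cnj w))) = 0"
      "integrable lborel (\<lambda>x. boundary_value f x * (1 / (of_real x - cnj w)))"
    unfolding conj_kernel_boundary_value[OF w, symmetric]
    by (rule H2_boundary_product_zero[OF f conj_kernel_holomorphic[OF w]], erule conj_kernel_decay[OF w])+
  note P = H2_poisson_boundary[OF f b, of a]
  have ker: "1 / (of_real x - w) = 1 / (of_real x - cnj w) + 2 * of_real pi * \<i> * of_real (poisson b (x - a))" for x
  proof -
    have ne: "of_real x - w \<noteq> 0" "of_real x - cnj w \<noteq> 0" using w by (auto simp: complex_eq_iff)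
    have "(of_real x - w) * (of_real x - cnj w) = of_real ((x - a)\<^sup>2 + b\<^sup>2)"
      by (simp add: w_eq complex_eq_iff power2_eq_square)
    then have "2 * of_real pi * \<i> * of_real (poisson b (x - a)) = 2 * \<i> * of_real b / ((of_real x - w) * (of_real x - cnj w))"
      by (simp add: poisson_def)
    moreover have "w - cnj w = 2 * \<i> * of_real b" by (simp add: w_eq complex_eq_iff)
    moreover have "1 / (of_real x - w) - 1 / (of_real x - cnj w) = (w - cnj w) / ((of_real x - w) * (of_real x - cnj w))"
      using ne by (simp add: diff_frac_eq)
    ultimately have "1 / (of_real x - w) - 1 / (of_real x - cnj w) = 2 * of_real pi * \<i> * of_real (poisson b (x - a))"
      by (simp only:)
    then show ?thesis by (simp only: diff_eq_eq add.commute)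
  qed
  have eq: "boundary_value f x * (1 / (of_real x - w)) =
      boundary_value f x * (1 / (of_real x - cnj w)) + 2 * of_real pi * \<i> * (boundary_value f x * of_real (poisson b (x - a)))" for x
    unfolding ker by (simp add: algebra_simps)
  show "integrable lborel (\<lambda>x. boundary_value f x * (1 / (of_real x - w)))"
    unfolding eq by (intro Bochner_Integration.integrable_add integrable_mult_right Z(2) P(2))
  show "2 * of_real pi * \<i> * f w = (LINT x|lborel. boundary_value f x * (1 / (of_real x - w)))"
    unfolding eq by (subst Bochner_Integration.integral_add) (use Z P w_eq in auto)
qed

section \<open>Inner functions with atomic Clark measure\<close>

lemma holomorphic_on_suminf:
  fixes f :: "nat \<Rightarrow> complex \<Rightarrow> complex"
  assumes hol: "\<And>n. f n holomorphic_on upper_half_plane"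
    and bound: "\<And>\<eta>. \<eta> > 0 \<Longrightarrow> \<exists>M. summable M \<and> (\<forall>n z. \<eta> \<le> Im z \<longrightarrow> cmod (f n z) \<le> M n)"
  shows "(\<lambda>z. \<Sum>n. f n z) holomorphic_on upper_half_plane"
proof (rule holomorphic_uniform_sequence[OF open_upper_half_plane])
  show "(\<lambda>z. \<Sum>i<n. f i z) holomorphic_on upper_half_plane" for n
    by (intro holomorphic_intros hol)
  fix x assume x: "x \<in> upper_half_plane"
  define d where "d = Im x / 2"
  have d: "d > 0" using x by (simp add: d_def upper_half_plane_def)
  have sub: "d \<le> Im z" if "z \<in> cball x d" for z
    using that abs_Im_le_cmod[of "x - z"] by (simp add: dist_norm d_def)
  obtain M where "summable M" "\<forall>n z. d \<le> Im z \<longrightarrow> cmod (f n z) \<le> M n" using bound[OF d] by blast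
  then have "uniform_limit (cball x d) (\<lambda>n z. \<Sum>i<n. f i z) (\<lambda>z. \<Sum>i. f i z) sequentially"
    using sub by (intro Weierstrass_m_test) auto
  moreover have "cball x d \<subseteq> upper_half_plane" using sub d by (force simp: upper_half_plane_def)
  ultimately show "\<exists>d>0. cball x d \<subseteq> upper_half_plane \<and>
      uniform_limit (cball x d) (\<lambda>n z. \<Sum>i<n. f i z) (\<lambda>z. \<Sum>i. f i z) sequentially"
    using d by blast
qed

text \<open>
  Away from its limit \<open>0\<close> a null sequence is discrete.
\<close>
lemma null_sequence_gap:
  fixes t :: "nat \<Rightarrow> real"
  assumes t: "t \<longlonglongrightarrow> 0" and x: "x \<noteq> 0"
  obtains d where "d > 0" "\<And>k. t k \<noteq> x \<Longrightarrow> d \<le> \<bar>t k - x\<bar>"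
proof -
  have "eventually (\<lambda>k. \<bar>t k\<bar> < \<bar>x\<bar> / 2) sequentially"
    using order_tendstoD(2)[OF tendsto_rabs_zero[OF t], of "\<bar>x\<bar> / 2"] x by simp
  then obtain N where N: "\<And>k. k \<ge> N \<Longrightarrow> \<bar>t k\<bar> < \<bar>x\<bar> / 2" by (auto simp: eventually_sequentially)
  define A where "A = insert (\<bar>x\<bar> / 2) ((\<lambda>k. \<bar>t k - x\<bar>) ` {k. k < N \<and> t k \<noteq> x})"
  have fin: "finite A" "A \<noteq> {}" by (auto simp: A_def)
  have "Min A > 0" using fin x by (auto simp: Min_gr_iff A_def)
  moreover have "Min A \<le> \<bar>t k - x\<bar>" if "t k \<noteq> x" for k
  proof (cases "k < N")
    case True
    then show ?thesis using fin that by (intro Min_le) (auto simp: A_def)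
  next
    case False
    have "Min A \<le> \<bar>x\<bar> / 2" using fin by (intro Min_le) (auto simp: A_def)
    also have "\<dots> \<le> \<bar>t k - x\<bar>" using N[of k] False by linarith
    finally show ?thesis .
  qed
  ultimately show ?thesis by (rule that)
qed

text \<open>
  A tool for estimating quotients with the denominator \<open>s - z\<close>: a bound near \<open>s\<close> and the natural decay away
  from \<open>s\<close> together amount to decay like \<open>1 / (z + \<i>)\<close>, with a constant that does not depend on the function.
\<close>
lemma decay_near_far:
  fixes s :: complex
  assumes \<delta>: "\<delta> > 0" and A: "A \<ge> 0"
  obtains K where "\<And>z w. z \<in> upper_half_plane \<Longrightarrow> (cmod (s - z) < \<delta> \<Longrightarrow> cmod w \<le> A) \<Longrightarrow>
     (\<delta> \<le> cmod (s - z) \<Longrightarrow> cmod w \<le> A / cmod (s - z)) \<Longrightarrow> cmod w \<le> K / cmod (z + \<i>)"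
proof -
  define K where "K = A * (\<delta> + cmod (s + \<i>)) + A * (1 + cmod (s + \<i>) / \<delta>)"
  have K: "A * (\<delta> + cmod (s + \<i>)) \<le> K" "A * (1 + cmod (s + \<i>) / \<delta>) \<le> K"
    using A \<delta> by (simp_all add: K_def)
  have "cmod w \<le> K / cmod (z + \<i>)"
    if z: "z \<in> upper_half_plane" and near: "cmod (s - z) < \<delta> \<Longrightarrow> cmod w \<le> A"
      and far: "\<delta> \<le> cmod (s - z) \<Longrightarrow> cmod w \<le> A / cmod (s - z)" for z w
  proof -
    have pos: "cmod (z + \<i>) > 0" using z by (auto simp: complex_eq_iff upper_half_plane_def)
    have tri: "cmod (z + \<i>) \<le> cmod (s - z) + cmod (s + \<i>)"
      using norm_triangle_ineq[of "z - s" "s + \<i>"] by (simp add: norm_minus_commute)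
    show ?thesis
    proof (cases "cmod (s - z) < \<delta>")
      case True
      have "cmod w * cmod (z + \<i>) \<le> A * (\<delta> + cmod (s + \<i>))"
        using near[OF True] tri True A by (intro mult_mono) auto
      then show ?thesis using K(1) pos by (simp add: pos_le_divide_eq)
    next
      case False
      define r where "r = cmod (s - z)"
      have r: "r \<ge> \<delta>" "r > 0" using False \<delta> by (auto simp: r_def)
      have "cmod (s + \<i>) = cmod (s + \<i>) / \<delta> * \<delta>" using \<delta> by simp
      also have "\<dots> \<le> cmod (s + \<i>) / \<delta> * r" using r \<delta> by (intro mult_left_mono) auto
      finally have "cmod (z + \<i>) \<le> r * (1 + cmod (s + \<i>) / \<delta>)" using tri by (simp add: r_def algebra_simps)
      then have "cmod w * cmod (z + \<i>) \<le> A / r * (r * (1 + cmod (s + \<i>) / \<delta>))"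
        using far False A r by (intro mult_mono) (auto simp: r_def)
      also have "\<dots> = A * (1 + cmod (s + \<i>) / \<delta>)" using r by simp
      finally show ?thesis using K(2) pos by (simp add: pos_le_divide_eq)
    qed
  qed
  then show ?thesis using that by blast
qed

text \<open>
  Split \<open>h\<close> as \<open>1 / (z + \<i>)\<close> times \<open>(z + \<i>) * h z\<close>; both factors decay like \<open>1 / (z + \<i>)\<close>.
\<close>
lemma decay_square_integral_zero:
  assumes hol: "h holomorphic_on upper_half_plane"
    and h: "\<And>z. z \<in> upper_half_plane \<Longrightarrow> cmod (h z) \<le> K / (cmod (z + \<i>))\<^sup>2"
  shows "integrable lborel (boundary_value h)" and "(LINT x|lborel. boundary_value h x) = 0"
proof -
  define f where "f = (\<lambda>z. 1 / (z + \<i>))"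
  define v where "v = (\<lambda>z. (z + \<i>) * h z)"
  have nz: "z + \<i> \<noteq> 0" if "z \<in> upper_half_plane" for z
    using that by (auto simp: complex_eq_iff upper_half_plane_def)
  have f: "f holomorphic_on upper_half_plane" unfolding f_def using nz by (intro holomorphic_intros) auto
  have H2f: "H2 f" by (rule H2_decay[OF f, of 1]) (simp add: f_def norm_divide)
  have v: "v holomorphic_on upper_half_plane" unfolding v_def by (intro holomorphic_intros hol)
  have vb: "cmod (v z) \<le> K / cmod (z + \<i>)" if z: "z \<in> upper_half_plane" for z
  proof -
    have "cmod (v z) \<le> cmod (z + \<i>) * (K / (cmod (z + \<i>))\<^sup>2)"
      unfolding v_def norm_mult by (intro mult_left_mono h z) auto
    then show ?thesis using nz[OF z] by (simp add: power2_eq_square)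
  qed
  have H2v: "H2 v" by (rule H2_decay[OF v vb])
  have meas: "boundary_value h \<in> borel_measurable borel"
    by (intro boundary_value_measurable holomorphic_on_imp_continuous_on hol)
  note mfv = H2_boundary_measurable[OF H2f] H2_boundary_measurable[OF H2v]
  have "AE x in lborel. boundary_value f x * boundary_value v x = boundary_value h x"
    using H2_boundary_tendsto[OF H2f] H2_boundary_tendsto[OF H2v]
  proof eventually_elim
    fix x assume "((\<lambda>y. f (Complex x y)) \<longlongrightarrow> boundary_value f x) (at_right 0)"
      "((\<lambda>y. v (Complex x y)) \<longlongrightarrow> boundary_value v x) (at_right 0)"
    then have "((\<lambda>y. f (Complex x y) * v (Complex x y)) \<longlongrightarrow> boundary_value f x * boundary_value v x) (at_right 0)"
      by (rule tendsto_mult)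
    moreover have "eventually (\<lambda>y. f (Complex x y) * v (Complex x y) = h (Complex x y)) (at_right 0)"
      using eventually_at_right_less[of 0]
    proof eventually_elim
      fix y :: real assume "0 < y"
      then show "f (Complex x y) * v (Complex x y) = h (Complex x y)" using nz[of "Complex x y"] by (simp add: f_def v_def)
    qed
    ultimately have "((\<lambda>y. h (Complex x y)) \<longlongrightarrow> boundary_value f x * boundary_value v x) (at_right 0)"
      by (rule Lim_transform_eventually)
    then show "boundary_value f x * boundary_value v x = boundary_value h x"
      using boundary_value_eqI by metis
  qed
  note ae = this
  show "integrable lborel (boundary_value h)"
    by (rule integrable_cong_AE_imp[OF H2_boundary_product_zero(2)[OF H2f v vb]]) (use meas ae in auto)
  show "(LINT x|lborel. boundary_value h x) = 0"
    using H2_boundary_product_zero(1)[OF H2f v vb] integral_cong_AE[OF _ _ ae] meas mfv by simp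
qed

text \<open>
  Positions and masses of the atoms. Summability of the square roots makes all series below converge
  absolutely; convergence of the positions to \<open>0\<close> makes every point other than \<open>0\<close> isolated from the remaining
  atoms, so that boundary values exist off a countable set.
\<close>
locale atoms =
  fixes t m :: "nat \<Rightarrow> real"
  assumes m_pos: "\<And>n. m n > 0" and summable_sqrt_m: "summable (\<lambda>n. sqrt (m n))"
    and t_nonzero: "\<And>n. t n \<noteq> 0" and t_lim: "t \<longlonglongrightarrow> 0" and t_inj: "inj t"
begin

definition u :: "complex \<Rightarrow> complex" where
  "u z = (\<Sum>n. of_real (m n) / (of_real (t n) - z))"

definition U :: "complex \<Rightarrow> complex" where
  "U z = (u z - \<i>) / (u z + \<i>)"

text \<open>
  As \<open>1 - U z = 2 * \<i> / (u z + \<i>)\<close>, this is a constant multiple of the reproducing kernel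
  \<open>(1 - U z) / (t n - z)\<close> of the model space at the boundary point \<open>t n\<close>, where \<open>U\<close> has the value \<open>1\<close>.
\<close>
definition E :: "nat \<Rightarrow> complex \<Rightarrow> complex" where
  "E n z = 1 / ((u z + \<i>) * (of_real (t n) - z))"

text \<open>
  The points at which the series for \<open>u\<close> converges for the trivial reason that its denominators are
  bounded away from zero.
\<close>
definition separated :: "complex \<Rightarrow> bool" where
  "separated z \<longleftrightarrow> (\<exists>d>0. \<forall>n. d \<le> cmod (of_real (t n) - z))"

lemma summable_m: "summable m"
proof -
  obtain B where B: "\<And>n. \<bar>sqrt (m n)\<bar> \<le> B"
    using summable_imp_Bseq[OF summable_sqrt_m] by (auto simp: Bseq_def)
  show ?thesis
  proof (rule summable_comparison_test')
    show "summable (\<lambda>n. B * sqrt (m n))" by (intro summable_mult summable_sqrt_m)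
    show "norm (m n) \<le> B * sqrt (m n)" for n
    proof -
      have "norm (m n) = sqrt (m n) * sqrt (m n)" using m_pos[of n] by simp
      also have "\<dots> \<le> B * sqrt (m n)" using B[of n] m_pos[of n] by (intro mult_right_mono) auto
      finally show ?thesis .
    qed
  qed
qed

lemma cmod_ge_Im: "Im z \<le> cmod (of_real r - z)"
  using abs_Im_le_cmod[of "of_real r - z"] by simp

lemma upper_separated: "z \<in> upper_half_plane \<Longrightarrow> separated z"
  unfolding separated_def upper_half_plane_def using cmod_ge_Im by blast

lemma real_separated:
  assumes "x \<notin> insert 0 (range t)"
  shows "separated (of_real x)"
proof -
  obtain d where "d > 0" "\<And>k. t k \<noteq> x \<Longrightarrow> d \<le> \<bar>t k - x\<bar>"
    using null_sequence_gap[OF t_lim, of x] assms by blast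
  moreover have "t k \<noteq> x" for k using assms by auto
  moreover have "cmod (of_real (t k) - of_real x) = \<bar>t k - x\<bar>" for k
    by (simp flip: of_real_diff)
  ultimately show ?thesis unfolding separated_def by auto
qed

lemma AE_separated: "AE x in lborel. separated (of_real x)"
proof -
  have "countable (insert 0 (range t))" by auto
  then have "AE x in lborel. x \<notin> insert 0 (range t)"
    by (intro AE_not_in countable_imp_null_set_lborel)
  then show ?thesis by eventually_elim (rule real_separated)
qed

lemma separated_nonzero: "separated z \<Longrightarrow> of_real (t n) - z \<noteq> 0"
  unfolding separated_def by (metis norm_zero not_le)

lemma u_summable:
  assumes "separated z"
  shows "summable (\<lambda>n. cmod (of_real (m n) / (of_real (t n) - z)))"
proof -
  obtain d where d: "d > 0" "\<And>n. d \<le> cmod (of_real (t n) - z)" using assms by (auto simp: separated_def)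
  show ?thesis
  proof (rule summable_comparison_test')
    show "summable (\<lambda>n. m n / d)" by (intro summable_divide summable_m)
    show "norm (cmod (of_real (m n) / (of_real (t n) - z))) \<le> m n / d" for n
      using d(1) d(2)[of n] m_pos[of n] by (auto simp: norm_divide intro!: divide_left_mono mult_pos_pos)
  qed
qed

lemma u_sums: "separated z \<Longrightarrow> (\<lambda>n. of_real (m n) / (of_real (t n) - z)) sums u z"
  unfolding u_def by (rule summable_sums[OF summable_norm_cancel[OF u_summable]])

text \<open>
  The resolvent identity. It gives continuity of \<open>u\<close> up to the line as well as the kernel expansion.
\<close>
lemma u_diff_sums:
  assumes "separated z" "separated w"
  shows "(\<lambda>n. of_real (m n) * (z - w) / ((of_real (t n) - z) * (of_real (t n) - w))) sums (u z - u w)"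
proof -
  have "of_real (m n) * (z - w) / ((of_real (t n) - z) * (of_real (t n) - w)) =
      of_real (m n) / (of_real (t n) - z) - of_real (m n) / (of_real (t n) - w)" for n
    using separated_nonzero[OF assms(1), of n] separated_nonzero[OF assms(2), of n]
    by (simp add: divide_simps) (simp add: algebra_simps)
  then show ?thesis using sums_diff[OF u_sums[OF assms(1)] u_sums[OF assms(2)]] by simp
qed

lemma u_real:
  assumes "separated (of_real x)"
  obtains r where "u (of_real x) = of_real r"
proof -
  have "(\<lambda>n. of_real (m n) / (of_real (t n) - of_real x)) = (\<lambda>n. complex_of_real (m n / (t n - x)))" by simp
  then have "(\<lambda>n. complex_of_real (m n / (t n - x))) sums u (of_real x)" using u_sums[OF assms] by simp
  then have "(\<lambda>n. Im (complex_of_real (m n / (t n - x)))) sums Im (u (of_real x))" by (rule sums_Im)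
  then have "(\<lambda>n. 0) sums Im (u (of_real x))" by simp
  then have "Im (u (of_real x)) = 0" using sums_unique2 sums_zero by blast
  then show ?thesis using that[of "Re (u (of_real x))"] by (simp add: complex_eq_iff)
qed

lemma Im_u_pos:
  assumes z: "z \<in> upper_half_plane" shows "0 < Im (u z)"
proof -
  have s: "(\<lambda>n. Im (of_real (m n) / (of_real (t n) - z))) sums Im (u z)"
    by (intro sums_Im u_sums upper_separated z)
  have "Im (of_real (m n) / (of_real (t n) - z)) > 0" for n
    using z m_pos[of n] cmod_ge_Im[of z "t n"]
    by (auto simp: Im_divide upper_half_plane_def power2_eq_square intro!: divide_pos_pos add_nonneg_pos mult_pos_pos)
  from suminf_pos[OF sums_summable[OF s] this] show ?thesis using s by (simp add: sums_iff)
qed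

lemma norm_u_plus_i:
  assumes "z \<in> upper_half_plane \<or> (\<exists>x. z = of_real x \<and> separated z)"
  shows "1 \<le> cmod (u z + \<i>)"
proof -
  have "0 \<le> Im (u z)"
  proof (cases "z \<in> upper_half_plane")
    case True then show ?thesis using Im_u_pos by fastforce
  next
    case False
    then obtain x where x: "z = of_real x" "separated (of_real x)" using assms by auto
    obtain r where "u (of_real x) = of_real r" by (rule u_real[OF x(2)])
    then show ?thesis using x by simp
  qed
  then have "1 \<le> Im (u z + \<i>)" by simp
  also have "\<dots> \<le> cmod (u z + \<i>)" using abs_Im_le_cmod[of "u z + \<i>"] by linarith
  finally show ?thesis .
qed

lemma u_plus_i_nonzero: "z \<in> upper_half_plane \<Longrightarrow> u z + \<i> \<noteq> 0"
  using norm_u_plus_i[of z] by auto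

lemma u_holomorphic: "u holomorphic_on upper_half_plane"
  unfolding u_def
proof (rule holomorphic_on_suminf)
  show "(\<lambda>z. of_real (m n) / (of_real (t n) - z)) holomorphic_on upper_half_plane" for n
    by (intro holomorphic_intros separated_nonzero upper_separated)
  fix \<eta> :: real assume \<eta>: "\<eta> > 0"
  have "cmod (of_real (m n) / (of_real (t n) - z)) \<le> m n / \<eta>" if "\<eta> \<le> Im z" for n z
    using \<eta> m_pos[of n] order_trans[OF that cmod_ge_Im[of z "t n"]]
    by (auto simp: norm_divide intro!: divide_left_mono mult_pos_pos)
  then show "\<exists>M. summable M \<and> (\<forall>n z. \<eta> \<le> Im z \<longrightarrow> cmod (of_real (m n) / (of_real (t n) - z)) \<le> M n)"
    by (intro exI[of _ "\<lambda>n. m n / \<eta>"]) (auto intro: summable_divide summable_m)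
qed

lemma U_holomorphic: "U holomorphic_on upper_half_plane"
  unfolding U_def by (intro holomorphic_intros u_holomorphic u_plus_i_nonzero)

lemma E_holomorphic: "E n holomorphic_on upper_half_plane"
  unfolding E_def using separated_nonzero[OF upper_separated, of _ n] u_plus_i_nonzero
  by (intro holomorphic_intros u_holomorphic) auto

lemma U_bounded:
  assumes z: "z \<in> upper_half_plane" shows "cmod (U z) \<le> 1"
proof -
  have "(cmod (u z - \<i>))\<^sup>2 \<le> (cmod (u z + \<i>))\<^sup>2"
    using Im_u_pos[OF z] unfolding cmod_power2 by (simp add: power2_eq_square algebra_simps)
  then have "cmod (u z - \<i>) \<le> cmod (u z + \<i>)" by (rule power2_le_imp_le) simp
  then show ?thesis using norm_u_plus_i[of z] z by (simp add: U_def norm_divide divide_le_eq)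
qed

lemma vertical_to_real: "((\<lambda>y. Complex x y) \<longlongrightarrow> of_real x) (at_right 0)"
proof -
  have "((\<lambda>y. of_real x + \<i> * of_real y) \<longlongrightarrow> of_real x + \<i> * of_real 0) (at_right 0)"
    by (intro tendsto_intros)
  then show ?thesis by (simp add: Complex_eq)
qed

lemma u_vertical_limit:
  assumes x: "separated (of_real x)"
  shows "((\<lambda>y. u (Complex x y)) \<longlongrightarrow> u (of_real x)) (at_right 0)"
proof -
  obtain d where d: "d > 0" "\<And>n. d \<le> cmod (of_real (t n) - of_real x)" using x by (auto simp: separated_def)
  have bound: "cmod (u (Complex x y) - u (of_real x)) \<le> y * (\<Sum>n. m n / d\<^sup>2)" if y: "0 < y" for y
  proof -
    have sep: "separated (Complex x y)" by (rule upper_separated) (use y in simp)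
    have s: "(\<lambda>n. of_real (m n) * (Complex x y - of_real x) / ((of_real (t n) - Complex x y) * (of_real (t n) - of_real x)))
        sums (u (Complex x y) - u (of_real x))" by (rule u_diff_sums[OF sep x])
    have le: "cmod (of_real (m n) * (Complex x y - of_real x) / ((of_real (t n) - Complex x y) * (of_real (t n) - of_real x)))
        \<le> y * (m n / d\<^sup>2)" for n
    proof -
      have "cmod (of_real (t n) - of_real x) = \<bar>t n - x\<bar>" by (simp flip: of_real_diff)
      then have "d \<le> \<bar>Re (of_real (t n) - Complex x y)\<bar>" using d(2)[of n] by simp
      also have "\<dots> \<le> cmod (of_real (t n) - Complex x y)" by (rule abs_Re_le_cmod)
      finally have "d * d \<le> cmod (of_real (t n) - Complex x y) * cmod (of_real (t n) - of_real x)"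
        using d by (intro mult_mono) auto
      moreover have "cmod (Complex x y - of_real x) = y" using y by (simp add: cmod_def)
      moreover have "d * d > 0" using d by simp
      ultimately show ?thesis using m_pos[of n] y
        by (simp add: norm_divide norm_mult power2_eq_square) 
           (auto simp: mult.commute intro!: divide_left_mono mult_pos_pos)
    qed
    have sm: "summable (\<lambda>n. y * (m n / d\<^sup>2))" by (intro summable_mult summable_divide summable_m)
    have "cmod (u (Complex x y) - u (of_real x)) \<le> (\<Sum>n. y * (m n / d\<^sup>2))"
      unfolding sums_unique[OF s] by (rule norm_suminf_le[OF le sm])
    also have "\<dots> = y * (\<Sum>n. m n / d\<^sup>2)" by (intro suminf_mult summable_divide summable_m)
    finally show ?thesis .
  qed
  have "((\<lambda>y. u (Complex x y) - u (of_real x)) \<longlongrightarrow> 0) (at_right 0)"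
  proof (rule Lim_null_comparison)
    show "eventually (\<lambda>y. norm (u (Complex x y) - u (of_real x)) \<le> y * (\<Sum>n. m n / d\<^sup>2)) (at_right 0)"
      using eventually_at_right_less[of 0] by eventually_elim (rule bound)
    have "((\<lambda>y::real. y * (\<Sum>n. m n / d\<^sup>2)) \<longlongrightarrow> 0 * (\<Sum>n. m n / d\<^sup>2)) (at_right 0)" by (intro tendsto_intros)
    then show "((\<lambda>y::real. y * (\<Sum>n. m n / d\<^sup>2)) \<longlongrightarrow> 0) (at_right 0)" by simp
  qed
  then show ?thesis by (rule LIM_zero_cancel)
qed

lemma u_real_plus_i_nonzero: "separated (of_real x) \<Longrightarrow> u (of_real x) + \<i> \<noteq> 0"
  using norm_u_plus_i[of "of_real x"] by auto

lemma U_vertical_limit: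
  assumes x: "separated (of_real x)"
  shows "((\<lambda>y. U (Complex x y)) \<longlongrightarrow> U (of_real x)) (at_right 0)"
  unfolding U_def by (intro tendsto_intros u_vertical_limit x u_real_plus_i_nonzero)

lemma E_vertical_limit:
  assumes x: "separated (of_real x)"
  shows "((\<lambda>y. E n (Complex x y)) \<longlongrightarrow> E n (of_real x)) (at_right 0)"
  unfolding E_def using u_real_plus_i_nonzero[OF x] separated_nonzero[OF x, of n]
  by (intro tendsto_intros u_vertical_limit x vertical_to_real) auto

lemma U_norm_real:
  assumes x: "separated (of_real x)"
  shows "cmod (U (of_real x)) = 1"
proof -
  obtain r where r: "u (of_real x) = of_real r" by (rule u_real[OF x])
  have "cmod (of_real r - \<i>) = cmod (of_real r + \<i>)" by (simp add: cmod_def)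
  moreover have "of_real r + \<i> \<noteq> 0" by (simp add: complex_eq_iff)
  ultimately show ?thesis by (simp add: U_def r norm_divide)
qed

lemma U_inner: "inner_function U"
  unfolding inner_function_def
proof (intro conjI U_holomorphic)
  show "bounded (U ` upper_half_plane)"
    using U_bounded by (auto simp: bounded_iff)
  show "AE x in lborel. \<exists>l. ((\<lambda>y. U (Complex x y)) \<longlongrightarrow> l) (at_right 0) \<and> cmod l = 1"
    using AE_separated by eventually_elim (use U_vertical_limit U_norm_real in blast)
qed

text \<open>
  If \<open>U\<close> were constant then so would be \<open>u\<close>; but \<open>u\<close> tends to zero along the imaginary axis while its
  imaginary part is positive.
\<close>
lemma U_nonconstant: "\<not> U constant_on upper_half_plane"
proof
  assume "U constant_on upper_half_plane"
  then obtain c where c: "\<And>z. z \<in> upper_half_plane \<Longrightarrow> U z = c" by (auto simp: constant_on_def)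
  have u_eq: "u z * (1 - U z) = \<i> * (1 + U z)" if "z \<in> upper_half_plane" for z
    using u_plus_i_nonzero[OF that] by (simp add: U_def field_simps)
  have ii: "\<i> \<in> upper_half_plane" by (simp add: upper_half_plane_def)
  have c1: "c \<noteq> 1" using u_eq[OF ii] c[OF ii] by auto
  have const: "u z = u \<i>" if "z \<in> upper_half_plane" for z
    using u_eq[OF that] u_eq[OF ii] c[OF that] c[OF ii] c1 by (metis eq_iff_diff_eq_0 mult_cancel_right)
  have "Im (u \<i>) \<le> (\<Sum>n. m n) / y" if y: "y > 0" for y
  proof -
    have iy: "Complex 0 y \<in> upper_half_plane" using y by simp
    have "cmod (u (Complex 0 y)) \<le> (\<Sum>n. m n / y)"
      unfolding sums_unique[OF u_sums[OF upper_separated[OF iy]]]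
    proof (rule norm_suminf_le)
      show "cmod (of_real (m n) / (of_real (t n) - Complex 0 y)) \<le> m n / y" for n
        using y m_pos[of n] cmod_ge_Im[of "Complex 0 y" "t n"]
        by (auto simp: norm_divide intro!: divide_left_mono mult_pos_pos)
    qed (intro summable_divide summable_m)
    also have "\<dots> = (\<Sum>n. m n) / y" by (rule suminf_divide[OF summable_m])
    finally have "cmod (u \<i>) \<le> (\<Sum>n. m n) / y" by (simp only: const[OF iy])
    then show ?thesis using abs_Im_le_cmod[of "u \<i>"] by linarith
  qed
  then have "eventually (\<lambda>y. Im (u \<i>) \<le> (\<Sum>n. m n) * inverse y) at_top"
    by (intro eventually_mono[OF eventually_gt_at_top[of 0]]) (simp add: divide_inverse)
  moreover have "((\<lambda>y. (\<Sum>n. m n) * inverse y) \<longlongrightarrow> (\<Sum>n. m n) * 0) at_top"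
    by (intro tendsto_intros tendsto_inverse_0_at_top filterlim_ident)
  ultimately have "Im (u \<i>) \<le> (\<Sum>n. m n) * 0"
    by (intro tendsto_lowerbound) auto
  then show False using Im_u_pos[OF ii] by simp
qed

text \<open>
  Since \<open>t n\<close> is isolated among the atoms, \<open>u\<close> is a simple pole at \<open>t n\<close> plus a bounded function nearby.
\<close>
lemma rest_bounded:
  obtains d \<rho> where "d > 0" "\<rho> \<ge> 0"
    "\<And>z. z \<in> upper_half_plane \<Longrightarrow> cmod (of_real (t n) - z) < d \<Longrightarrow> cmod (u z - of_real (m n) / (of_real (t n) - z)) \<le> \<rho>"
proof -
  obtain d where d: "d > 0" "\<And>k. t k \<noteq> t n \<Longrightarrow> d \<le> \<bar>t k - t n\<bar>"
    using null_sequence_gap[OF t_lim t_nonzero] by blast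
  define \<rho> where "\<rho> = (\<Sum>k. m k / (d / 2))"
  have sm: "summable (\<lambda>k. m k / (d / 2))" by (intro summable_divide summable_m)
  have "\<rho> \<ge> 0" unfolding \<rho>_def using m_pos d by (intro suminf_nonneg sm) (simp add: less_imp_le)
  moreover have "cmod (u z - of_real (m n) / (of_real (t n) - z)) \<le> \<rho>"
    if z: "z \<in> upper_half_plane" and near: "cmod (of_real (t n) - z) < d / 2" for z
  proof -
    define a where "a = (\<lambda>k. of_real (m k) / (of_real (t k) - z) :: complex)"
    have s: "a sums u z" unfolding a_def by (rule u_sums[OF upper_separated[OF z]])
    have s': "(\<lambda>k. a k - (if k = n then a k else 0)) sums (u z - a n)"
      by (intro sums_diff s sums_single)
    have "cmod (u z - a n) \<le> (\<Sum>k. m k / (d / 2))"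
      unfolding sums_unique[OF s']
    proof (rule norm_suminf_le[OF _ sm])
      fix k
      show "cmod (a k - (if k = n then a k else 0)) \<le> m k / (d / 2)"
      proof (cases "k = n")
        case True then show ?thesis using m_pos[of k] d by simp
      next
        case False
        then have "t k \<noteq> t n" using t_inj by (auto dest: injD)
        then have "d \<le> cmod (of_real (t k) - of_real (t n))" using d(2)[of k] by (simp flip: of_real_diff)
        also have "\<dots> \<le> cmod (of_real (t k) - z) + cmod (of_real (t n) - z)"
          using norm_triangle_ineq4[of "of_real (t k) - z" "of_real (t n) - z"] by simp
        finally have "d / 2 \<le> cmod (of_real (t k) - z)" using near by linarith
        then show ?thesis using False d m_pos[of k]
          unfolding a_def by (simp only: if_False diff_zero norm_divide norm_of_real abs_of_pos)
            (intro divide_left_mono mult_pos_pos, auto)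
      qed
    qed
    then show ?thesis by (simp add: a_def \<rho>_def)
  qed
  ultimately show ?thesis using that[of "d / 2" \<rho>] d(1) by auto
qed

text \<open>
  The pole of \<open>u\<close> at \<open>t n\<close> cancels the zero of \<open>t n - z\<close>: near \<open>t n\<close> the denominator of \<open>E n z\<close>
  differs from \<open>m n\<close> by at most half of \<open>m n\<close>.
\<close>
lemma E_near_atom:
  obtains \<delta> A \<rho> where "\<delta> > 0" "A \<ge> 0" "\<rho> \<ge> 0"
    "\<And>z. z \<in> upper_half_plane \<Longrightarrow> cmod (of_real (t n) - z) < \<delta> \<Longrightarrow> cmod (u z - of_real (m n) / (of_real (t n) - z)) \<le> \<rho>"
    "\<And>z. z \<in> upper_half_plane \<Longrightarrow> cmod (of_real (t n) - z) < \<delta> \<Longrightarrow> cmod (E n z) \<le> A"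
proof -
  obtain d \<rho> where d: "d > 0" "\<rho> \<ge> 0"
    and rest: "\<And>z. z \<in> upper_half_plane \<Longrightarrow> cmod (of_real (t n) - z) < d \<Longrightarrow> cmod (u z - of_real (m n) / (of_real (t n) - z)) \<le> \<rho>"
    using rest_bounded by blast
  define \<delta> where "\<delta> = min d (m n / (2 * (\<rho> + 1)))"
  have \<delta>: "\<delta> > 0" "\<delta> \<le> d" using d m_pos[of n] by (auto simp: \<delta>_def)
  have "cmod (E n z) \<le> 2 / m n" if z: "z \<in> upper_half_plane" and near: "cmod (of_real (t n) - z) < \<delta>" for z
  proof -
    define r where "r = of_real (t n) - z"
    have r: "r \<noteq> 0" "cmod r \<le> m n / (2 * (\<rho> + 1))" using separated_nonzero[OF upper_separated[OF z]] near by (auto simp: r_def \<delta>_def)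
    have R: "cmod (u z - of_real (m n) / r) \<le> \<rho>" using rest[OF z] near \<delta> by (simp add: r_def)
    have "m n = cmod ((u z + \<i>) * r - (u z - of_real (m n) / r) * r - \<i> * r)"
      using r m_pos[of n] by (simp add: algebra_simps)
    also have "\<dots> \<le> cmod ((u z + \<i>) * r) + cmod ((u z - of_real (m n) / r) * r) + cmod (\<i> * r)"
      by (intro order_trans[OF norm_triangle_ineq4] add_right_mono norm_triangle_ineq4)
    also have "\<dots> \<le> cmod ((u z + \<i>) * r) + (\<rho> + 1) * cmod r"
      using mult_right_mono[OF R, of "cmod r"] by (simp add: norm_mult distrib_right)
    also have "(\<rho> + 1) * cmod r \<le> (\<rho> + 1) * (m n / (2 * (\<rho> + 1)))"
      using r d by (intro mult_left_mono) auto
    also have "\<dots> = m n / 2"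
    proof -
      have "\<rho> + 1 \<noteq> 0" using d by simp
      then show ?thesis by (simp add: divide_simps)
    qed
    finally have "m n / 2 \<le> cmod ((u z + \<i>) * r)" by simp
    then have "1 / cmod ((u z + \<i>) * r) \<le> 1 / (m n / 2)"
      using m_pos[of n] by (intro divide_left_mono mult_pos_pos) (auto intro: less_le_trans)
    then show ?thesis by (simp add: E_def r_def norm_divide)
  qed
  then show ?thesis using that[of \<delta> "2 / m n" \<rho>] \<delta> rest d m_pos[of n] by (auto simp: less_imp_le)
qed

lemma E_norm_le:
  assumes z: "z \<in> upper_half_plane \<or> (\<exists>x. z = of_real x \<and> separated z)"
  shows "cmod (E n z) \<le> 1 / cmod (of_real (t n) - z)"
proof -
  have sep: "separated z" using z upper_separated by auto
  have "cmod (of_real (t n) - z) > 0" using separated_nonzero[OF sep] by simp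
  moreover have "1 * cmod (of_real (t n) - z) \<le> cmod (u z + \<i>) * cmod (of_real (t n) - z)"
    by (intro mult_right_mono norm_u_plus_i z) auto
  ultimately show ?thesis unfolding E_def norm_divide norm_mult norm_one by (intro divide_left_mono mult_pos_pos) auto
qed

lemma E_decay:
  obtains K where "\<And>z. z \<in> upper_half_plane \<Longrightarrow> cmod (E n z) \<le> K / cmod (z + \<i>)"
proof -
  obtain \<delta> A \<rho> where d: "\<delta> > 0" "A \<ge> 0" "\<rho> \<ge> 0"
    and "\<And>z. z \<in> upper_half_plane \<Longrightarrow> cmod (of_real (t n) - z) < \<delta> \<Longrightarrow> cmod (u z - of_real (m n) / (of_real (t n) - z)) \<le> \<rho>"
    and near: "\<And>z. z \<in> upper_half_plane \<Longrightarrow> cmod (of_real (t n) - z) < \<delta> \<Longrightarrow> cmod (E n z) \<le> A"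
    by (rule E_near_atom[of n]) blast
  have mA: "0 \<le> max A 1" by simp
  obtain K where K: "\<And>z w. z \<in> upper_half_plane \<Longrightarrow> (cmod (of_real (t n) - z) < \<delta> \<Longrightarrow> cmod w \<le> max A 1) \<Longrightarrow>
     (\<delta> \<le> cmod (of_real (t n) - z) \<Longrightarrow> cmod w \<le> max A 1 / cmod (of_real (t n) - z)) \<Longrightarrow> cmod w \<le> K / cmod (z + \<i>)"
    using decay_near_far[OF d(1) mA] by metis
  have "cmod (E n z) \<le> K / cmod (z + \<i>)" if z: "z \<in> upper_half_plane" for z
  proof (rule K[OF z])
    have "cmod (E n z) \<le> 1 / cmod (of_real (t n) - z)" by (rule E_norm_le) (use z in simp)
    also have "\<dots> \<le> max A 1 / cmod (of_real (t n) - z)" by (intro divide_right_mono) auto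
    finally show "cmod (E n z) \<le> max A 1 / cmod (of_real (t n) - z)" .
  qed (use near[OF z] in auto)
  then show ?thesis by (rule that)
qed

lemma E_H2: "H2 (E n)"
proof -
  obtain K where "\<And>z. z \<in> upper_half_plane \<Longrightarrow> cmod (E n z) \<le> K / cmod (z + \<i>)" using E_decay by blast
  then show ?thesis by (rule H2_decay[OF E_holomorphic])
qed

lemma E_boundary_value: "separated (of_real x) \<Longrightarrow> boundary_value (E n) x = E n (of_real x)"
  by (rule boundary_value_eqI[OF E_vertical_limit])

end

section \<open>Orthogonality of the boundary kernels\<close>

lemma cnj_measurable: "f \<in> borel_measurable borel \<Longrightarrow> (\<lambda>x. cnj (f x)) \<in> borel_measurable borel"
  by (rule borel_measurable_continuous_on[of cnj]) (auto intro: continuous_intros)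

lemma H2_inner:
  assumes f: "H2 f" and g: "H2 g"
  shows "integrable lborel (\<lambda>x. boundary_value f x * cnj (boundary_value g x))"
    and "cmod (LINT x|lborel. boundary_value f x * cnj (boundary_value g x)) \<le> sqrt (boundary_sqnorm f * boundary_sqnorm g)"
    and "(LINT x|lborel. cmod (boundary_value f x * cnj (boundary_value g x))) \<le> sqrt (boundary_sqnorm f * boundary_sqnorm g)"
proof -
  note L = L2_product[OF H2_boundary_measurable[OF f] cnj_measurable[OF H2_boundary_measurable[OF g]], of "boundary_sqnorm f" "boundary_sqnorm g"]
  note sq = H2_boundary_square_integrable(2)[OF f] H2_boundary_square_integrable(2)[OF g]
  show int: "integrable lborel (\<lambda>x. boundary_value f x * cnj (boundary_value g x))"
    by (rule L(2)) (simp_all add: sq boundary_sqnorm_nonneg)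
  show "cmod (LINT x|lborel. boundary_value f x * cnj (boundary_value g x)) \<le> sqrt (boundary_sqnorm f * boundary_sqnorm g)"
    by (rule L(3)) (simp_all add: sq boundary_sqnorm_nonneg)
  have "ennreal (LINT x|lborel. cmod (boundary_value f x * cnj (boundary_value g x))) =
      (\<integral>\<^sup>+x. ennreal (cmod (boundary_value f x * cnj (boundary_value g x))) \<partial>lborel)"
    by (rule nn_integral_eq_integral[symmetric]) (use int in auto)
  also have "\<dots> \<le> ennreal (sqrt (boundary_sqnorm f * boundary_sqnorm g))"
    by (rule L(1)) (simp_all add: sq boundary_sqnorm_nonneg)
  finally show "(LINT x|lborel. cmod (boundary_value f x * cnj (boundary_value g x))) \<le> sqrt (boundary_sqnorm f * boundary_sqnorm g)"
    by (subst (asm) ennreal_le_iff) (simp_all add: boundary_sqnorm_nonneg)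
qed

lemma integral_poisson:
  assumes "y > 0"
  shows "integrable lborel (\<lambda>x. poisson y (x - a))" "(LINT x|lborel. poisson y (x - a)) = 1"
proof -
  have "(\<integral>\<^sup>+x. ennreal (poisson y (x - a)) \<partial>lborel) = ennreal 1"
    using nn_integral_poisson[OF assms] by simp
  then have "integrable lborel (\<lambda>x. poisson y (x - a)) \<and> (LINT x|lborel. poisson y (x - a)) = 1"
    by (subst (asm) nn_integral_eq_integrable) (use assms in \<open>auto simp: poisson_nonneg\<close>)
  then show "integrable lborel (\<lambda>x. poisson y (x - a))" "(LINT x|lborel. poisson y (x - a)) = 1" by auto
qed

text \<open>
  On the line \<open>u\<close> is real, and this identity turns products \<open>E n * cnj (E k)\<close> into imaginary parts of boundary
  values of holomorphic functions.
\<close>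
lemma inverse_real_plus_i:
  fixes r :: real
  defines "p \<equiv> 1 / (of_real r + \<i>) :: complex"
  shows "p * cnj p = of_real (- Im p)"
proof -
  have "of_real r + \<i> \<noteq> 0" "of_real r - \<i> \<noteq> 0" by (auto simp: complex_eq_iff)
  then have "p - cnj p = - 2 * \<i> * (p * cnj p)" by (simp add: p_def divide_simps)
  moreover have "p - cnj p = 2 * \<i> * of_real (Im p)" by (simp add: complex_eq_iff)
  ultimately have "\<i> * (p * cnj p) = \<i> * of_real (- Im p)" by (simp add: algebra_simps)
  then show ?thesis by (simp only: mult_cancel_left) simp
qed

context atoms
begin

text \<open>
  On the line the product equals minus the imaginary part of \<open>Q = 1 / ((u + \<i>) * (t n - z) * (t k - z))\<close>.
  Since \<open>1 / (u + \<i>)\<close> vanishes at both points, \<open>Q\<close> is holomorphic without singularities at the line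
  and decays quadratically, so its integral is zero.
\<close>
lemma E_boundary_inner_distinct:
  assumes nk: "n \<noteq> k"
  shows "(LINT x|lborel. boundary_value (E n) x * cnj (boundary_value (E k) x)) = 0"
proof -
  define Q where "Q = (\<lambda>z. E n z / (of_real (t k) - z))"
  have tnk: "t k \<noteq> t n" using nk t_inj by (auto dest: injD)
  have hol: "Q holomorphic_on upper_half_plane"
    unfolding Q_def using separated_nonzero[OF upper_separated, of _ k]
    by (intro holomorphic_intros E_holomorphic) auto
  obtain K1 where K1: "\<And>z. z \<in> upper_half_plane \<Longrightarrow> cmod (E n z) \<le> K1 / cmod (z + \<i>)" by (rule E_decay[of n]) blast
  obtain K2 where K2: "\<And>z. z \<in> upper_half_plane \<Longrightarrow> cmod (E k z) \<le> K2 / cmod (z + \<i>)" by (rule E_decay[of k]) blast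
  define c where "c = cmod (of_real (t k) - of_real (t n) :: complex)"
  have c: "c > 0" using tnk by (simp add: c_def)
  define K where "K = (K1 + (cmod (of_real (t k) + \<i>)) * (K1 + K2) / c)"
  have bound: "cmod (Q z) \<le> K / (cmod (z + \<i>))\<^sup>2" if z: "z \<in> upper_half_plane" for z
  proof -
    define s where "s = cmod (z + \<i>)"
    define r where "r = of_real (t k) - z"
    have s: "s > 0" using z by (auto simp: s_def complex_eq_iff upper_half_plane_def)
    have nz: "of_real (t n) - z \<noteq> 0" "r \<noteq> 0" unfolding r_def by (intro separated_nonzero upper_separated z)+
    have uz: "u z + \<i> \<noteq> 0" by (rule u_plus_i_nonzero[OF z])
    have "Q z * (of_real (t k) - of_real (t n)) = E n z - E k z"
      using nz uz unfolding Q_def E_def r_def by (simp add: divide_simps)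
    then have "cmod (Q z) * c = cmod (E n z - E k z)" by (metis c_def norm_mult)
    also have "\<dots> \<le> K1 / s + K2 / s"
      using K1[OF z] K2[OF z] norm_triangle_ineq4[of "E n z" "E k z"] by (simp add: s_def)
    finally have 1: "cmod (Q z) \<le> (K1 + K2) / c / s" using c s by (simp add: field_simps)
    have 2: "cmod (Q z) * cmod r \<le> K1 / s"
      using K1[OF z] nz by (simp add: Q_def r_def norm_divide s_def)
    have "s \<le> cmod r + cmod (of_real (t k) + \<i>)"
      using norm_triangle_ineq[of "z - of_real (t k)" "of_real (t k) + \<i>"] by (simp add: s_def r_def norm_minus_commute)
    then have "cmod (Q z) * s \<le> cmod (Q z) * cmod r + cmod (Q z) * cmod (of_real (t k) + \<i>)"
      by (simp flip: distrib_left add: mult_left_mono)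
    also have "\<dots> \<le> K1 / s + (K1 + K2) / c / s * cmod (of_real (t k) + \<i>)"
      by (intro add_mono 2 mult_right_mono 1) auto
    also have "\<dots> = K / s" using s c by (simp add: K_def field_simps)
    finally show ?thesis using s by (simp add: s_def power2_eq_square pos_le_divide_eq field_simps)
  qed
  note Z = decay_square_integral_zero[OF hol bound]
  have ae: "AE x in lborel. boundary_value (E n) x * cnj (boundary_value (E k) x) = of_real (- Im (boundary_value Q x))"
    using AE_separated
  proof eventually_elim
    fix x assume x: "separated (of_real x)"
    obtain r where r: "u (of_real x) = of_real r" by (rule u_real[OF x])
    define p where "p = 1 / (of_real r + \<i>)"
    have "((\<lambda>y. Q (Complex x y)) \<longlongrightarrow> Q (of_real x)) (at_right 0)"
      unfolding Q_def using separated_nonzero[OF x, of k]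
      by (intro tendsto_intros E_vertical_limit[OF x] vertical_to_real) auto
    then have "boundary_value Q x = E n (of_real x) / (of_real (t k) - of_real x)"
      by (subst boundary_value_eqI) (auto simp: Q_def)
    also have "\<dots> = p / of_real ((t n - x) * (t k - x))"
      by (simp add: E_def r p_def mult.assoc)
    finally have Qx: "boundary_value Q x = p / of_real ((t n - x) * (t k - x))" .
    have "E n (of_real x) * cnj (E k (of_real x)) = p * cnj p / of_real ((t n - x) * (t k - x))"
      by (simp add: E_def r p_def mult_ac)
    also have "p * cnj p = of_real (- Im p)" unfolding p_def by (rule inverse_real_plus_i)
    also have "of_real (- Im p) / of_real ((t n - x) * (t k - x)) = complex_of_real (- Im (boundary_value Q x))"
      unfolding Qx by (simp add: Im_divide_of_real)
    finally show "boundary_value (E n) x * cnj (boundary_value (E k) x) = of_real (- Im (boundary_value Q x))"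
      by (simp add: E_boundary_value[OF x])
  qed
  have meas: "boundary_value Q \<in> borel_measurable borel"
    by (intro boundary_value_measurable holomorphic_on_imp_continuous_on hol)
  have "(LINT x|lborel. boundary_value (E n) x * cnj (boundary_value (E k) x)) = (LINT x|lborel. complex_of_real (- Im (boundary_value Q x)))"
    by (rule integral_cong_AE[OF _ _ ae])
       (use meas H2_boundary_measurable[OF E_H2] cnj_measurable[OF H2_boundary_measurable[OF E_H2]] in auto)
  also have "\<dots> = of_real (- (LINT x|lborel. Im (boundary_value Q x)))"
    by (simp only: integral_complex_of_real Bochner_Integration.integral_minus)
  also have "\<dots> = 0" using Z by (simp add: integral_Im)
  finally show ?thesis .
qed

text \<open>
  For a single atom the kernel is \<open>E0 = 1 / (m n + \<i> * (t n - z))\<close>, and \<open>\<bar>E0\<bar>\<^sup>2\<close> on the line is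
  \<open>pi / m n\<close> times a Poisson kernel. The difference of \<open>\<bar>E n\<bar>\<^sup>2\<close> and \<open>\<bar>E0\<bar>\<^sup>2\<close> is minus the imaginary part of \<open>D\<close>,
  in which the double pole at \<open>t n\<close> has cancelled, so \<open>D\<close> has integral zero.
\<close>
lemma E_boundary_norm: "(LINT x|lborel. boundary_value (E n) x * cnj (boundary_value (E n) x)) = of_real (pi / m n)"
proof -
  define w where "w = Complex (t n) (m n)"
  define E0 where "E0 = (\<lambda>z. 1 / (of_real (m n) + \<i> * (of_real (t n) - z)))"
  have E0_eq: "E0 z = \<i> * (1 / (z - cnj w))" for z
  proof -
    have "of_real (m n) + \<i> * (of_real (t n) - z) = - \<i> * (z - cnj w)"
      by (simp add: w_def complex_eq_iff)
    then show ?thesis by (simp add: E0_def divide_inverse)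
  qed
  have Imw: "0 < Im w" using m_pos by (simp add: w_def)
  define R where "R = (\<lambda>z. u z - of_real (m n) / (of_real (t n) - z))"
  define D where "D = (\<lambda>z. - R z * E n z * E0 z)"
  have holE0: "E0 holomorphic_on upper_half_plane"
    unfolding E0_eq by (intro holomorphic_intros conj_kernel_holomorphic[OF Imw])
  have holR: "R holomorphic_on upper_half_plane"
    unfolding R_def by (intro holomorphic_intros u_holomorphic separated_nonzero upper_separated)
  have hol: "D holomorphic_on upper_half_plane"
    unfolding D_def by (intro holomorphic_intros E_holomorphic holE0 holR)
  define K0 where "K0 = 1 + cmod (cnj w + \<i>) / Im w"
  have K0: "cmod (E0 z) \<le> K0 / cmod (z + \<i>)" if "z \<in> upper_half_plane" for z
    using conj_kernel_decay[OF Imw that] by (simp add: E0_eq norm_mult norm_divide K0_def)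
  have K0_pos: "K0 > 0" using Imw by (simp add: K0_def add_pos_nonneg)
  obtain \<delta> A \<rho> where d: "\<delta> > 0" "A \<ge> 0" "\<rho> \<ge> 0"
    and near1: "\<And>z. z \<in> upper_half_plane \<Longrightarrow> cmod (of_real (t n) - z) < \<delta> \<Longrightarrow> cmod (u z - of_real (m n) / (of_real (t n) - z)) \<le> \<rho>"
    and near2: "\<And>z. z \<in> upper_half_plane \<Longrightarrow> cmod (of_real (t n) - z) < \<delta> \<Longrightarrow> cmod (E n z) \<le> A"
    by (rule E_near_atom[of n]) blast
  define A' where "A' = \<rho> * A + 2 + m n / \<delta>"
  have A': "A' \<ge> 0" "\<rho> * A \<le> A'" "2 + m n / \<delta> \<le> A'" using d m_pos[of n] by (simp_all add: A'_def)
  obtain K where K: "\<And>z w. z \<in> upper_half_plane \<Longrightarrow> (cmod (of_real (t n) - z) < \<delta> \<Longrightarrow> cmod w \<le> A') \<Longrightarrow>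
     (\<delta> \<le> cmod (of_real (t n) - z) \<Longrightarrow> cmod w \<le> A' / cmod (of_real (t n) - z)) \<Longrightarrow> cmod w \<le> K / cmod (z + \<i>)"
    using decay_near_far[OF d(1) A'(1)] by metis
  have RE: "cmod (R z * E n z) \<le> K / cmod (z + \<i>)" if z: "z \<in> upper_half_plane" for z
  proof (rule K[OF z])
    assume "cmod (of_real (t n) - z) < \<delta>"
    then have "cmod (R z * E n z) \<le> \<rho> * A"
      unfolding norm_mult R_def using near1[OF z] near2[OF z] d by (intro mult_mono) auto
    then show "cmod (R z * E n z) \<le> A'" using A' by linarith
  next
    define r where "r = cmod (of_real (t n) - z)"
    assume "\<delta> \<le> cmod (of_real (t n) - z)"
    then have r: "\<delta> \<le> r" "r > 0" using d by (auto simp: r_def)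
    have En: "cmod (E n z) \<le> 1 / r" unfolding r_def by (rule E_norm_le) (use z in simp)
    have ui: "1 \<le> cmod (u z + \<i>)" by (rule norm_u_plus_i) (use z in simp)
    have "cmod (u z) \<le> 2 * cmod (u z + \<i>)"
      using norm_triangle_ineq4[of "u z + \<i>" \<i>] ui by simp
    then have "cmod (u z) * cmod (E n z) \<le> 2 * cmod (u z + \<i>) * cmod (E n z)" by (intro mult_right_mono) auto
    also have "\<dots> = 2 / r" using ui by (auto simp: E_def norm_divide norm_mult r_def)
    finally have 1: "cmod (u z * E n z) \<le> 2 / r" by (simp add: norm_mult)
    have "cmod (of_real (m n) / (of_real (t n) - z) * E n z) \<le> m n / \<delta> * (1 / r)"
      unfolding norm_mult using En r d m_pos[of n]
      by (intro mult_mono) (auto simp: norm_divide r_def[symmetric] intro!: divide_left_mono mult_pos_pos)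
    then have "cmod (R z * E n z) \<le> 2 / r + m n / \<delta> * (1 / r)"
      using 1 norm_triangle_ineq4[of "u z * E n z" "of_real (m n) / (of_real (t n) - z) * E n z"]
      by (simp add: R_def left_diff_distrib)
    also have "\<dots> = (2 + m n / \<delta>) / r" by (simp add: add_divide_distrib)
    also have "\<dots> \<le> A' / r" using A'(3) r by (intro divide_right_mono) auto
    finally show "cmod (R z * E n z) \<le> A' / cmod (of_real (t n) - z)" by (simp add: r_def)
  qed
  have bound: "cmod (D z) \<le> K * K0 / (cmod (z + \<i>))\<^sup>2" if z: "z \<in> upper_half_plane" for z
  proof -
    have "cmod (D z) = cmod (R z * E n z) * cmod (E0 z)" by (simp add: D_def norm_mult)
    also have "\<dots> \<le> (K / cmod (z + \<i>)) * (K0 / cmod (z + \<i>))"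
      using RE[OF z] K0[OF z] by (intro mult_mono) (auto intro: order_trans[OF norm_ge_zero])
    finally show ?thesis by (simp add: power2_eq_square)
  qed
  note Z = decay_square_integral_zero[OF hol bound]
  have ae: "AE x in lborel. boundary_value (E n) x * cnj (boundary_value (E n) x) =
      of_real (pi / m n * poisson (m n) (x - t n) - Im (boundary_value D x))"
    using AE_separated
  proof eventually_elim
    fix x assume x: "separated (of_real x)"
    obtain r where r: "u (of_real x) = of_real r" by (rule u_real[OF x])
    define p where "p = 1 / (of_real r + \<i>)"
    define a where "a = t n - x"
    have a: "a \<noteq> 0" using separated_nonzero[OF x, of n] by (auto simp: a_def simp flip: of_real_diff)
    have ri: "of_real r + \<i> \<noteq> 0" by (simp add: complex_eq_iff)
    have ma: "of_real (m n) + \<i> * of_real a \<noteq> 0" using m_pos[of n] by (auto simp: complex_eq_iff)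
    have xw: "of_real x - cnj w \<noteq> 0" using Imw by (auto simp: complex_eq_iff)
    have "((\<lambda>y. D (Complex x y)) \<longlongrightarrow> D (of_real x)) (at_right 0)"
      unfolding D_def R_def E0_eq using separated_nonzero[OF x, of n] xw
      by (intro tendsto_intros E_vertical_limit[OF x] u_vertical_limit[OF x] vertical_to_real) auto
    then have "boundary_value D x = D (of_real x)" by (rule boundary_value_eqI)
    also have "\<dots> = - (of_real r - of_real (m n) / of_real a) * (1 / ((of_real r + \<i>) * of_real a)) * (1 / (of_real (m n) + \<i> * of_real a))"
      by (simp add: D_def R_def E_def E0_def r a_def)
    also have "\<dots> = p / of_real (a * a) - 1 / (of_real (m n) + \<i> * of_real a) / of_real a"
      unfolding p_def using a ri ma by (simp add: divide_simps) (simp add: algebra_simps)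
    finally have Dx: "boundary_value D x = p / of_real (a * a) - 1 / (of_real (m n) + \<i> * of_real a) / of_real a" .
    have "Im (1 / (of_real (m n) + \<i> * of_real a) / of_real a) = - (1 / ((m n)\<^sup>2 + a\<^sup>2))"
    proof -
      have "Im (1 / (of_real (m n) + \<i> * of_real a)) = - a / ((m n)\<^sup>2 + a\<^sup>2)" by (simp add: Im_divide)
      then show ?thesis using a unfolding Im_divide_of_real by simp
    qed
    moreover have "pi / m n * poisson (m n) (x - t n) = 1 / ((m n)\<^sup>2 + a\<^sup>2)"
      using m_pos[of n] by (simp add: poisson_def a_def power2_commute add.commute)
    ultimately have "pi / m n * poisson (m n) (x - t n) - Im (boundary_value D x) = - Im p / (a * a)"
      unfolding Dx by (simp add: Im_divide_of_real)
    moreover have "E n (of_real x) * cnj (E n (of_real x)) = p * cnj p / of_real (a * a)"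
      by (simp add: E_def r p_def a_def mult_ac)
    moreover have "p * cnj p = of_real (- Im p)" unfolding p_def by (rule inverse_real_plus_i)
    ultimately show "boundary_value (E n) x * cnj (boundary_value (E n) x) = of_real (pi / m n * poisson (m n) (x - t n) - Im (boundary_value D x))"
      by (simp add: E_boundary_value[OF x])
  qed
  have meas[measurable]: "boundary_value D \<in> borel_measurable borel"
    by (intro boundary_value_measurable holomorphic_on_imp_continuous_on hol)
  have "(LINT x|lborel. boundary_value (E n) x * cnj (boundary_value (E n) x)) =
     (LINT x|lborel. complex_of_real (pi / m n * poisson (m n) (x - t n) - Im (boundary_value D x)))"
    by (rule integral_cong_AE[OF _ _ ae])
       (use H2_boundary_measurable[OF E_H2] cnj_measurable[OF H2_boundary_measurable[OF E_H2]] in auto)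
  also have "\<dots> = of_real (LINT x|lborel. pi / m n * poisson (m n) (x - t n) - Im (boundary_value D x))"
    by (rule integral_complex_of_real)
  also have "(LINT x|lborel. pi / m n * poisson (m n) (x - t n) - Im (boundary_value D x)) =
      (LINT x|lborel. pi / m n * poisson (m n) (x - t n)) - (LINT x|lborel. Im (boundary_value D x))"
    using integral_poisson(1)[OF m_pos] Z(1) by (intro Bochner_Integration.integral_diff integrable_mult_right integrable_Im) auto
  also have "\<dots> = pi / m n"
    using integral_poisson(2)[OF m_pos] Z by (simp add: integral_Im)
  finally show ?thesis .
qed

lemma E_boundary_inner:
  "(LINT x|lborel. boundary_value (E n) x * cnj (boundary_value (E k) x)) = (if n = k then of_real (pi / m n) else 0)"
  using E_boundary_norm E_boundary_inner_distinct by auto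

lemma boundary_sqnorm_eq_inner: "of_real (boundary_sqnorm f) = (LINT x|lborel. boundary_value f x * cnj (boundary_value f x))"
  unfolding boundary_sqnorm_def integral_complex_of_real[symmetric] complex_norm_square ..

lemma boundary_sqnorm_E: "boundary_sqnorm (E n) = pi / m n"
proof -
  have "complex_of_real (boundary_sqnorm (E n)) = of_real (pi / m n)"
    unfolding boundary_sqnorm_eq_inner by (rule E_boundary_norm)
  then show ?thesis by (simp only: of_real_eq_iff)
qed

definition kernel_sum :: "(nat \<Rightarrow> complex) \<Rightarrow> nat set \<Rightarrow> complex \<Rightarrow> complex" where
  "kernel_sum c S z = (\<Sum>n\<in>S. c n * of_real (m n) * E n z)"

lemma kernel_sum_H2: "finite S \<Longrightarrow> H2 (kernel_sum c S)"
  unfolding kernel_sum_def by (intro H2_sum H2_cmult E_H2)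

lemma kernel_sum_boundary_value:
  assumes x: "separated (of_real x)"
  shows "boundary_value (kernel_sum c S) x = (\<Sum>n\<in>S. c n * of_real (m n) * boundary_value (E n) x)"
  unfolding E_boundary_value[OF x]
  by (rule boundary_value_eqI) (unfold kernel_sum_def, intro tendsto_intros E_vertical_limit[OF x])

lemma inner_kernel_sum:
  assumes f: "H2 f" and S: "finite S"
  shows "(LINT x|lborel. boundary_value f x * cnj (boundary_value (kernel_sum c S) x)) =
    (\<Sum>n\<in>S. cnj (c n) * of_real (m n) * (LINT x|lborel. boundary_value f x * cnj (boundary_value (E n) x)))"
proof -
  note int = H2_inner(1)[OF f E_H2]
  have "(LINT x|lborel. boundary_value f x * cnj (boundary_value (kernel_sum c S) x)) =
    (LINT x|lborel. (\<Sum>n\<in>S. cnj (c n) * of_real (m n) * (boundary_value f x * cnj (boundary_value (E n) x))))"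
  proof (rule integral_cong_AE)
    show "AE x in lborel. boundary_value f x * cnj (boundary_value (kernel_sum c S) x) =
       (\<Sum>n\<in>S. cnj (c n) * of_real (m n) * (boundary_value f x * cnj (boundary_value (E n) x)))"
      using AE_separated
      by eventually_elim (simp add: kernel_sum_boundary_value sum_distrib_left mult_ac)
  qed (use borel_measurable_integrable[OF H2_inner(1)[OF f kernel_sum_H2[OF S]]] borel_measurable_integrable[OF int] in auto)
  also have "\<dots> = (\<Sum>n\<in>S. cnj (c n) * of_real (m n) * (LINT x|lborel. boundary_value f x * cnj (boundary_value (E n) x)))"
    using int by (subst Bochner_Integration.integral_sum) auto
  finally show ?thesis .
qed

lemma boundary_sqnorm_kernel_sum:
  assumes S: "finite S"
  shows "boundary_sqnorm (kernel_sum c S) = pi * (\<Sum>n\<in>S. m n * (cmod (c n))\<^sup>2)"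
proof -
  have comb_E: "(LINT x|lborel. boundary_value (kernel_sum c S) x * cnj (boundary_value (E n) x)) = of_real pi * c n"
    if n: "n \<in> S" for n
  proof -
    have "(LINT x|lborel. boundary_value (kernel_sum c S) x * cnj (boundary_value (E n) x)) =
      cnj (LINT x|lborel. boundary_value (E n) x * cnj (boundary_value (kernel_sum c S) x))"
      by (subst Bochner_Integration.integral_cnj[symmetric]) (simp add: mult.commute)
    also have "\<dots> = (\<Sum>k\<in>S. c k * of_real (m k) * cnj (if n = k then of_real (pi / m n) else 0))"
      unfolding inner_kernel_sum[OF E_H2 S] E_boundary_inner by simp
    also have "\<dots> = (\<Sum>k\<in>S. if n = k then c k * of_real (m k) * of_real (pi / m n) else 0)"
      by (intro sum.cong) auto
    also have "\<dots> = of_real pi * c n" using n S m_pos[of n] by (simp add: sum.delta)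
    finally show ?thesis .
  qed
  have "complex_of_real (boundary_sqnorm (kernel_sum c S)) = (\<Sum>n\<in>S. cnj (c n) * of_real (m n) * (of_real pi * c n))"
    unfolding boundary_sqnorm_eq_inner inner_kernel_sum[OF kernel_sum_H2[OF S] S] by (intro sum.cong) (simp_all add: comb_E)
  also have "\<dots> = (\<Sum>n\<in>S. of_real (pi * (m n * (cmod (c n))\<^sup>2)))"
    by (intro sum.cong refl) (simp only: of_real_mult complex_norm_square mult_ac)
  also have "\<dots> = of_real (pi * (\<Sum>n\<in>S. m n * (cmod (c n))\<^sup>2))"
    by (simp add: sum_distrib_left)
  finally show ?thesis by (simp only: of_real_eq_iff)
qed

end

section \<open>The model space as a space of kernel series\<close>

text \<open>
  Test functions are given by formulas; to be members of \<^const>\<open>hardy2\<close> they have to be cut off.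
\<close>
lemma hardy2_extend_zero:
  assumes "H2 f"
  shows "(\<lambda>z. if z \<in> upper_half_plane then f z else 0) \<in> hardy2"
  unfolding hardy2_iff by (auto intro: H2_cong[OF assms])

lemma model_space_iff:
  "f \<in> model_space V \<longleftrightarrow> f \<in> hardy2 \<and> (\<forall>g\<in>hardy2. hardy2_inner f (\<lambda>z. V z * g z) = 0)"
  by (auto simp: model_space_def hardy2_orthogonal_def mult_image_def)

context atoms
begin

lemma U_mult_H2: "H2 g \<Longrightarrow> H2 (\<lambda>z. U z * g z)"
  by (rule H2_bounded_mult[OF _ U_holomorphic U_bounded])

lemma U_mult_boundary:
  assumes g: "H2 g"
  shows "AE x in lborel. boundary_value (\<lambda>z. U z * g z) x = U (of_real x) * boundary_value g x"
  using AE_separated H2_boundary_tendsto[OF g]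
  by eventually_elim (intro boundary_value_eqI tendsto_mult U_vertical_limit)

text \<open>
  Testing orthogonality on the Cauchy kernel at \<open>w\<close> and combining it with Cauchy's formula gives
  \<open>2 * pi * \<i> * f w\<close> as the integral of \<open>f x * (1 - U w * cnj (U x)) / (x - w)\<close> over the line. By the resolvent identity
  for \<open>u\<close> this kernel is \<open>2 * \<i>\<close> times the sum of \<open>m n * E n w * cnj (E n x)\<close>. Sum and integral may be
  exchanged because \<open>m n\<close> times the norm of \<open>E n\<close> is a multiple of \<open>sqrt (m n)\<close>.
\<close>
lemma U_reproducing:
  assumes f: "f \<in> model_space U" and w: "w \<in> upper_half_plane"
  shows "(\<lambda>n. of_real (m n) * E n w * (LINT x|lborel. boundary_value f x * cnj (boundary_value (E n) x)))
    sums (of_real pi * f w)"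
proof -
  have f2: "H2 f" and orth: "\<And>g. g \<in> hardy2 \<Longrightarrow> hardy2_inner f (\<lambda>z. U z * g z) = 0"
    using f by (auto simp: model_space_iff hardy2_iff)
  have Imw: "0 < Im w" using w by (simp add: upper_half_plane_def)
  note [measurable] = H2_boundary_measurable[OF f2]
  define k where "k = (\<lambda>z. 1 / (z - cnj w))"
  have k2: "H2 k"
    unfolding k_def by (rule H2_decay[OF conj_kernel_holomorphic[OF Imw]]) (erule conj_kernel_decay[OF Imw])
  have kb: "boundary_value k x = 1 / (of_real x - cnj w)" for x
    unfolding k_def by (rule conj_kernel_boundary_value[OF Imw])
  define g where "g = (\<lambda>z. if z \<in> upper_half_plane then k z else 0)"
  have g: "g \<in> hardy2" unfolding g_def by (rule hardy2_extend_zero[OF k2])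
  have g2: "H2 g" using g by (simp add: hardy2_iff)
  have gb: "boundary_value g x = 1 / (of_real x - cnj w)" for x
  proof -
    have "((\<lambda>y. k (Complex x y)) \<longlongrightarrow> 1 / (Complex x 0 - cnj w)) (at_right 0)"
      unfolding k_def Complex_eq using Imw by (intro tendsto_intros) (auto simp: complex_eq_iff)
    moreover have "eventually (\<lambda>y. k (Complex x y) = g (Complex x y)) (at_right 0)"
      using eventually_at_right_less[of 0] by eventually_elim (simp add: g_def)
    ultimately have "((\<lambda>y. g (Complex x y)) \<longlongrightarrow> 1 / (Complex x 0 - cnj w)) (at_right 0)"
      by (rule Lim_transform_eventually)
    from boundary_value_eqI[OF this] show ?thesis by (simp add: Complex_eq)
  qed
  define h where "h = (\<lambda>z. U z * g z)"
  have h2: "H2 h" unfolding h_def by (rule U_mult_H2[OF g2])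
  have hb: "AE x in lborel. boundary_value h x = U (of_real x) * (1 / (of_real x - cnj w))"
    using U_mult_boundary[OF g2] by (simp add: h_def gb)
  have zero: "(LINT x|lborel. boundary_value f x * cnj (boundary_value h x)) = 0"
    using orth[OF g] by (simp add: hardy2_inner_def h_def)
  note int_h = H2_inner(1)[OF f2 h2]
  note int_k = H2_boundary_kernel_integrable[OF f2 Imw]
  define \<phi> where "\<phi> = (\<lambda>n x. of_real (m n) * E n w * (boundary_value f x * cnj (boundary_value (E n) x)))"
  have int_\<phi>: "integrable lborel (\<phi> n)" for n
    unfolding \<phi>_def by (intro integrable_mult_right H2_inner(1) f2 E_H2)
  have key: "AE x in lborel. summable (\<lambda>n. norm (\<phi> n x)) \<and>
     boundary_value f x * (1 / (of_real x - w)) - U w * (boundary_value f x * cnj (boundary_value h x)) = 2 * \<i> * (\<Sum>n. \<phi> n x)"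
    using AE_separated hb
  proof eventually_elim
    fix x assume x: "separated (of_real x)" and hbx: "boundary_value h x = U (of_real x) * (1 / (of_real x - cnj w))"
    obtain r where r: "u (of_real x) = of_real r" by (rule u_real[OF x])
    have ws: "separated w" by (rule upper_separated[OF w])
    have nz: "of_real r - \<i> \<noteq> 0" "of_real r + \<i> \<noteq> 0" "u w + \<i> \<noteq> 0" "of_real x - w \<noteq> 0"
      using Imw u_plus_i_nonzero[OF w] by (auto simp: complex_eq_iff)
    \<comment> \<open>The factor left over when the \<open>n\<close>-th term of the resolvent identity is split off from \<open>\<phi> n x\<close>.\<close>
    define q where "q = boundary_value f x / ((u w + \<i>) * (of_real r - \<i>) * (of_real x - w))"
    have \<phi>_eq: "\<phi> n x = q * (of_real (m n) * (of_real x - w) / ((of_real (t n) - of_real x) * (of_real (t n) - w)))" for n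
      unfolding \<phi>_def E_boundary_value[OF x] E_def r q_def
      using nz separated_nonzero[OF x, of n] separated_nonzero[OF ws, of n]
      by (simp add: divide_simps)
    have sums: "(\<lambda>n. \<phi> n x) sums (q * (of_real r - u w))"
      unfolding \<phi>_eq r[symmetric] by (intro sums_mult u_diff_sums x ws)
    have "summable (\<lambda>n. norm (\<phi> n x))"
    proof -
      obtain d1 where d1: "d1 > 0" "\<And>n. d1 \<le> cmod (of_real (t n) - of_real x)" using x by (auto simp: separated_def)
      obtain d2 where d2: "d2 > 0" "\<And>n. d2 \<le> cmod (of_real (t n) - w)" using ws by (auto simp: separated_def)
      show ?thesis
      proof (rule summable_comparison_test')
        show "summable (\<lambda>n. cmod q * cmod (of_real x - w) * (m n / (d1 * d2)))"
          by (intro summable_mult summable_divide summable_m)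
        fix n
        have "d1 * d2 \<le> cmod (of_real (t n) - of_real x) * cmod (of_real (t n) - w)"
          using d1 d2 by (intro mult_mono) (auto intro: less_imp_le)
        moreover have "0 < d1 * d2" using d1 d2 by simp
        ultimately have "m n / (cmod (of_real (t n) - of_real x) * cmod (of_real (t n) - w)) \<le> m n / (d1 * d2)"
          using less_imp_le[OF m_pos[of n]] by (intro frac_le) simp_all
        then have "cmod q * cmod (of_real x - w) * (m n / (cmod (of_real (t n) - of_real x) * cmod (of_real (t n) - w)))
            \<le> cmod q * cmod (of_real x - w) * (m n / (d1 * d2))" by (intro mult_left_mono) auto
        then show "norm (norm (\<phi> n x)) \<le> cmod q * cmod (of_real x - w) * (m n / (d1 * d2))"
          using m_pos[of n] unfolding \<phi>_eq by (simp add: norm_mult norm_divide mult_ac)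
      qed
    qed
    moreover have "boundary_value f x * (1 / (of_real x - w)) - U w * (boundary_value f x * cnj (boundary_value h x)) = 2 * \<i> * (q * (of_real r - u w))"
    proof -
      have "cnj (boundary_value h x) = (of_real r + \<i>) / (of_real r - \<i>) * (1 / (of_real x - w))"
        unfolding hbx U_def r by simp
      then have "boundary_value f x * (1 / (of_real x - w)) - U w * (boundary_value f x * cnj (boundary_value h x)) =
          boundary_value f x / (of_real x - w) * (1 - (u w - \<i>) * (of_real r + \<i>) / ((u w + \<i>) * (of_real r - \<i>)))"
      proof -
        have "b * (1 / X) - P / Q * (b * (R / S * (1 / X))) = b / X * (1 - P * R / (Q * S))" for b X P Q R S :: complex
          by (simp add: right_diff_distrib mult_ac)
        moreover assume "cnj (boundary_value h x) = (of_real r + \<i>) / (of_real r - \<i>) * (1 / (of_real x - w))"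
        ultimately show ?thesis by (simp only: U_def)
      qed
      also have "1 - (u w - \<i>) * (of_real r + \<i>) / ((u w + \<i>) * (of_real r - \<i>)) =
          2 * \<i> * (of_real r - u w) / ((u w + \<i>) * (of_real r - \<i>))"
      proof -
        have "1 - N / D = (D - N) / D" if "D \<noteq> 0" for N D :: complex
          using that by (simp add: diff_divide_distrib)
        moreover have "(u w + \<i>) * (of_real r - \<i>) \<noteq> 0" using nz by simp
        moreover have "(u w + \<i>) * (of_real r - \<i>) - (u w - \<i>) * (of_real r + \<i>) = 2 * \<i> * (of_real r - u w)"
          by (simp add: algebra_simps)
        ultimately show ?thesis by (simp only: not_False_eq_True)
      qed
      finally show ?thesis by (simp add: q_def mult_ac)
    qed
    ultimately show "summable (\<lambda>n. norm (\<phi> n x)) \<and>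
      boundary_value f x * (1 / (of_real x - w)) - U w * (boundary_value f x * cnj (boundary_value h x)) = 2 * \<i> * (\<Sum>n. \<phi> n x)"
      using sums_unique[OF sums] by simp
  qed
  have sm: "summable (\<lambda>n. LINT x|lborel. norm (\<phi> n x))"
  proof (rule summable_comparison_test')
    show "summable (\<lambda>n. (1 / Im w) * sqrt (boundary_sqnorm f * pi) * sqrt (m n))"
      by (intro summable_mult summable_sqrt_m)
    fix n
    have En: "cmod (E n w) \<le> 1 / Im w"
    proof -
      have "cmod (E n w) \<le> 1 / cmod (of_real (t n) - w)" by (rule E_norm_le) (use w in simp)
      also have "\<dots> \<le> 1 / Im w" using cmod_ge_Im[of w "t n"] Imw by (intro divide_left_mono mult_pos_pos) auto
      finally show ?thesis .
    qed
    have "(LINT x|lborel. norm (\<phi> n x)) = (m n * cmod (E n w)) * (LINT x|lborel. cmod (boundary_value f x * cnj (boundary_value (E n) x)))"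
      using m_pos[of n] by (simp add: \<phi>_def norm_mult)
    also have "\<dots> \<le> (m n * (1 / Im w)) * sqrt (boundary_sqnorm f * (pi / m n))"
      using H2_inner(3)[OF f2 E_H2[of n]] En m_pos[of n] Imw unfolding boundary_sqnorm_E
      by (intro mult_mono mult_left_mono) auto
    also have "\<dots> = (1 / Im w) * sqrt (boundary_sqnorm f * pi) * sqrt (m n)"
    proof -
      have "m n * sqrt (boundary_sqnorm f * (pi / m n)) = sqrt (boundary_sqnorm f * pi) * (m n / sqrt (m n))"
        by (simp add: real_sqrt_mult real_sqrt_divide)
      also have "m n / sqrt (m n) = sqrt (m n)" using m_pos[of n] by (simp add: real_div_sqrt)
      finally show ?thesis by (simp add: mult_ac)
    qed
    finally show "norm (LINT x|lborel. norm (\<phi> n x)) \<le> (1 / Im w) * sqrt (boundary_sqnorm f * pi) * sqrt (m n)"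
      by simp
  qed
  have ae_sm: "AE x in lborel. summable (\<lambda>n. norm (\<phi> n x))" using key by eventually_elim simp
  note S = sums_integral[OF int_\<phi> ae_sm sm] and SI = integrable_suminf[OF int_\<phi> ae_sm sm]
  have "2 * of_real pi * \<i> * f w = (LINT x|lborel. boundary_value f x * (1 / (of_real x - w))) - U w * (LINT x|lborel. boundary_value f x * cnj (boundary_value h x))"
    by (simp only: zero int_k(2) mult_zero_right diff_zero)
  also have "\<dots> = (LINT x|lborel. boundary_value f x * (1 / (of_real x - w)) - U w * (boundary_value f x * cnj (boundary_value h x)))"
    using int_k(1) int_h by (subst Bochner_Integration.integral_diff) (auto intro: integrable_mult_right)
  also have "\<dots> = (LINT x|lborel. 2 * \<i> * (\<Sum>n. \<phi> n x))"
  proof (rule integral_cong_AE)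
    show "(\<lambda>x. boundary_value f x * (1 / (of_real x - w)) - U w * (boundary_value f x * cnj (boundary_value h x))) \<in> borel_measurable lborel"
      using borel_measurable_integrable[OF int_k(1)] borel_measurable_integrable[OF int_h] by auto
    show "(\<lambda>x. 2 * \<i> * (\<Sum>n. \<phi> n x)) \<in> borel_measurable lborel"
      using borel_measurable_integrable[OF SI] by auto
    show "AE x in lborel. boundary_value f x * (1 / (of_real x - w)) - U w * (boundary_value f x * cnj (boundary_value h x)) = 2 * \<i> * (\<Sum>n. \<phi> n x)"
      using key by eventually_elim simp
  qed
  also have "\<dots> = 2 * \<i> * (LINT x|lborel. (\<Sum>n. \<phi> n x))"
    by (rule integral_mult_right_zero)
  finally have "(LINT x|lborel. (\<Sum>n. \<phi> n x)) = of_real pi * f w" by simp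
  moreover have "(LINT x|lborel. \<phi> n x) = of_real (m n) * E n w * (LINT x|lborel. boundary_value f x * cnj (boundary_value (E n) x))" for n
    unfolding \<phi>_def by (rule integral_mult_right_zero)
  ultimately show ?thesis using S by simp
qed

text \<open>
  The coefficients are those of the reproducing formula; their square summability is Bessel's inequality.
\<close>
lemma model_space_expansion:
  assumes f: "f \<in> model_space U"
  shows "\<exists>c. summable (\<lambda>n. m n * (cmod (c n))\<^sup>2) \<and>
    (\<forall>z\<in>upper_half_plane. (\<lambda>n. c n * of_real (m n) * E n z) sums f z)"
proof -
  have f2: "H2 f" using f by (auto simp: model_space_iff hardy2_iff)
  define c where "c = (\<lambda>n. (LINT x|lborel. boundary_value f x * cnj (boundary_value (E n) x)) / of_real pi)"
  have bessel: "pi * (\<Sum>n<N. m n * (cmod (c n))\<^sup>2) \<le> boundary_sqnorm f" for N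
  proof -
    define B where "B = pi * (\<Sum>n<N. m n * (cmod (c n))\<^sup>2)"
    have B0: "B \<ge> 0" unfolding B_def using m_pos by (intro mult_nonneg_nonneg sum_nonneg) (auto intro: less_imp_le)
    have "(LINT x|lborel. boundary_value f x * cnj (boundary_value (kernel_sum c {..<N}) x)) =
        (\<Sum>n<N. cnj (c n) * of_real (m n) * (of_real pi * c n))"
      by (subst inner_kernel_sum[OF f2]) (simp_all add: c_def)
    also have "\<dots> = (\<Sum>n<N. of_real (pi * (m n * (cmod (c n))\<^sup>2)))"
      by (intro sum.cong refl) (simp only: of_real_mult complex_norm_square mult_ac)
    also have "\<dots> = of_real B" by (simp add: B_def sum_distrib_left)
    finally have "cmod (LINT x|lborel. boundary_value f x * cnj (boundary_value (kernel_sum c {..<N}) x)) = B"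
      using B0 by simp
    then have "B \<le> sqrt (boundary_sqnorm f * boundary_sqnorm (kernel_sum c {..<N}))"
      using H2_inner(2)[OF f2 kernel_sum_H2[of "{..<N}" c]] by simp
    also have "boundary_sqnorm (kernel_sum c {..<N}) = B" by (simp add: boundary_sqnorm_kernel_sum B_def)
    finally have "B\<^sup>2 \<le> (sqrt (boundary_sqnorm f * B))\<^sup>2" using B0 by (intro power_mono) auto
    then have "B * B \<le> boundary_sqnorm f * B" using B0 boundary_sqnorm_nonneg[of f] by (simp add: power2_eq_square)
    then show ?thesis using B0 boundary_sqnorm_nonneg[of f] unfolding B_def[symmetric] by (cases "B = 0") auto
  qed
  have "summable (\<lambda>n. m n * (cmod (c n))\<^sup>2)"
  proof (rule summableI_nonneg_bounded)
    show "0 \<le> m n * (cmod (c n))\<^sup>2" for n using m_pos[of n] by simp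
    show "(\<Sum>n<N. m n * (cmod (c n))\<^sup>2) \<le> boundary_sqnorm f / pi" for N
      using bessel[of N] by (simp add: pos_le_divide_eq mult.commute)
  qed
  moreover have "(\<lambda>n. c n * of_real (m n) * E n z) sums f z" if z: "z \<in> upper_half_plane" for z
    using sums_divide[OF U_reproducing[OF f z], of "of_real pi"] by (simp add: c_def mult_ac)
  ultimately show ?thesis by blast
qed

text \<open>
  On the line \<open>cnj (E n) * U = E n\<close>, so the inner product is the conjugate of the integral of \<open>g * E n\<close>,
  a product of two functions of class \<open>H\<^sup>2\<close>.
\<close>
lemma E_orthogonal_range:
  assumes g: "H2 g"
  shows "(LINT x|lborel. boundary_value (E n) x * cnj (boundary_value (\<lambda>z. U z * g z) x)) = 0"
proof -
  obtain K where K: "\<And>z. z \<in> upper_half_plane \<Longrightarrow> cmod (E n z) \<le> K / cmod (z + \<i>)" by (rule E_decay[of n]) blast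
  note Z = H2_boundary_product_zero[OF g E_holomorphic K]
  have "(LINT x|lborel. boundary_value (E n) x * cnj (boundary_value (\<lambda>z. U z * g z) x)) =
      (LINT x|lborel. cnj (boundary_value g x * boundary_value (E n) x))"
  proof (rule integral_cong_AE)
    show "(\<lambda>x. boundary_value (E n) x * cnj (boundary_value (\<lambda>z. U z * g z) x)) \<in> borel_measurable lborel"
      using borel_measurable_integrable[OF H2_inner(1)[OF E_H2 U_mult_H2[OF g]]] .
    show "(\<lambda>x. cnj (boundary_value g x * boundary_value (E n) x)) \<in> borel_measurable lborel"
      using cnj_measurable[of "\<lambda>x. boundary_value g x * boundary_value (E n) x"] borel_measurable_integrable[OF Z(2)] by simp
    show "AE x in lborel. boundary_value (E n) x * cnj (boundary_value (\<lambda>z. U z * g z) x) = cnj (boundary_value g x * boundary_value (E n) x)"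
      using AE_separated U_mult_boundary[OF g]
    proof eventually_elim
      fix x assume x: "separated (of_real x)" and b: "boundary_value (\<lambda>z. U z * g z) x = U (of_real x) * boundary_value g x"
      obtain r where r: "u (of_real x) = of_real r" by (rule u_real[OF x])
      have nz: "of_real r + \<i> \<noteq> 0" "of_real r - \<i> \<noteq> 0" by (auto simp: complex_eq_iff)
      have "E n (of_real x) * cnj (U (of_real x)) = cnj (E n (of_real x))"
        using nz separated_nonzero[OF x, of n] by (simp add: E_def U_def r)
      then show "boundary_value (E n) x * cnj (boundary_value (\<lambda>z. U z * g z) x) = cnj (boundary_value g x * boundary_value (E n) x)"
        unfolding b E_boundary_value[OF x] by (metis complex_cnj_mult mult.assoc mult.commute)
    qed
  qed
  also have "\<dots> = 0" using Z(1) unfolding Bochner_Integration.integral_cnj by simp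
  finally show ?thesis .
qed

text \<open>
  The tails of the series have squared norm at most \<open>pi\<close> times the tails of \<open>\<Sum>n. m n * \<bar>c n\<bar>\<^sup>2\<close>, so the series converges in
  the Hardy space norm and orthogonality to \<open>U\<close> times the Hardy space passes from the partial sums to the limit.
\<close>
lemma expansion_model_space:
  assumes c: "summable (\<lambda>n. m n * (cmod (c n))\<^sup>2)"
    and F0: "\<And>z. z \<notin> upper_half_plane \<Longrightarrow> F z = 0"
    and F: "\<And>z. z \<in> upper_half_plane \<Longrightarrow> (\<lambda>n. c n * of_real (m n) * E n z) sums F z"
  shows "F \<in> model_space U"
proof -
  have holF: "F holomorphic_on upper_half_plane"
  proof -
    have "(\<lambda>z. \<Sum>n. c n * of_real (m n) * E n z) holomorphic_on upper_half_plane"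
    proof (rule holomorphic_on_suminf)
      show "(\<lambda>z. c n * of_real (m n) * E n z) holomorphic_on upper_half_plane" for n
        by (intro holomorphic_intros E_holomorphic)
      fix \<eta> :: real assume \<eta>: "\<eta> > 0"
      obtain B where B: "\<And>n. norm (m n * (cmod (c n))\<^sup>2) \<le> B"
        using summable_imp_Bseq[OF c] by (auto simp: Bseq_def)
      have B0: "0 \<le> B" using order_trans[OF norm_ge_zero B[of 0]] .
      have "cmod (c n * of_real (m n) * E n z) \<le> sqrt B * sqrt (m n) / \<eta>" if z: "\<eta> \<le> Im z" for n z
      proof -
        have zu: "z \<in> upper_half_plane" using z \<eta> by (simp add: upper_half_plane_def)
        have "cmod (E n z) \<le> 1 / cmod (of_real (t n) - z)" by (rule E_norm_le) (use zu in simp)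
        also have "\<dots> \<le> 1 / \<eta>" using cmod_ge_Im[of z "t n"] z \<eta> by (intro divide_left_mono mult_pos_pos) auto
        finally have En: "cmod (E n z) \<le> 1 / \<eta>" .
        have "cmod (c n) * sqrt (m n) = sqrt (m n * (cmod (c n))\<^sup>2)"
          by (simp add: real_sqrt_mult mult.commute)
        also have "\<dots> \<le> sqrt B" using B[of n] by (intro real_sqrt_le_mono) auto
        finally have "cmod (c n) * sqrt (m n) * sqrt (m n) \<le> sqrt B * sqrt (m n)"
          using m_pos[of n] by (intro mult_right_mono) auto
        then have "cmod (c n) * m n \<le> sqrt B * sqrt (m n)" using m_pos[of n] by (simp add: mult.assoc)
        then have "cmod (c n) * m n * cmod (E n z) \<le> sqrt B * sqrt (m n) * (1 / \<eta>)"
          by (rule mult_mono[OF _ En]) (use B0 m_pos[of n] in \<open>simp_all add: less_imp_le\<close>)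
        then show ?thesis using m_pos[of n] by (simp add: norm_mult)
      qed
      then show "\<exists>M. summable M \<and> (\<forall>n z. \<eta> \<le> Im z \<longrightarrow> cmod (c n * of_real (m n) * E n z) \<le> M n)"
        by (intro exI[of _ "\<lambda>n. sqrt B * sqrt (m n) / \<eta>"]) (auto intro!: summable_divide summable_mult summable_sqrt_m)
    qed
    then show ?thesis by (rule holomorphic_transform) (rule sums_unique[OF F, symmetric])
  qed
  define tail where "tail = (\<lambda>N. pi * ((\<Sum>n. m n * (cmod (c n))\<^sup>2) - (\<Sum>n<N. m n * (cmod (c n))\<^sup>2)))"
  have nonneg: "0 \<le> m n * (cmod (c n))\<^sup>2" for n using m_pos[of n] by simp
  have tail0: "tail N \<ge> 0" for N
    unfolding tail_def using sum_le_suminf[OF c, of "{..<N}"] nonneg by simp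
  have tail_lim: "tail \<longlonglongrightarrow> 0"
  proof -
    have "tail \<longlonglongrightarrow> pi * ((\<Sum>n. m n * (cmod (c n))\<^sup>2) - (\<Sum>n. m n * (cmod (c n))\<^sup>2))"
      unfolding tail_def by (intro tendsto_intros summable_LIMSEQ c)
    then show ?thesis by simp
  qed
  have G: "H2 (\<lambda>z. F z - kernel_sum c {..<N} z)" "boundary_sqnorm (\<lambda>z. F z - kernel_sum c {..<N} z) \<le> tail N" for N
  proof -
    have line: "line_sqnorm (\<lambda>z. F z - kernel_sum c {..<N} z) y \<le> ennreal (tail N)" if y: "0 < y" for y
      unfolding line_sqnorm_def
    proof (rule nn_integral_norm_square_LIMSEQ_le[where f = "\<lambda>M x. kernel_sum c {N..<M + N} (Complex x y)"])
      have H: "H2 (kernel_sum c {N..<M + N})" for M by (intro kernel_sum_H2) simp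
      show "(\<lambda>x. kernel_sum c {N..<M + N} (Complex x y)) \<in> borel_measurable borel" for M
        by (rule horizontal_measurable[OF H2_continuous[OF H] y])
      have "(\<lambda>M. kernel_sum c {N..<M + N} z) \<longlonglongrightarrow> F z - kernel_sum c {..<N} z" if z: "z \<in> upper_half_plane" for z
      proof -
        have "(\<lambda>M. kernel_sum c {..<M + N} z - kernel_sum c {..<N} z) \<longlonglongrightarrow> F z - kernel_sum c {..<N} z"
          using F[OF z] unfolding kernel_sum_def sums_def by (intro tendsto_intros LIMSEQ_ignore_initial_segment)
        moreover have "kernel_sum c {..<M + N} z - kernel_sum c {..<N} z = kernel_sum c {N..<M + N} z" for M
          unfolding kernel_sum_def lessThan_atLeast0
          using sum.atLeastLessThan_concat[of 0 N "M + N" "\<lambda>n. c n * of_real (m n) * E n z"]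
          by (simp add: algebra_simps)
        ultimately show ?thesis by simp
      qed
      then show "AE x in lborel. (\<lambda>M. kernel_sum c {N..<M + N} (Complex x y)) \<longlonglongrightarrow> F (Complex x y) - kernel_sum c {..<N} (Complex x y)"
        using y by (intro AE_I2) simp
      fix M
      have "(\<integral>\<^sup>+x. ennreal ((cmod (kernel_sum c {N..<M + N} (Complex x y)))\<^sup>2) \<partial>lborel) \<le> ennreal (boundary_sqnorm (kernel_sum c {N..<M + N}))"
        using H2_line_sqnorm_le_boundary[OF H y] by (simp add: line_sqnorm_def)
      also have "boundary_sqnorm (kernel_sum c {N..<M + N}) \<le> tail N"
      proof -
        have "(\<Sum>n<N. m n * (cmod (c n))\<^sup>2) + (\<Sum>n\<in>{N..<M + N}. m n * (cmod (c n))\<^sup>2) = (\<Sum>n<M + N. m n * (cmod (c n))\<^sup>2)"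
          unfolding lessThan_atLeast0 by (rule sum.atLeastLessThan_concat) auto
        also have "\<dots> \<le> (\<Sum>n. m n * (cmod (c n))\<^sup>2)" by (rule sum_le_suminf[OF c]) (use nonneg in auto)
        finally show ?thesis by (simp add: boundary_sqnorm_kernel_sum tail_def)
      qed
      then have "ennreal (boundary_sqnorm (kernel_sum c {N..<M + N})) \<le> ennreal (tail N)" by (rule ennreal_leI)
      finally show "(\<integral>\<^sup>+x. ennreal ((cmod (kernel_sum c {N..<M + N} (Complex x y)))\<^sup>2) \<partial>lborel) \<le> ennreal (tail N)" .
    qed
    show H2G: "H2 (\<lambda>z. F z - kernel_sum c {..<N} z)"
      unfolding H2_def using line tail0[of N] holF H2_holomorphic[OF kernel_sum_H2[of "{..<N}" c]]
      by (auto intro!: holomorphic_intros)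
    have "ennreal (boundary_sqnorm (\<lambda>z. F z - kernel_sum c {..<N} z)) \<le> ennreal (tail N)"
      using H2_boundary_norm_le[OF H2G line] by (simp add: H2_boundary_square_integrable(2)[OF H2G])
    then show "boundary_sqnorm (\<lambda>z. F z - kernel_sum c {..<N} z) \<le> tail N" using tail0[of N] by (simp add: ennreal_le_iff)
  qed
  have H2F: "H2 F" using G(1)[of 0] by (simp add: kernel_sum_def)
  have "hardy2_inner F (\<lambda>z. U z * g z) = 0" if g: "g \<in> hardy2" for g
  proof -
    have g2: "H2 g" using g by (simp add: hardy2_iff)
    define h where "h = (\<lambda>z. U z * g z)"
    have h2: "H2 h" unfolding h_def by (rule U_mult_H2[OF g2])
    have bound: "cmod (hardy2_inner F h) \<le> sqrt (tail N * boundary_sqnorm h)" for N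
    proof -
      let ?G = "\<lambda>z. F z - kernel_sum c {..<N} z"
      have comb0: "(LINT x|lborel. boundary_value (kernel_sum c {..<N}) x * cnj (boundary_value h x)) = 0"
      proof -
        have "(LINT x|lborel. boundary_value (kernel_sum c {..<N}) x * cnj (boundary_value h x)) =
          cnj (LINT x|lborel. boundary_value h x * cnj (boundary_value (kernel_sum c {..<N}) x))"
          by (subst Bochner_Integration.integral_cnj[symmetric]) (simp add: mult.commute)
        also have "\<dots> = (\<Sum>n<N. c n * of_real (m n) * cnj (LINT x|lborel. boundary_value h x * cnj (boundary_value (E n) x)))"
          by (subst inner_kernel_sum[OF h2]) auto
        also have "\<dots> = (\<Sum>n<N. c n * of_real (m n) * (LINT x|lborel. boundary_value (E n) x * cnj (boundary_value h x)))"
          by (subst Bochner_Integration.integral_cnj[symmetric]) (simp add: mult.commute)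
        also have "\<dots> = 0" unfolding h_def using E_orthogonal_range[OF g2] by simp
        finally show ?thesis .
      qed
      have "hardy2_inner F h = (LINT x|lborel. boundary_value ?G x * cnj (boundary_value h x) + boundary_value (kernel_sum c {..<N}) x * cnj (boundary_value h x))"
        unfolding hardy2_inner_def
      proof (rule integral_cong_AE)
        show "(\<lambda>x. boundary_value F x * cnj (boundary_value h x)) \<in> borel_measurable lborel"
          by (rule borel_measurable_integrable[OF H2_inner(1)[OF H2F h2]])
        show "(\<lambda>x. boundary_value ?G x * cnj (boundary_value h x) + boundary_value (kernel_sum c {..<N}) x * cnj (boundary_value h x)) \<in> borel_measurable lborel"
          by (intro borel_measurable_add borel_measurable_integrable[OF H2_inner(1)[OF G(1) h2]] borel_measurable_integrable[OF H2_inner(1)[OF kernel_sum_H2 h2]]) simp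
        have "AE x in lborel. boundary_value ?G x = boundary_value F x - boundary_value (kernel_sum c {..<N}) x"
          using H2_boundary_tendsto[OF H2F] H2_boundary_tendsto[OF kernel_sum_H2[of "{..<N}" c, simplified]]
          by eventually_elim (intro boundary_value_eqI tendsto_diff)
        then show "AE x in lborel. boundary_value F x * cnj (boundary_value h x) =
            boundary_value ?G x * cnj (boundary_value h x) + boundary_value (kernel_sum c {..<N}) x * cnj (boundary_value h x)"
        proof eventually_elim
          fix x assume eq: "boundary_value ?G x = boundary_value F x - boundary_value (kernel_sum c {..<N}) x"
          show "boundary_value F x * cnj (boundary_value h x) =
            boundary_value ?G x * cnj (boundary_value h x) + boundary_value (kernel_sum c {..<N}) x * cnj (boundary_value h x)"
            unfolding eq by (simp add: algebra_simps)
        qed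
      qed
      also have "\<dots> = (LINT x|lborel. boundary_value ?G x * cnj (boundary_value h x)) + (LINT x|lborel. boundary_value (kernel_sum c {..<N}) x * cnj (boundary_value h x))"
        by (intro Bochner_Integration.integral_add H2_inner(1) G(1) kernel_sum_H2 h2) simp
      finally have "hardy2_inner F h = (LINT x|lborel. boundary_value ?G x * cnj (boundary_value h x))" by (simp add: comb0)
      then have "cmod (hardy2_inner F h) \<le> sqrt (boundary_sqnorm ?G * boundary_sqnorm h)" using H2_inner(2)[OF G(1) h2, of N] by simp
      also have "\<dots> \<le> sqrt (tail N * boundary_sqnorm h)"
        using G(2)[of N] boundary_sqnorm_nonneg by (intro real_sqrt_le_mono mult_right_mono) auto
      finally show ?thesis .
    qed
    have "(\<lambda>N. sqrt (tail N * boundary_sqnorm h)) \<longlonglongrightarrow> sqrt (0 * boundary_sqnorm h)" by (intro tendsto_intros tail_lim)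
    then have "cmod (hardy2_inner F h) \<le> sqrt (0 * boundary_sqnorm h)"
      by (rule LIMSEQ_le_const) (use bound in auto)
    then show ?thesis by (simp add: h_def)
  qed
  then show ?thesis using H2F F0 by (simp add: model_space_iff hardy2_iff[of F])
qed

theorem model_space_characterization:
  "f \<in> model_space U \<longleftrightarrow> (\<forall>z. z \<notin> upper_half_plane \<longrightarrow> f z = 0) \<and>
    (\<exists>c. summable (\<lambda>n. m n * (cmod (c n))\<^sup>2) \<and>
      (\<forall>z\<in>upper_half_plane. (\<lambda>n. c n * of_real (m n) * E n z) sums f z))"
proof
  assume f: "f \<in> model_space U"
  then show "(\<forall>z. z \<notin> upper_half_plane \<longrightarrow> f z = 0) \<and>
    (\<exists>c. summable (\<lambda>n. m n * (cmod (c n))\<^sup>2) \<and>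
      (\<forall>z\<in>upper_half_plane. (\<lambda>n. c n * of_real (m n) * E n z) sums f z))"
    using model_space_expansion[OF f] by (auto simp: model_space_iff hardy2_iff)
qed (auto intro: expansion_model_space)

end

section \<open>Comparable masses and the unbounded multiplier\<close>

text \<open>
  The quotient carries the kernels of the first system to those of the second. The coefficients change by the
  factor \<open>m1 n / m2 n\<close>, which is at most \<open>C\<close>.
\<close>
lemma model_space_multiplier:
  assumes A1: "atoms t m1" and A2: "atoms t m2" and C: "\<And>n. m1 n \<le> C * m2 n"
    and f: "f \<in> model_space (atoms.U t m1)"
  shows "(\<lambda>z. (atoms.u t m1 z + \<i>) / (atoms.u t m2 z + \<i>) * f z) \<in> model_space (atoms.U t m2)"
proof -
  interpret A1: atoms t m1 by (rule A1)
  interpret A2: atoms t m2 by (rule A2)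
  let ?\<Psi> = "\<lambda>z. (A1.u z + \<i>) / (A2.u z + \<i>)"
  obtain c where f0: "\<And>z. z \<notin> upper_half_plane \<Longrightarrow> f z = 0"
    and c: "summable (\<lambda>n. m1 n * (cmod (c n))\<^sup>2)"
    and fs: "\<And>z. z \<in> upper_half_plane \<Longrightarrow> (\<lambda>n. c n * of_real (m1 n) * A1.E n z) sums f z"
    using f unfolding A1.model_space_characterization by blast
  define c' where "c' = (\<lambda>n. c n * of_real (m1 n / m2 n))"
  show ?thesis
  proof (rule A2.expansion_model_space[of c'])
    show "summable (\<lambda>n. m2 n * (cmod (c' n))\<^sup>2)"
    proof (rule summable_comparison_test')
      show "summable (\<lambda>n. C * (m1 n * (cmod (c n))\<^sup>2))" by (intro summable_mult c)
      fix n
      have pos: "m1 n > 0" "m2 n > 0" using A1.m_pos A2.m_pos by auto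
      have "m2 n * (cmod (c' n))\<^sup>2 = m1 n * (cmod (c n))\<^sup>2 * (m1 n / m2 n)"
        using pos by (simp add: c'_def norm_mult norm_divide power_mult_distrib power2_eq_square)
      also have "\<dots> \<le> m1 n * (cmod (c n))\<^sup>2 * C"
        using pos C[of n] by (intro mult_left_mono) (auto simp: pos_divide_le_eq)
      finally show "norm (m2 n * (cmod (c' n))\<^sup>2) \<le> C * (m1 n * (cmod (c n))\<^sup>2)"
        using pos by (simp add: mult.commute)
    qed
    show "?\<Psi> z * f z = 0" if "z \<notin> upper_half_plane" for z using f0[OF that] by simp
    fix z assume z: "z \<in> upper_half_plane"
    have "(\<lambda>n. ?\<Psi> z * (c n * of_real (m1 n) * A1.E n z)) sums (?\<Psi> z * f z)"
      by (intro sums_mult fs z)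
    moreover have "?\<Psi> z * (c n * of_real (m1 n) * A1.E n z) = c' n * of_real (m2 n) * A2.E n z" for n
    proof -
      have "m2 n \<noteq> 0" using A2.m_pos[of n] by simp
      moreover have "A1.u z + \<i> \<noteq> 0" by (rule A1.u_plus_i_nonzero[OF z])
      ultimately show ?thesis by (simp add: c'_def A1.E_def A2.E_def)
    qed
    ultimately show "(\<lambda>n. c' n * of_real (m2 n) * A2.E n z) sums (?\<Psi> z * f z)" by simp
  qed
qed

lemma mult_image_model_space:
  assumes A1: "atoms t m1" and A2: "atoms t m2"
    and C: "\<And>n. m1 n \<le> C1 * m2 n" "\<And>n. m2 n \<le> C2 * m1 n"
  shows "mult_image (\<lambda>z. (atoms.u t m1 z + \<i>) / (atoms.u t m2 z + \<i>)) (model_space (atoms.U t m1)) = model_space (atoms.U t m2)"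
proof
  show "mult_image (\<lambda>z. (atoms.u t m1 z + \<i>) / (atoms.u t m2 z + \<i>)) (model_space (atoms.U t m1)) \<subseteq> model_space (atoms.U t m2)"
    unfolding mult_image_def using model_space_multiplier[OF A1 A2 C(1)] by auto
  show "model_space (atoms.U t m2) \<subseteq> mult_image (\<lambda>z. (atoms.u t m1 z + \<i>) / (atoms.u t m2 z + \<i>)) (model_space (atoms.U t m1))"
  proof
    fix g assume g: "g \<in> model_space (atoms.U t m2)"
    define f where "f = (\<lambda>z. (atoms.u t m2 z + \<i>) / (atoms.u t m1 z + \<i>) * g z)"
    have f: "f \<in> model_space (atoms.U t m1)"
      unfolding f_def by (rule model_space_multiplier[OF A2 A1 C(2) g])
    have "g z = (atoms.u t m1 z + \<i>) / (atoms.u t m2 z + \<i>) * f z" for z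
    proof (cases "z \<in> upper_half_plane")
      case True
      then show ?thesis
        using atoms.u_plus_i_nonzero[OF A1 True] atoms.u_plus_i_nonzero[OF A2 True] by (simp add: f_def)
    next
      case False
      then have "g z = 0" using g by (auto simp: model_space_iff hardy2_iff)
      then show ?thesis by (simp add: f_def)
    qed
    then show "g \<in> mult_image (\<lambda>z. (atoms.u t m1 z + \<i>) / (atoms.u t m2 z + \<i>)) (model_space (atoms.U t m1))"
      unfolding mult_image_def using f by (intro image_eqI[of _ _ f]) auto
  qed
qed

lemma summable_power_div2:
  fixes q :: real
  assumes q: "0 < q" "q < 1"
  shows "summable (\<lambda>n. q ^ (n div 2))"
proof -
  define r where "r = sqrt q"
  have r: "0 < r" "r < 1" "r\<^sup>2 = q" using q by (simp_all add: r_def)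
  show ?thesis
  proof (rule summable_comparison_test')
    show "summable (\<lambda>n. r ^ n / r)" using r by (intro summable_divide summable_geometric) auto
    fix n
    have "r * q ^ (n div 2) = r ^ (2 * (n div 2) + 1)" by (simp add: r(3)[symmetric] power_mult)
    also have "\<dots> \<le> r ^ n" using r by (intro power_decreasing) auto
    finally show "norm (q ^ (n div 2)) \<le> r ^ n / r" using r q by (simp add: pos_le_divide_eq mult.commute)
  qed
qed

text \<open>
  The points are \<open>2\<^sup>-\<^sup>k\<close> and \<open>- 2\<^sup>-\<^sup>k\<close>, at the indices \<open>2 * k\<close> and \<open>2 * k + 1\<close>.
\<close>
definition node :: "nat \<Rightarrow> real" where "node n = (-1) ^ n * (1/2) ^ (n div 2)"

definition mass :: "real \<Rightarrow> nat \<Rightarrow> real" where "mass a n = (if even n then a else 1) * (1/2) ^ (n div 2)"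

lemma atoms_node_mass:
  assumes a: "a \<ge> 1" shows "atoms node (mass a)"
proof
  show "0 < mass a n" for n using a by (simp add: mass_def)
  show "node n \<noteq> 0" for n by (simp add: node_def)
  have abs_node: "\<bar>node n\<bar> = (1/2) ^ (n div 2)" for n by (simp add: node_def abs_mult power_abs)
  show "node \<longlonglongrightarrow> 0"
  proof (rule tendsto_rabs_zero_cancel)
    show "(\<lambda>n. \<bar>node n\<bar>) \<longlonglongrightarrow> 0"
      unfolding abs_node by (rule summable_LIMSEQ_zero[OF summable_power_div2]) auto
  qed
  show "inj node"
  proof (rule injI)
    fix n k assume eq: "node n = node k"
    have "(1/2 :: real) ^ (n div 2) = (1/2) ^ (k div 2)" using arg_cong[OF eq, of abs] by (simp add: abs_node)
    then have d: "n div 2 = k div 2" by (subst (asm) power_inject_exp') auto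
    then have "(-1 :: real) ^ n = (-1) ^ k" using eq by (simp add: node_def)
    then have "even n \<longleftrightarrow> even k" by (cases "even n"; cases "even k") auto
    with d show "n = k" by presburger
  qed
  show "summable (\<lambda>n. sqrt (mass a n))"
  proof (rule summable_comparison_test')
    show "summable (\<lambda>n. sqrt a * sqrt (1/2) ^ (n div 2))"
      by (intro summable_mult summable_power_div2) auto
    fix n
    have "mass a n \<le> a * (1/2) ^ (n div 2)" using a by (auto simp: mass_def)
    then have "sqrt (mass a n) \<le> sqrt (a * (1/2) ^ (n div 2))" by (rule real_sqrt_le_mono)
    also have "\<dots> = sqrt a * sqrt (1/2) ^ (n div 2)" by (simp only: real_sqrt_mult real_sqrt_power)
    finally show "norm (sqrt (mass a n)) \<le> sqrt a * sqrt (1/2) ^ (n div 2)"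
      using a by (simp add: mass_def)
  qed
qed

lemma sum_pairs: "(\<Sum>n<2 * K. g n) = (\<Sum>k<K. g (2 * k) + g (2 * k + 1))" for g :: "nat \<Rightarrow> 'a::comm_monoid_add"
  by (induction K) (simp_all add: add.assoc)

text \<open>
  Only partial sums of even length occur, so that the two atoms at \<open>\<plusminus>2\<^sup>-\<^sup>k\<close> always enter together. Their real
  parts combine to a multiple of \<open>a - 1\<close>.
\<close>
lemma u_partial_sums:
  assumes a: "a \<ge> 1" and y: "y > 0"
  shows "(\<lambda>K. \<Sum>k<K. Complex ((a - 1) * ((1/4) ^ k / ((1/4) ^ k + y\<^sup>2))) ((a + 1) * ((1/2) ^ k * y / ((1/4) ^ k + y\<^sup>2))))
    \<longlonglongrightarrow> atoms.u node (mass a) (Complex 0 y)"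
proof -
  interpret A: atoms node "mass a" by (rule atoms_node_mass[OF a])
  have "(\<lambda>n. of_real (mass a n) / (of_real (node n) - Complex 0 y)) sums A.u (Complex 0 y)"
    by (rule A.u_sums[OF A.upper_separated]) (use y in simp)
  then have "(\<lambda>N. \<Sum>n<N. of_real (mass a n) / (of_real (node n) - Complex 0 y)) \<longlonglongrightarrow> A.u (Complex 0 y)"
    by (simp add: sums_def)
  moreover have "strict_mono (\<lambda>K::nat. 2 * K)" by (simp add: strict_mono_def)
  ultimately have "((\<lambda>N. \<Sum>n<N. of_real (mass a n) / (of_real (node n) - Complex 0 y)) \<circ> (\<lambda>K. 2 * K)) \<longlonglongrightarrow> A.u (Complex 0 y)"
    by (rule LIMSEQ_subseq_LIMSEQ)
  then have lim: "(\<lambda>K. \<Sum>k<K. of_real (mass a (2 * k)) / (of_real (node (2 * k)) - Complex 0 y) +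
      of_real (mass a (2 * k + 1)) / (of_real (node (2 * k + 1)) - Complex 0 y)) \<longlonglongrightarrow> A.u (Complex 0 y)"
    by (simp only: o_def sum_pairs)
  have "of_real (mass a (2 * k)) / (of_real (node (2 * k)) - Complex 0 y) +
      of_real (mass a (2 * k + 1)) / (of_real (node (2 * k + 1)) - Complex 0 y) =
      Complex ((a - 1) * ((1/4) ^ k / ((1/4) ^ k + y\<^sup>2))) ((a + 1) * ((1/2) ^ k * y / ((1/4) ^ k + y\<^sup>2)))" for k
  proof -
    define s :: real where "s = (1/2) ^ k"
    have s: "s > 0" "(1/4) ^ k = s\<^sup>2" by (simp_all add: s_def power2_eq_square flip: power_mult_distrib)
    have v: "mass a (2 * k) = a * s" "mass a (2 * k + 1) = s" "node (2 * k) = s" "node (2 * k + 1) = - s"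
      by (simp_all add: mass_def node_def s_def)
    have frac: "of_real p / (of_real q - Complex 0 y) = Complex (p * q / (q\<^sup>2 + y\<^sup>2)) (p * y / (q\<^sup>2 + y\<^sup>2))" for p q
      by (simp add: complex_eq_iff Re_divide Im_divide)
    show ?thesis unfolding v s(2) s_def[symmetric] frac
      by (simp add: complex_eq_iff power2_eq_square add_divide_distrib diff_divide_distrib algebra_simps)
  qed
  then show ?thesis using lim by simp
qed

text \<open>
  The real parts cancel. The imaginary parts are peaked where \<open>2\<^sup>-\<^sup>k\<close> is about \<open>y\<close>, and they are dominated by
  the differences of \<open>s / (s + y)\<close> at \<open>s = 2 * 2\<^sup>-\<^sup>k\<close> and \<open>s = 2\<^sup>-\<^sup>k\<close>, whose sum telescopes.
\<close>
lemma u_symmetric_bounded: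
  assumes y: "y > 0"
  shows "cmod (atoms.u node (mass 1) (Complex 0 y)) \<le> 8"
proof (rule LIMSEQ_le_const2[OF tendsto_norm[OF u_partial_sums[OF order_refl y]]])
  show "\<exists>N. \<forall>K\<ge>N. cmod (\<Sum>k<K. Complex ((1 - 1) * ((1/4) ^ k / ((1/4) ^ k + y\<^sup>2))) ((1 + 1) * ((1/2) ^ k * y / ((1/4) ^ k + y\<^sup>2)))) \<le> 8"
  proof (intro exI[of _ 0] allI impI)
    fix K :: nat
    define \<psi> where "\<psi> = (\<lambda>k::nat. 2 * (1/2) ^ k / (2 * (1/2) ^ k + y))"
    have step: "(1/2) ^ k * y / ((1/4) ^ k + y\<^sup>2) \<le> 4 * (\<psi> k - \<psi> (Suc k))" for k
    proof -
      define s :: real where "s = (1/2) ^ k"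
      have s: "s > 0" "(1/4) ^ k = s\<^sup>2" by (simp_all add: s_def power2_eq_square flip: power_mult_distrib)
      have "\<psi> k - \<psi> (Suc k) = 2 * s / (2 * s + y) - s / (s + y)" by (simp add: \<psi>_def s_def)
      also have "\<dots> = s * y / ((2 * s + y) * (s + y))" using s y by (simp add: field_simps)
      finally have eq: "\<psi> k - \<psi> (Suc k) = s * y / ((2 * s + y) * (s + y))" .
      have "(2 * s + y) * (s + y) \<le> 4 * (s\<^sup>2 + y\<^sup>2)"
      proof -
        have "2 * (s * y) \<le> s\<^sup>2 + y\<^sup>2" using sum_squares_bound[of s y] by (simp add: mult.assoc)
        moreover have "2 * A + 3 * P + B \<le> 4 * (A + B)" if "2 * P \<le> A + B" "0 \<le> A" "0 \<le> B" for A B P :: real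
          using that by argo
        ultimately have "2 * s\<^sup>2 + 3 * (s * y) + y\<^sup>2 \<le> 4 * (s\<^sup>2 + y\<^sup>2)"
          by (metis zero_le_power2)
        then show ?thesis by (simp add: power2_eq_square algebra_simps)
      qed
      then have "s * y / (4 * (s\<^sup>2 + y\<^sup>2)) \<le> s * y / ((2 * s + y) * (s + y))"
        using s y by (intro divide_left_mono mult_pos_pos add_pos_pos) auto
      moreover have "s * y / (4 * (s\<^sup>2 + y\<^sup>2)) = s * y / (s\<^sup>2 + y\<^sup>2) / 4"
        by (simp only: divide_divide_eq_left mult.commute[of 4])
      moreover have "p \<le> 4 * q" if "r \<le> q" "r = p / 4" for p q r :: real using that by simp
      ultimately have "s * y / (s\<^sup>2 + y\<^sup>2) \<le> 4 * (s * y / ((2 * s + y) * (s + y)))" by metis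
      then show ?thesis by (simp only: eq s(2) s_def[symmetric])
    qed
    have psi: "0 \<le> \<psi> k" "\<psi> k \<le> 1" for k
    proof -
      have "0 < 2 * (1/2) ^ k + y" using y by (intro add_pos_pos) auto
      then show "0 \<le> \<psi> k" "\<psi> k \<le> 1" using y by (auto simp: \<psi>_def pos_divide_le_eq)
    qed
    have "(\<Sum>k<K. (1/2) ^ k * y / ((1/4) ^ k + y\<^sup>2)) \<le> (\<Sum>k<K. 4 * (\<psi> k - \<psi> (Suc k)))"
      by (intro sum_mono step)
    also have "\<dots> = 4 * (\<psi> 0 - \<psi> K)" by (simp only: sum_distrib_left[symmetric] sum_lessThan_telescope')
    also have "\<dots> \<le> 4" using psi(1)[of K] psi(2)[of 0] by simp
    finally have le: "(\<Sum>k<K. (1/2) ^ k * y / ((1/4) ^ k + y\<^sup>2)) \<le> 4" .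
    have ge: "0 \<le> (\<Sum>k<K. (1/2) ^ k * y / ((1/4) ^ k + y\<^sup>2))" using y by (intro sum_nonneg) simp
    have "(\<Sum>k<K. Complex ((1 - 1) * ((1/4) ^ k / ((1/4) ^ k + y\<^sup>2))) ((1 + 1) * ((1/2) ^ k * y / ((1/4) ^ k + y\<^sup>2)))) =
        Complex 0 (2 * (\<Sum>k<K. (1/2) ^ k * y / ((1/4) ^ k + y\<^sup>2)))"
      by (simp add: complex_eq_iff sum_distrib_left)
    then show "cmod (\<Sum>k<K. Complex ((1 - 1) * ((1/4) ^ k / ((1/4) ^ k + y\<^sup>2))) ((1 + 1) * ((1/2) ^ k * y / ((1/4) ^ k + y\<^sup>2)))) \<le> 8"
    proof (rule ssubst)
      have "cmod (Complex 0 r) = \<bar>r\<bar>" for r by (simp add: cmod_def)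
      then show "cmod (Complex 0 (2 * (\<Sum>k<K. (1/2) ^ k * y / ((1/4) ^ k + y\<^sup>2)))) \<le> 8"
        using le ge by simp
    qed
  qed
qed

text \<open>
  At height \<open>2\<^sup>-\<^sup>K\<close> each of the first \<open>K\<close> pairs contributes at least \<open>1/2\<close> to the real part.
\<close>
lemma u_asymmetric_large:
  shows "real K / 2 \<le> Re (atoms.u node (mass 2) (Complex 0 ((1/2) ^ K)))"
proof -
  define y :: real where "y = (1/2) ^ K"
  have y: "y > 0" by (simp add: y_def)
  define \<sigma> where "\<sigma> = (\<lambda>k::nat. (1/4) ^ k / ((1/4) ^ k + y\<^sup>2))"
  have \<sigma>0: "\<sigma> k \<ge> 0" for k by (simp add: \<sigma>_def)
  have \<sigma>_half: "1/2 \<le> \<sigma> k" if k: "k < K" for k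
  proof -
    have "y\<^sup>2 = (1/4) ^ K" by (simp add: y_def power2_eq_square flip: power_mult_distrib)
    also have "\<dots> \<le> (1/4) ^ k" using k by (intro power_decreasing) auto
    finally have "y\<^sup>2 \<le> (1/4) ^ k" .
    moreover have "0 < (1/4 :: real) ^ k + y\<^sup>2" by (intro add_pos_nonneg) auto
    ultimately show ?thesis by (simp add: \<sigma>_def pos_le_divide_eq)
  qed
  have lim: "(\<lambda>N. \<Sum>k<N. \<sigma> k) \<longlonglongrightarrow> Re (atoms.u node (mass 2) (Complex 0 y))"
    using tendsto_Re[OF u_partial_sums[of 2 y]] y by (simp add: \<sigma>_def)
  have "real K / 2 \<le> Re (atoms.u node (mass 2) (Complex 0 y))"
  proof (rule LIMSEQ_le_const[OF lim])
    show "\<exists>M. \<forall>N\<ge>M. real K / 2 \<le> (\<Sum>k<N. \<sigma> k)"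
    proof (intro exI[of _ K] allI impI)
      fix N assume N: "K \<le> N"
      have "real K / 2 = (\<Sum>k<K. 1/2)" by simp
      also have "\<dots> \<le> (\<Sum>k<K. \<sigma> k)" by (intro sum_mono \<sigma>_half) auto
      also have "\<dots> \<le> (\<Sum>k<N. \<sigma> k)" using N \<sigma>0 by (intro sum_mono2) auto
      finally show "real K / 2 \<le> (\<Sum>k<N. \<sigma> k)" .
    qed
  qed
  then show ?thesis by (simp add: y_def)
qed

theorem theorem6p9:
  "\<exists>B \<Theta> \<Psi> :: complex \<Rightarrow> complex.
     inner_function B \<and> \<not> B constant_on upper_half_plane \<and>
     inner_function \<Theta> \<and> \<not> \<Theta> constant_on upper_half_plane \<and>
     \<Psi> holomorphic_on upper_half_plane \<and> \<not> bounded (\<Psi> ` upper_half_plane) \<and>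
     mult_image \<Psi> (model_space B) = model_space \<Theta>"
proof -
  interpret B: atoms node "mass 2" by (rule atoms_node_mass) simp
  interpret T: atoms node "mass 1" by (rule atoms_node_mass) simp
  define \<Psi> where "\<Psi> = (\<lambda>z. (B.u z + \<i>) / (T.u z + \<i>))"
  have "\<Psi> holomorphic_on upper_half_plane"
    unfolding \<Psi>_def by (intro holomorphic_intros B.u_holomorphic T.u_holomorphic T.u_plus_i_nonzero)
  moreover have "\<not> bounded (\<Psi> ` upper_half_plane)"
  proof
    assume "bounded (\<Psi> ` upper_half_plane)"
    then obtain M where M: "\<And>z. z \<in> upper_half_plane \<Longrightarrow> cmod (\<Psi> z) \<le> M" by (auto simp: bounded_iff)
    have "real K / 2 \<le> M * 9" for K
    proof -
      define z where "z = Complex 0 ((1/2) ^ K)"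
      have z: "z \<in> upper_half_plane" by (simp add: z_def)
      have ne: "T.u z + \<i> \<noteq> 0" by (rule T.u_plus_i_nonzero[OF z])
      have M0: "0 \<le> M" using order_trans[OF norm_ge_zero M[OF z]] .
      have "real K / 2 \<le> Re (B.u z + \<i>)" using u_asymmetric_large[of K] by (simp add: z_def)
      also have "\<dots> \<le> cmod (B.u z + \<i>)" by (rule complex_Re_le_cmod)
      also have "\<dots> = cmod (\<Psi> z) * cmod (T.u z + \<i>)" using ne by (simp add: \<Psi>_def norm_divide)
      also have "\<dots> \<le> M * (8 + 1)"
        using M[OF z] M0 u_symmetric_bounded[of "(1/2) ^ K"] norm_triangle_ineq[of "T.u z" \<i>]
        by (intro mult_mono) (auto simp: z_def)
      finally show ?thesis by simp
    qed
    note le = this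
    obtain K :: nat where K: "M * 18 < real K" using reals_Archimedean2 by blast
    show False using le[of K] K by linarith
  qed
  moreover have "mult_image \<Psi> (model_space B.U) = model_space T.U"
    unfolding \<Psi>_def
    by (rule mult_image_model_space[OF B.atoms_axioms T.atoms_axioms, where ?C1.0 = 2 and ?C2.0 = 1])
       (auto simp: mass_def)
  ultimately show ?thesis
    using B.U_inner B.U_nonconstant T.U_inner T.U_nonconstant by blast
qed

end
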